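(* The fair liveness verification problem for broadcast networks is in $\mathsf{P}$: given a broadcast network $\mathcal{N}=(D,P)$ with client $P=(Q,I,\delta)$ and a set $F\subseteq Q$ of final states, it can be decided in polynomial time whether there exists an infinite initialized computation $\pi$ of $\mathcal{N}$ with $\mathrm{Inf}(\pi)\subseteq\mathrm{Fin}(\pi)$.
   Context: A broadcast network is a pair $\mathcal{N}=(D,P)$ where $D$ is a finite set of messages and $P=(Q,I,\delta)$ is a finite automaton with initial states $I$ and $\delta\subseteq Q\times\mathrm{Ops}(D)\times Q$, $\mathrm{Ops}(D)=\{!a,\ ?a: a\in D\}$; write $q\xrightarrow{o}q'$ for $(q,o,q')\in\delta$. A configuration is $c\in Q^k$ for some $k$, with entries $c[i]$; initial configurations are those in $\bigcup_k I^k$. For $c,c'\in Q^k$ and $a\in D$, $c\xrightarrow{a}c'$ holds if there is $i$ with $c[i]\xrightarrow{!a}c'[i]$, a set $R\subseteq[1..k]\setminus\{i\}$ with $c[j]\xrightarrow{?a}c'[j]$ for $j\in R$, and $c[j]=c'[j]$ for $j\notin R\cup\{i\}$; then $\mathrm{type}(c\xrightarrow{a}c')=R\cup\{i\}$. An infinite computation $\pi=c_0\to c_1\to\cdots$ is initialized if $c_0$ is initial. $\mathrm{Inf}(\pi)=\{i: i\in\mathrm{type}(c_j\to c_{j+1})\text{ for infinitely many } j\}$ and $\mathrm{Fin}(\pi)=\{i: c_j[i]\in F\text{ for infinitely many } j\}$. *)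

theory Defs
  imports Main
begin

datatype 'd bop = Snd 'd | Rcv 'd

text \<open>A client automaton is given by its initial states I and transition relation delta
  (a set of triples (q, op, q')). Configurations are lists of states.
  bstep delta c a T c' : the broadcast step c --a--> c' with type T = R \<union> {i}.\<close>

definition bstep :: "('q \<times> 'd bop \<times> 'q) set \<Rightarrow> 'q list \<Rightarrow> 'd \<Rightarrow> nat set \<Rightarrow> 'q list \<Rightarrow> bool" where
  "bstep delta c a T c' \<longleftrightarrow>
     length c' = length c \<and> T \<subseteq> {..<length c} \<and>
     (\<exists>i\<in>T. (c ! i, Snd a, c' ! i) \<in> delta \<and>
        (\<forall>j\<in>T - {i}. (c ! j, Rcv a, c' ! j) \<in> delta)) \<and>
     (\<forall>j<length c. j \<notin> T \<longrightarrow> c ! j = c' ! j)"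

definition is_computation :: "('q \<times> 'd bop \<times> 'q) set \<Rightarrow> (nat \<Rightarrow> 'q list) \<Rightarrow> (nat \<Rightarrow> 'd) \<Rightarrow> (nat \<Rightarrow> nat set) \<Rightarrow> bool" where
  "is_computation delta cs as ts \<longleftrightarrow> (\<forall>j. bstep delta (cs j) (as j) (ts j) (cs (Suc j)))"

definition initialized :: "'q set \<Rightarrow> (nat \<Rightarrow> 'q list) \<Rightarrow> bool" where
  "initialized I cs \<longleftrightarrow> set (cs 0) \<subseteq> I"

definition Inf_set :: "(nat \<Rightarrow> nat set) \<Rightarrow> nat set" where
  "Inf_set ts = {i. infinite {j. i \<in> ts j}}"

definition Fin_set :: "'q set \<Rightarrow> (nat \<Rightarrow> 'q list) \<Rightarrow> nat set" where
  "Fin_set F cs = {i. infinite {j. i < length (cs j) \<and> cs j ! i \<in> F}}"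

definition fair_live :: "'q set \<Rightarrow> ('q \<times> 'd bop \<times> 'q) set \<Rightarrow> 'q set \<Rightarrow> bool" where
  "fair_live I delta F \<longleftrightarrow>
     (\<exists>cs as ts. is_computation delta cs as ts \<and> initialized I cs \<and> Inf_set ts \<subseteq> Fin_set F cs)"

fun bop_msg :: "'d bop \<Rightarrow> 'd" where
  "bop_msg (Snd a) = a" | "bop_msg (Rcv a) = a"

definition valid_instance :: "nat \<Rightarrow> nat \<Rightarrow> nat list \<Rightarrow> (nat \<times> nat bop \<times> nat) list \<Rightarrow> nat list \<Rightarrow> bool" where
  "valid_instance n m I T F \<longleftrightarrow>
     set I \<subseteq> {..<n} \<and> set F \<subseteq> {..<n} \<and>
     (\<forall>(q, op, q') \<in> set T. q < n \<and> q' < n \<and> bop_msg op < m)"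

definition enc_nat :: "nat \<Rightarrow> nat list" where
  "enc_nat k = replicate k 1 @ [2]"

definition enc_nats :: "nat list \<Rightarrow> nat list" where
  "enc_nats xs = concat (map enc_nat xs) @ [3]"

fun trans_nats :: "nat \<times> nat bop \<times> nat \<Rightarrow> nat list" where
  "trans_nats (q, Snd a, q') = [q, 0, a, q']"
| "trans_nats (q, Rcv a, q') = [q, 1, a, q']"

definition enc_instance :: "nat \<Rightarrow> nat \<Rightarrow> nat list \<Rightarrow> (nat \<times> nat bop \<times> nat) list \<Rightarrow> nat list \<Rightarrow> nat list" where
  "enc_instance n m I T F =
     enc_nat n @ enc_nat m @ enc_nats I @ enc_nats (concat (map trans_nats T)) @ enc_nats F"

text \<open>States and symbols are naturals; blank = 0; start state 0, accept 1, reject 2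
  (halting, absorbing). A configuration (q, ls, h, rs): ls is the reversed left part,
  h the scanned symbol, rs the right part; the tape is two-way infinite.\<close>

datatype dir = Lft | Rgt | Stay

type_synonym tm = "nat \<Rightarrow> nat \<Rightarrow> nat \<times> nat \<times> dir"
type_synonym tm_conf = "nat \<times> nat list \<times> nat \<times> nat list"

text \<open>Finiteness: the machine uses only states and symbols below N (N > 3 so the input alphabet fits).\<close>
definition tm_wf :: "nat \<Rightarrow> tm \<Rightarrow> bool" where
  "tm_wf N M \<longleftrightarrow> 3 < N \<and>
     (\<forall>q<N. \<forall>s<N. fst (M q s) < N \<and> fst (snd (M q s)) < N)"

fun tm_step :: "tm \<Rightarrow> tm_conf \<Rightarrow> tm_conf" where
  "tm_step M (q, ls, h, rs) =
     (if q = 1 \<or> q = 2 then (q, ls, h, rs)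
      else (case M q h of (q', w, d) \<Rightarrow>
        (case d of
           Stay \<Rightarrow> (q', ls, w, rs)
         | Lft \<Rightarrow> (case ls of [] \<Rightarrow> (q', [], 0, w # rs) | x # ls' \<Rightarrow> (q', ls', x, w # rs))
         | Rgt \<Rightarrow> (case rs of [] \<Rightarrow> (q', w # ls, 0, []) | x # rs' \<Rightarrow> (q', w # ls, x, rs')))))"

fun tm_init :: "nat list \<Rightarrow> tm_conf" where
  "tm_init [] = (0, [], 0, [])"
| "tm_init (x # xs) = (0, [], x, xs)"

definition tm_decides_within :: "tm \<Rightarrow> nat \<Rightarrow> nat list \<Rightarrow> bool \<Rightarrow> bool" where
  "tm_decides_within M t0 w b \<longleftrightarrow>
     (\<exists>t\<le>t0. fst ((tm_step M ^^ t) (tm_init w)) = (if b then 1 else 2))"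

end

theory Submission
  imports Defs "HOL-Library.Nat_Bijection" "HOL-Library.Infinite_Set"
begin

text \<open>A transition is fireable if its source state can be covered and its message can be sent; by
  copying clients, any number of clients can be brought into coverable states simultaneously. There
  is a fair computation iff there is a nonempty set \<open>X\<close> of fireable transitions such that every
  message of \<open>X\<close> is sent by a transition of \<open>X\<close> and every transition of \<open>X\<close> lies on a closed walk
  within \<open>X\<close> through a final state: the transitions used infinitely often form such a set, and
  conversely the clients can rotate along the closed walks forever. The largest candidate for \<open>X\<close> is
  a greatest fixed point whose body contains least fixed points for the walks.

  Polynomial time comes from the easy half of the Immerman-Vardi theorem: properties of words that
  are definable in first-order logic with least fixed points of sets of positions, extended by
  an equality test for unary blocks, are decided by a single-tape machine. Position variables and set
  variables are bit tracks of the tape, and all loops run over the positions of the input word.\<close>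

subsection \<open>Self-supporting sets of transitions\<close>

text \<open>A broadcast forces nobody to receive, so clients can be added beside a computation
  without disturbing it. Fireability therefore depends on which states can be covered and never on
  how many clients cover them, and sets replace the infinite space of configurations. Indices are
  used in place of triples because they become positions of the input word: every fixed point is
  then a set of positions, that is, one bit per tape cell. The greatest fixed point is computed as
  the complement of a least one, the set of transitions that must be discarded, so a single
  iteration scheme serves all fixed points. State and message numbers are unbounded whereas alphabet
  and number of tracks are fixed. Equality of two numbers is therefore decided by moving two markers
  in parallel along their unary blocks.\<close>

text \<open>Indices \<open>p \<in> P\<close> stand for the transitions \<open>(src p, opr p, tgt p)\<close>.\<close>

locale client =
  fixes P :: "'p set" and src :: "'p \<Rightarrow> 'q" and opr :: "'p \<Rightarrow> 'd bop" and tgt :: "'p \<Rightarrow> 'q"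
    and I :: "'q set" and F :: "'q set"
  assumes finite_P: "finite P"
begin

definition delta :: "('q \<times> 'd bop \<times> 'q) set" where
  "delta = (\<lambda>p. (src p, opr p, tgt p)) ` P"

definition sends :: "'p \<Rightarrow> 'd \<Rightarrow> bool" where
  "sends p a \<longleftrightarrow> opr p = Snd a"

text \<open>\<open>sends p (bop_msg (opr p))\<close> says that \<open>p\<close> is itself a send. A
  send needs no partner, because the set of receivers may be empty.\<close>

definition enabling :: "'p set \<Rightarrow> 'p set" where
  "enabling X = {p \<in> P. (src p \<in> I \<or> (\<exists>u\<in>X. tgt u = src p)) \<and>
     (sends p (bop_msg (opr p)) \<or> (\<exists>z\<in>X. sends z (bop_msg (opr p))))}"

definition En :: "'p set" where
  "En = lfp enabling"

lemma mono_enabling: "mono enabling"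
  unfolding mono_def enabling_def by blast

lemma En_unfold: "En = enabling En"
  unfolding En_def by (rule lfp_unfold[OF mono_enabling])

lemma En:
  assumes "p \<in> P" and "src p \<in> I \<or> (\<exists>u\<in>En. tgt u = src p)"
    and "sends p (bop_msg (opr p)) \<or> (\<exists>z\<in>En. sends z (bop_msg (opr p)))"
  shows "p \<in> En"
  using assms by (subst En_unfold) (simp add: enabling_def)

lemma En_subset: "En \<subseteq> P"
  by (subst En_unfold) (auto simp: enabling_def)

definition succ_rel :: "'p set \<Rightarrow> ('p \<times> 'p) set" where
  "succ_rel X = {(u, v). u \<in> X \<and> v \<in> X \<and> tgt u = src v}"

text \<open>The closed walk through \<open>t\<close> is cut at \<open>v\<close>, where the final
  state occurs as a source, and at \<open>u\<close>, whose target leads back to \<open>t\<close>.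
  Reflexivity admits the loop consisting of \<open>t\<close> alone.\<close>

definition good :: "'p set \<Rightarrow> 'p \<Rightarrow> bool" where
  "good X t \<longleftrightarrow> (\<exists>z\<in>X. sends z (bop_msg (opr t))) \<and>
     (\<exists>v u. (t, v) \<in> (succ_rel X)\<^sup>* \<and> src v \<in> F \<and> (v, u) \<in> (succ_rel X)\<^sup>* \<and> tgt u = src t)"

definition Rch :: "'q set" where
  "Rch = I \<union> tgt ` En"

subsection \<open>From a fair computation to a self-supporting set of transitions\<close>

context
  fixes cs :: "nat \<Rightarrow> 'q list" and as :: "nat \<Rightarrow> 'd" and ts :: "nat \<Rightarrow> nat set"
  assumes comp: "is_computation delta cs as ts" and init: "initialized I cs"
begin

text \<open>Only the message of the operation is fixed, so a sending client may also be matched with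
  a receiving transition that has the same source and target. This does no harm, since
  \<open>ex_sender\<close> supplies a genuine sender for every step.\<close>

definition used :: "'p \<Rightarrow> nat \<Rightarrow> nat \<Rightarrow> bool" where
  "used p i j \<longleftrightarrow> p \<in> P \<and> i \<in> ts j \<and> src p = cs j ! i \<and> tgt p = cs (Suc j) ! i \<and> bop_msg (opr p) = as j"

lemma step: "bstep delta (cs j) (as j) (ts j) (cs (Suc j))"
  using comp by (simp add: is_computation_def)

lemma length_cs: "length (cs j) = length (cs 0)"
  by (induction j) (use step in \<open>auto simp: bstep_def\<close>)

lemma ts_less: "i \<in> ts j \<Longrightarrow> i < length (cs 0)"
  using step[of j] length_cs[of j] by (auto simp: bstep_def)

lemma ex_used: "i \<in> ts j \<Longrightarrow> \<exists>p. used p i j"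
proof -
  assume i: "i \<in> ts j"
  obtain i0 where i0: "i0 \<in> ts j" "(cs j ! i0, Snd (as j), cs (Suc j) ! i0) \<in> delta"
    "\<forall>i\<in>ts j - {i0}. (cs j ! i, Rcv (as j), cs (Suc j) ! i) \<in> delta"
    using step[of j] unfolding bstep_def by blast
  then have "\<exists>b\<in>{Snd (as j), Rcv (as j)}. (cs j ! i, b, cs (Suc j) ! i) \<in> delta"
    using i by (cases "i = i0") auto
  then obtain p where "p \<in> P" "src p = cs j ! i" "bop_msg (opr p) = as j" "tgt p = cs (Suc j) ! i"
    unfolding delta_def by fastforce
  then show ?thesis using i by (auto simp: used_def)
qed

lemma ex_sender: "\<exists>p i. used p i j \<and> sends p (as j)"
proof -
  obtain i where i: "i \<in> ts j" "(cs j ! i, Snd (as j), cs (Suc j) ! i) \<in> delta"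
    using step[of j] unfolding bstep_def by blast
  then obtain p where "p \<in> P" "src p = cs j ! i" "opr p = Snd (as j)" "tgt p = cs (Suc j) ! i"
    by (auto simp: delta_def)
  then show ?thesis using i by (intro exI[of _ p] exI[of _ i]) (auto simp: used_def sends_def)
qed

lemma not_moved: "i < length (cs 0) \<Longrightarrow> i \<notin> ts j \<Longrightarrow> cs (Suc j) ! i = cs j ! i"
  using step[of j] length_cs[of j] by (auto simp: bstep_def)

text \<open>Within a step the sender comes first: a send depends on its source only, and it then
  provides the message for all transitions used in that step. The bound on the states carries the
  induction to the next step.\<close>

lemma used_En: "(\<forall>p i. used p i j \<longrightarrow> p \<in> En) \<and> set (cs j) \<subseteq> Rch"
proof (induction j)
  have En_if: "\<forall>p i. used p i j \<longrightarrow> p \<in> En" if R: "set (cs j) \<subseteq> Rch" for j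
  proof (intro allI impI)
    fix p i assume u: "used p i j"
    have src: "src q \<in> I \<or> (\<exists>u\<in>En. tgt u = src q)" if "used q k j" for q k
    proof -
      have "src q \<in> set (cs j)" using that ts_less[of k j] length_cs[of j] by (auto simp: used_def)
      then show ?thesis using R unfolding Rch_def by fastforce
    qed
    obtain z k where z: "used z k j" "sends z (as j)" using ex_sender by blast
    have "z \<in> En" using z src[OF z(1)] by (intro En) (auto simp: used_def sends_def)
    then show "p \<in> En" using u src[OF u] z by (intro En) (auto simp: used_def)
  qed
  case 0
  have "set (cs 0) \<subseteq> Rch" using init by (auto simp: initialized_def Rch_def)
  then show ?case using En_if by blast
  case (Suc j)
  have "set (cs (Suc j)) \<subseteq> Rch"
  proof
    fix q assume "q \<in> set (cs (Suc j))"
    then obtain i where i: "i < length (cs 0)" "q = cs (Suc j) ! i"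
      by (metis in_set_conv_nth length_cs)
    show "q \<in> Rch"
    proof (cases "i \<in> ts j")
      case True
      then obtain p where p: "used p i j" using ex_used by blast
      then have "p \<in> En" using Suc by blast
      then have "tgt p \<in> Rch" unfolding Rch_def by blast
      then show ?thesis using p i by (simp add: used_def)
    next
      case False
      then have "q \<in> set (cs j)" using not_moved i length_cs[of j] by auto
      then show ?thesis using Suc by blast
    qed
  qed
  then show ?case using En_if by blast
qed

lemma inf_pigeonhole:
  assumes "infinite {j. \<exists>y\<in>Y. R y j}" and "finite Y"
  shows "\<exists>y\<in>Y. infinite {j::nat. R y j}"
proof (rule ccontr)
  assume "\<not> ?thesis"
  then have "finite (\<Union>y\<in>Y. {j. R y j})" using assms(2) by blast
  moreover have "(\<Union>y\<in>Y. {j. R y j}) = {j. \<exists>y\<in>Y. R y j}" by blast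
  ultimately show False using assms(1) by simp
qed

text \<open>From some time \<open>J\<close> on only transitions of \<open>X\<close> occur, so the
  later history of a single client is a walk in \<open>succ_rel X\<close>. A client that takes
  \<open>t\<close> infinitely often visits \<open>F\<close> infinitely often by fairness, and its
  history between two uses of \<open>t\<close> around such a visit is the required closed
  walk.\<close>

lemma exists_good_set:
  assumes fair: "Inf_set ts \<subseteq> Fin_set F cs"
  shows "\<exists>X\<subseteq>En. X \<noteq> {} \<and> (\<forall>t\<in>X. good X t)"
proof -
  let ?k = "length (cs 0)"
  define X where "X = {p \<in> P. infinite {j. \<exists>i. used p i j}}"
  have "X \<subseteq> En"
  proof
    fix p assume "p \<in> X"
    then have "{j. \<exists>i. used p i j} \<noteq> {}" by (auto simp: X_def dest: infinite_imp_nonempty)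
    then show "p \<in> En" using used_En by blast
  qed
  \<comment> \<open>\<open>P\<close> is finite, so among infinitely many uses with property
    \<open>R\<close> one index recurs infinitely often. \<open>S\<close> restricts the times that
    are looked at.\<close>
  have XI: "\<exists>p\<in>X. R p" if "infinite {j. \<exists>p i. used p i j \<and> R p \<and> S j}" for R S
  proof -
    have "\<exists>p\<in>P. infinite {j. \<exists>i. used p i j \<and> R p \<and> S j}"
    proof (rule inf_pigeonhole[OF _ finite_P])
      show "infinite {j. \<exists>y\<in>P. \<exists>i. used y i j \<and> R y \<and> S j}"
        by (rule infinite_super[OF _ that]) (auto simp: used_def)
    qed
    then obtain p where p: "p \<in> P" "infinite {j. \<exists>i. used p i j \<and> R p \<and> S j}" by blast
    then have "R p" by (auto dest: infinite_imp_nonempty)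
    moreover have "infinite {j. \<exists>i. used p i j}"
      by (rule infinite_super[OF _ p(2)]) auto
    ultimately show ?thesis using p(1) by (auto simp: X_def)
  qed
  have "X \<noteq> {}"
  proof -
    have "{j. \<exists>p i. used p i j \<and> True \<and> True} = UNIV" using ex_sender by blast
    then show ?thesis using XI[of "\<lambda>_. True" "\<lambda>_. True"] by auto
  qed
  have "finite {j. \<exists>p\<in>P - X. \<exists>i. used p i j}"
    using inf_pigeonhole[of "P - X" "\<lambda>p j. \<exists>i. used p i j"] finite_P by (auto simp: X_def)
  then obtain J where J: "\<And>j p i. J \<le> j \<Longrightarrow> used p i j \<Longrightarrow> p \<in> X"
  proof -
    obtain J where "\<forall>j\<in>{j. \<exists>p\<in>P - X. \<exists>i. used p i j}. j < J"
      using that \<open>finite {j. \<exists>p\<in>P - X. \<exists>i. used p i j}\<close> finite_nat_set_iff_bounded by auto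
    then show thesis using that[of J] by (force simp: used_def)
  qed
  \<comment> \<open>\<open>v\<close> is the last transition that the client has taken; it is kept
    while the client is idle.\<close>
  have walk: "\<exists>v. (u, v) \<in> (succ_rel X)\<^sup>* \<and> tgt v = cs (Suc (j + n)) ! i"
    if "J \<le> j" "used u i j" for u i j n
  proof (induction n)
    case 0
    then show ?case using that by (auto simp: used_def)
  next
    case (Suc n)
    then obtain v where v: "(u, v) \<in> (succ_rel X)\<^sup>*" "tgt v = cs (Suc (j + n)) ! i" by blast
    have i: "i < ?k" using that ts_less by (auto simp: used_def)
    show ?case
    proof (cases "i \<in> ts (Suc (j + n))")
      case True
      then obtain p where p: "used p i (Suc (j + n))" using ex_used by blast
      have "p \<in> X" using J[OF _ p] that(1) by simp
      moreover have "v \<in> X"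
        using v(1) J[OF that] by (cases rule: rtranclE) (auto simp: succ_rel_def)
      ultimately have "(v, p) \<in> succ_rel X" using p v(2) by (auto simp: succ_rel_def used_def)
      then show ?thesis using v p by (intro exI[of _ p]) (auto simp: used_def)
    next
      case False
      then show ?thesis using v not_moved[OF i] by auto
    qed
  qed
  have "good X t" if t: "t \<in> X" for t
  proof -
    have inf: "infinite {j. \<exists>i. used t i j}" using t by (simp add: X_def)
    have snd: "\<exists>z\<in>X. sends z (bop_msg (opr t))"
    proof (rule XI[of _ "\<lambda>j. \<exists>i. used t i j"])
      show "infinite {j. \<exists>p i. used p i j \<and> sends p (bop_msg (opr t)) \<and> (\<exists>i. used t i j)}"
      proof (rule infinite_super[OF _ inf], safe)
        fix j i assume u: "used t i j"
        then have "bop_msg (opr t) = as j" by (simp add: used_def)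
        then show "\<exists>p i. used p i j \<and> sends p (bop_msg (opr t)) \<and> (\<exists>i. used t i j)"
          using ex_sender[of j] u by auto
      qed
    qed
    \<comment> \<open>Fairness speaks of individual clients. There are finitely many, so one of them
      takes \<open>t\<close> infinitely often.\<close>
    have "\<exists>i\<in>{..<?k}. infinite {j. used t i j}"
      by (rule inf_pigeonhole, rule infinite_super[OF _ inf]) (auto simp: used_def dest: ts_less)
    then obtain i where i: "i < ?k" "infinite {j. used t i j}" by blast
    have "infinite {j. i \<in> ts j}"
      by (rule infinite_super[OF _ i(2)]) (auto simp: used_def)
    then have iF: "infinite {j. i < length (cs j) \<and> cs j ! i \<in> F}"
      using fair by (auto simp: Inf_set_def Fin_set_def)
    obtain j1 where j1: "J \<le> j1" "used t i j1"
      using i(2) unfolding infinite_nat_iff_unbounded_le by blast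
    obtain j2 where j2: "Suc j1 \<le> j2" "cs j2 ! i \<in> F"
      using iF unfolding infinite_nat_iff_unbounded_le by blast
    obtain j3 where j3: "Suc j2 \<le> j3" "used t i j3"
      using i(2) unfolding infinite_nat_iff_unbounded_le by blast
    \<comment> \<open>the first transition taken from time \<open>j2\<close> on starts in \<open>F\<close>\<close>
    define j where "j = (LEAST j. j2 \<le> j \<and> i \<in> ts j)"
    have ex: "j2 \<le> j3 \<and> i \<in> ts j3" using j3 by (auto simp: used_def)
    have j: "j2 \<le> j" "i \<in> ts j" and "j \<le> j3"
      using LeastI[of "\<lambda>j. j2 \<le> j \<and> i \<in> ts j", OF ex] Least_le[of "\<lambda>j. j2 \<le> j \<and> i \<in> ts j", OF ex]
      by (auto simp: j_def)
    have "j2 + n \<le> j \<Longrightarrow> cs (j2 + n) ! i = cs j2 ! i" for n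
    proof (induction n)
      case (Suc n)
      then have "i \<notin> ts (j2 + n)"
        using not_less_Least[of "j2 + n" "\<lambda>j. j2 \<le> j \<and> i \<in> ts j"] by (auto simp: j_def)
      then show ?case using not_moved[OF i(1)] Suc by auto
    qed simp
    from this[of "j - j2"] have jF: "cs j ! i \<in> F" using j(1) j2 by simp
    obtain v where v: "used v i j" using ex_used j(2) by blast
    obtain u where u: "(t, u) \<in> (succ_rel X)\<^sup>*" "tgt u = cs j ! i"
      using walk[OF j1, of "j - Suc j1"] j(1) j2(1) by auto
    have "v \<in> X" using J[OF _ v] j1 j2 j by simp
    moreover have "u \<in> X"
      using u(1) t by (cases rule: rtranclE) (auto simp: succ_rel_def)
    ultimately have "(u, v) \<in> succ_rel X" using u v by (auto simp: succ_rel_def used_def)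
    then have tv: "(t, v) \<in> (succ_rel X)\<^sup>*" using u by auto
    \<comment> \<open>\<open>walk\<close> describes states after step \<open>j\<close> only. If step
      \<open>j\<close> is itself the use of \<open>t\<close> at \<open>j3\<close>, the return to the
      source of \<open>t\<close> is read off at a later use \<open>j4\<close>.\<close>
    have "\<exists>w. (v, w) \<in> (succ_rel X)\<^sup>* \<and> tgt w = src t"
    proof (cases "j = j3")
      case True
      obtain j4 where j4: "Suc j \<le> j4" "used t i j4"
        using i(2) unfolding infinite_nat_iff_unbounded_le by blast
      then show ?thesis using walk[OF _ v, of "j4 - Suc j"] j1 j2 j by (auto simp: used_def)
    next
      case False
      then show ?thesis using walk[OF _ v, of "j3 - Suc j"] j1 j2 j j3 \<open>j \<le> j3\<close> by (auto simp: used_def)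
    qed
    then show ?thesis
      using snd tv v jF unfolding good_def by (auto simp: used_def)
  qed
  then show ?thesis using \<open>X \<subseteq> En\<close> \<open>X \<noteq> {}\<close> by blast
qed

end

subsection \<open>From a self-supporting set of transitions to a fair computation\<close>

definition bs :: "'q list \<Rightarrow> 'q list \<Rightarrow> bool" where
  "bs c c' \<longleftrightarrow> (\<exists>a T. bstep delta c a T c')"

definition reachable :: "'q list set" where
  "reachable = {c. \<exists>c0. set c0 \<subseteq> I \<and> bs\<^sup>*\<^sup>* c0 c}"

lemma bstep_append1: "bstep delta c a T c' \<Longrightarrow> bstep delta (c @ e) a T (c' @ e)"
  unfolding bstep_def by (fastforce simp: nth_append)

lemma bstep_append2:
  assumes "bstep delta c a T c'"
  shows "bstep delta (e @ c) a ((+) (length e) ` T) (e @ c')"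
proof -
  have T: "T \<subseteq> {..<length c}" and l: "length c' = length c" using assms by (auto simp: bstep_def)
  obtain i where i: "i \<in> T" "(c ! i, Snd a, c' ! i) \<in> delta"
    "\<forall>j\<in>T - {i}. (c ! j, Rcv a, c' ! j) \<in> delta" using assms by (auto simp: bstep_def)
  have idle: "c ! j = c' ! j" if "j < length c" "j \<notin> T" for j using assms that by (auto simp: bstep_def)
  have "(e @ c) ! j = (e @ c') ! j" if "j < length (e @ c)" "j \<notin> (+) (length e) ` T" for j
  proof (cases "j < length e")
    case False
    then have "j - length e \<notin> T" using that by (metis image_eqI le_add_diff_inverse not_less)
    then show ?thesis using idle[of "j - length e"] that False by (auto simp: nth_append)
  qed (simp add: nth_append)
  then show ?thesis
    unfolding bstep_def using T l i by (auto intro!: bexI[of _ i])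
qed

lemma reachable_step: "c \<in> reachable \<Longrightarrow> bstep delta c a T c' \<Longrightarrow> c' \<in> reachable"
  unfolding reachable_def bs_def by (auto intro: rtranclp.rtrancl_into_rtrancl)

text \<open>Two computations can be run one after the other on disjoint groups of clients, each
  group staying silent and deaf while the other moves.\<close>

lemma reachable_append:
  assumes "c \<in> reachable" and "d \<in> reachable"
  shows "c @ d \<in> reachable"
proof -
  obtain c0 d0 where c0: "set c0 \<subseteq> I" "bs\<^sup>*\<^sup>* c0 c" and d0: "set d0 \<subseteq> I" "bs\<^sup>*\<^sup>* d0 d"
    using assms by (auto simp: reachable_def)
  have "bs\<^sup>*\<^sup>* (c0 @ d0) (c @ d0)"
    using c0(2) by induction (auto simp: bs_def intro: bstep_append1 rtranclp.rtrancl_into_rtrancl)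
  moreover have "bs\<^sup>*\<^sup>* (c @ d0) (c @ d)"
    using d0(2) by induction (auto simp: bs_def intro: bstep_append2 rtranclp.rtrancl_into_rtrancl)
  ultimately show ?thesis using c0(1) d0(1) unfolding reachable_def
    by (auto intro!: exI[of _ "c0 @ d0"])
qed

definition coverable :: "'q \<Rightarrow> bool" where
  "coverable q \<longleftrightarrow> (\<exists>c\<in>reachable. q \<in> set c)"

text \<open>Induction along the fixed point. For a receive, a configuration covering its source is
  placed beside one covering the source of a matching send, and both clients move in one
  broadcast.\<close>

lemma coverable_En:
  assumes "p \<in> En"
  shows "coverable (src p) \<and> coverable (tgt p)"
proof (rule def_lfp_induct_set[OF eq_reflection[OF En_def] mono_enabling assms,
    where P = "\<lambda>p. coverable (src p) \<and> coverable (tgt p)"])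
  fix p assume "p \<in> enabling (En \<inter> {p. coverable (src p) \<and> coverable (tgt p)})"
  then have p: "p \<in> P" "src p \<in> I \<or> coverable (src p)"
    and z: "sends p (bop_msg (opr p)) \<or> (\<exists>z\<in>En. coverable (src z) \<and> sends z (bop_msg (opr p)))"
    by (auto simp: enabling_def)
  have "[src p] \<in> reachable" if "src p \<in> I"
    unfolding reachable_def using that by (auto intro!: exI[of _ "[src p]"])
  then have src: "coverable (src p)" using p unfolding coverable_def by (metis list.set_intros(1))
  then obtain c i where c: "c \<in> reachable" "i < length c" "c ! i = src p"
    by (auto simp: coverable_def in_set_conv_nth)
  define a where "a = bop_msg (opr p)"
  have in_delta: "(src q, opr q, tgt q) \<in> delta" if "q \<in> P" for q
    using that by (auto simp: delta_def)
  have "coverable (tgt p)"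
  proof (cases "sends p a")
    case True
    then have "bstep delta c a {i} (c[i := tgt p])"
      using c in_delta[OF p(1)] by (auto simp: bstep_def sends_def)
    then have "c[i := tgt p] \<in> reachable" using c reachable_step by blast
    then show ?thesis using c set_update_memI[of i c] unfolding coverable_def by blast
  next
    case False
    then have opr: "opr p = Rcv a" by (cases "opr p") (auto simp: sends_def a_def)
    obtain z where z: "z \<in> En" "coverable (src z)" "sends z a" using z False by (auto simp: a_def)
    then obtain d k where d: "d \<in> reachable" "k < length d" "d ! k = src z"
      by (auto simp: coverable_def in_set_conv_nth)
    let ?k = "length c + k"
    have "(src z, Snd a, tgt z) \<in> delta"
      using in_delta[of z] z En_subset by (auto simp: sends_def)
    then have "bstep delta (c @ d) a {i, ?k} ((c @ d)[i := tgt p, ?k := tgt z])"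
      using c d in_delta[OF p(1)] opr unfolding bstep_def by (auto simp: nth_append nth_list_update)
    then have "(c @ d)[i := tgt p, ?k := tgt z] \<in> reachable"
      using reachable_step[OF reachable_append[OF c(1) d(1)]] by blast
    moreover have "(c @ d)[i := tgt p, ?k := tgt z] ! i = tgt p"
      using c by simp
    then have "tgt p \<in> set ((c @ d)[i := tgt p, ?k := tgt z])"
      using c by (metis length_append length_list_update nth_mem trans_less_add1)
    ultimately show ?thesis unfolding coverable_def by blast
  qed
  then show "coverable (src p) \<and> coverable (tgt p)" using src by blast
qed

text \<open>One covering configuration per member of \<open>A\<close> is put side by side.
  Injectivity of \<open>e\<close> gives each member a client of its own, even where \<open>q\<close>
  repeats a state.\<close>

lemma cover_family:
  assumes "finite A" and "\<forall>a\<in>A. coverable (q a)"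
  shows "\<exists>c\<in>reachable. \<exists>e. inj_on e A \<and> (\<forall>a\<in>A. e a < length c \<and> c ! e a = q a)"
  using assms
proof induction
  case empty
  have "[] \<in> reachable" unfolding reachable_def by (auto intro!: exI[of _ "[]"])
  then show ?case by auto
next
  case (insert a A)
  obtain c e where c: "c \<in> reachable" and e: "inj_on e A" "\<forall>a\<in>A. e a < length c \<and> c ! e a = q a"
    using insert by auto
  obtain d k where d: "d \<in> reachable" "k < length d" "d ! k = q a"
    using insert by (auto simp: coverable_def in_set_conv_nth)
  let ?e = "\<lambda>b. if b = a then k else length d + e b"
  have "inj_on ?e (insert a A)"
    using e(1) d(2) insert.hyps(2) by (auto simp: inj_on_def)
  moreover have "\<forall>b\<in>insert a A. ?e b < length (d @ c) \<and> (d @ c) ! ?e b = q b"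
    using e d by (auto simp: nth_append)
  ultimately show ?case using reachable_append[OF d(1) c] by blast
qed

section \<open>Fair continuations and closed walks\<close>

definition fair_from :: "'q list \<Rightarrow> bool" where
  "fair_from c \<longleftrightarrow> (\<exists>cs as ts. is_computation delta cs as ts \<and> cs 0 = c \<and> Inf_set ts \<subseteq> Fin_set F cs)"

lemma infinite_case_nat: "infinite {j. R (case_nat x f j)} \<longleftrightarrow> infinite {j. R (f j)}"
proof -
  have *: "{j. R (case_nat x f j)} = (if R x then {0} else {}) \<union> Suc ` {j. R (f j)}"
    by (rule set_eqI, rename_tac j, case_tac j) auto
  show ?thesis unfolding * by (auto simp: finite_image_iff)
qed

text \<open>Both \<open>Inf_set\<close> and \<open>Fin_set\<close> ask for infinitely many times, so
  prepending one step changes neither.\<close>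

lemma fair_from_step:
  assumes "bs c c'" and "fair_from c'"
  shows "fair_from c"
proof -
  obtain a T where aT: "bstep delta c a T c'" using assms(1) by (auto simp: bs_def)
  obtain cs as ts where r: "is_computation delta cs as ts" "cs 0 = c'" "Inf_set ts \<subseteq> Fin_set F cs"
    using assms(2) by (auto simp: fair_from_def)
  have "is_computation delta (case_nat c cs) (case_nat a as) (case_nat T ts)"
    using aT r by (auto simp: is_computation_def split: nat.splits)
  moreover have "Inf_set (case_nat T ts) = Inf_set ts" "Fin_set F (case_nat c cs) = Fin_set F cs"
    unfolding Inf_set_def Fin_set_def
    using infinite_case_nat[of "\<lambda>t. i \<in> t" T ts for i]
      infinite_case_nat[of "\<lambda>c. i < length c \<and> c ! i \<in> F" c cs for i] by blast+
  ultimately show ?thesis using r(3) unfolding fair_from_def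
    by (intro exI[of _ "case_nat c cs"] exI[of _ "case_nat a as"] exI[of _ "case_nat T ts"]) auto
qed

lemma fair_live_if_fair_from:
  assumes "c \<in> reachable" and "fair_from c"
  shows "fair_live I delta F"
proof -
  obtain c0 where c0: "set c0 \<subseteq> I" "bs\<^sup>*\<^sup>* c0 c" using assms(1) by (auto simp: reachable_def)
  have "fair_from c0"
    using c0(2) assms(2) by (induction rule: converse_rtranclp_induct) (auto intro: fair_from_step)
  then show ?thesis using c0(1) by (auto simp: fair_live_def fair_from_def initialized_def)
qed

text \<open>The step from \<open>u\<close> back to \<open>t\<close> belongs to
  \<open>succ_rel X\<close>, so the second part of the walk has positive length even if
  \<open>t\<close>, \<open>v\<close> and \<open>u\<close> coincide. Hence positions can be counted
  modulo \<open>n\<close>.\<close>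

lemma good_closed_walk:
  assumes "good X t" and "t \<in> X"
  shows "\<exists>n f. 0 < n \<and> f 0 = t \<and> f n = t \<and> (\<forall>i<n. f i \<in> X \<and> tgt (f i) = src (f (Suc i))) \<and>
    (\<exists>m<n. src (f m) \<in> F)"
proof -
  obtain v u where vu: "(t, v) \<in> (succ_rel X)\<^sup>*" "src v \<in> F" "(v, u) \<in> (succ_rel X)\<^sup>*" "tgt u = src t"
    using assms(1) by (auto simp: good_def)
  have inX: "y \<in> X" if "(x, y) \<in> (succ_rel X)\<^sup>*" "x \<in> X" for x y
    using that by (cases rule: rtranclE) (auto simp: succ_rel_def)
  have "u \<in> X" using vu assms(2) inX by blast
  then have "(v, t) \<in> (succ_rel X)\<^sup>+"
    using vu assms(2) by (intro rtrancl_into_trancl1[of _ u]) (auto simp: succ_rel_def)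
  then obtain n2 where n2: "0 < n2" "(v, t) \<in> succ_rel X ^^ n2" by (auto simp: trancl_power)
  obtain n1 where n1: "(t, v) \<in> succ_rel X ^^ n1" using vu(1) by (auto simp: rtrancl_power)
  obtain f1 where f1: "f1 0 = t" "f1 n1 = v" "\<forall>i<n1. (f1 i, f1 (Suc i)) \<in> succ_rel X"
    using n1 by (auto simp: relpow_fun_conv)
  obtain f2 where f2: "f2 0 = v" "f2 n2 = t" "\<forall>i<n2. (f2 i, f2 (Suc i)) \<in> succ_rel X"
    using n2(2) by (auto simp: relpow_fun_conv)
  define f where "f i = (if i < n1 then f1 i else f2 (i - n1))" for i
  have "(f i, f (Suc i)) \<in> succ_rel X" if "i < n1 + n2" for i
  proof (cases "i < n1")
    case True
    then show ?thesis using f1 f2(1) by (cases "Suc i = n1") (auto simp: f_def dest: spec[of _ i])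
  next
    case False
    then have "i - n1 < n2" "Suc i - n1 = Suc (i - n1)" using that by auto
    then show ?thesis using f2(3) False by (auto simp: f_def)
  qed
  moreover have "f 0 = t" "f (n1 + n2) = t" "src (f n1) \<in> F"
    using f1 f2 vu(2) by (auto simp: f_def)
  ultimately show ?thesis using n2(1)
    by (intro exI[of _ "n1 + n2"] exI[of _ f]) (auto simp: succ_rel_def intro!: exI[of _ n1])
qed

text \<open>One client is placed at every position of the chosen closed walks, and in every round all
  clients advance by one position. So every round uses the same transitions, and every message
  received is also sent. Step \<open>k\<close> of a round is a broadcast by the sender of rank \<open>k\<close>.\<close>

lemma fair_live_if_good_set:
  assumes X: "X \<subseteq> En" "X \<noteq> {}" and good: "\<forall>t\<in>X. good X t"
  shows "fair_live I delta F"
proof -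
  have "\<forall>t\<in>X. \<exists>n f. 0 < n \<and> f 0 = t \<and> f n = t \<and> (\<forall>i<n. f i \<in> X \<and> tgt (f i) = src (f (Suc i))) \<and>
    (\<exists>m<n. src (f m) \<in> F)"
    using good good_closed_walk by blast
  then obtain ln wk where walk: "\<And>t. t \<in> X \<Longrightarrow> 0 < ln t \<and> wk t 0 = t \<and> wk t (ln t) = t \<and>
      (\<forall>i<ln t. wk t i \<in> X \<and> tgt (wk t i) = src (wk t (Suc i))) \<and> (\<exists>m<ln t. src (wk t m) \<in> F)"
    by metis
  \<comment> \<open>A pair \<open>(t, j)\<close> names position \<open>j\<close> on the closed walk
    of \<open>t\<close>, and at the same time the client that starts there; \<open>node r a\<close>
    is the position of client \<open>a\<close> in round \<open>r\<close>.\<close>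
  define A where "A = Sigma X (\<lambda>t. {..<ln t})"
  define lab where "lab a = wk (fst a) (snd a)" for a
  define node where "node r a = (fst a, (snd a + r) mod ln (fst a))" for r :: nat and a :: "'p \<times> nat"
  have "finite X" using X(1) En_subset finite_P finite_subset by metis
  then have finA: "finite A" by (auto simp: A_def)
  have lab: "lab a \<in> X" if "a \<in> A" for a
    using that walk by (auto simp: A_def lab_def)
  have node: "node r a \<in> A" if "a \<in> A" for r a
    using that walk by (auto simp: A_def node_def)
  have node_0: "node 0 a = a" if "a \<in> A" for a
    using that by (auto simp: A_def node_def)
  have tgt_lab: "tgt (lab (node r a)) = src (lab (node (Suc r) a))" if aA: "a \<in> A" for r a
  proof -
    obtain t j where a: "a = (t, j)" "t \<in> X" "j < ln t" using aA by (auto simp: A_def)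
    let ?k = "(j + r) mod ln t"
    have k: "?k < ln t" using walk[OF a(2)] by simp
    have "(j + Suc r) mod ln t = (if Suc ?k = ln t then 0 else Suc ?k)"
      by (simp add: mod_Suc)
    then show ?thesis using walk[OF a(2)] k a(1) by (auto simp: lab_def node_def)
  qed
  \<comment> \<open>Each round is a rotation of the walks, hence a permutation of \<open>A\<close>:
    every position is held by exactly one client.\<close>
  have inj: "inj_on (node r) A" for r
  proof (rule inj_onI)
    fix a b assume ab: "a \<in> A" "b \<in> A" "node r a = node r b"
    obtain t j j' where j: "a = (t, j)" "b = (t, j')" "j < ln t" "j' < ln t"
      using ab by (auto simp: A_def node_def)
    have eq: "(j + r) mod ln t = (j' + r) mod ln t" using ab j by (simp add: node_def)
    have "x = y" if "x \<le> y" "y < ln t" "(x + r) mod ln t = (y + r) mod ln t" for x y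
    proof -
      have "ln t dvd (y + r) - (x + r)" using that by (subst mod_eq_dvd_iff_nat[symmetric]) auto
      then have "y - x = 0" using that dvd_imp_le[of "ln t" "y - x"] by (cases "y - x = 0") simp_all
      then show ?thesis using that by simp
    qed
    from this[of j j'] this[of j' j] eq j show "a = b" by (cases "j \<le> j'") auto
  qed
  have surj: "\<exists>a\<in>A. node r a = b" if "b \<in> A" for r b
    using endo_inj_surj[OF finA _ inj[of r]] node that by (metis image_iff image_subsetI)
  \<comment> \<open>The sending positions. Each of the \<open>S\<close> steps of a round serves one
    of them, in the order given by \<open>h\<close>.\<close>
  define NS where "NS = {a \<in> A. \<exists>m. sends (lab a) m}"
  define S where "S = card NS"
  have "finite NS" using finA by (simp add: NS_def)
  then obtain h where h: "bij_betw h NS {..<S}"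
    using ex_bij_betw_finite_nat[of NS] by (auto simp: S_def lessThan_atLeast0)
  define msg where "msg a = bop_msg (opr (lab a))" for a
  have ex_sender: "\<exists>z\<in>NS. msg z = msg a" if "a \<in> A" for a
  proof -
    have "good X (lab a)" using lab that good by blast
    then obtain z where z: "z \<in> X" "sends z (bop_msg (opr (lab a)))" by (auto simp: good_def)
    \<comment> \<open>The walk of \<open>z\<close> starts with \<open>z\<close>, so every transition
      of \<open>X\<close> occurs at some position.\<close>
    then have "(z, 0) \<in> NS" using walk[OF z(1)] by (auto simp: NS_def A_def lab_def)
    moreover have "msg (z, 0) = msg a" using z walk[OF z(1)] by (simp add: msg_def lab_def sends_def)
    ultimately show ?thesis by blast
  qed
  \<comment> \<open>A sending position keeps its own number under \<open>h\<close>. A receiving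
    position takes the number of some sending position with the same message.\<close>
  define rank where "rank a = h (if a \<in> NS then a else SOME z. z \<in> NS \<and> msg z = msg a)" for a
  have rank: "\<exists>z\<in>NS. rank a = h z \<and> msg z = msg a \<and> (a \<in> NS \<longrightarrow> z = a)" if "a \<in> A" for a
  proof (cases "a \<in> NS")
    case False
    then show ?thesis
      using someI_ex[of "\<lambda>z. z \<in> NS \<and> msg z = msg a"] ex_sender[OF that] unfolding rank_def by auto
  qed (auto simp: rank_def)
  have rank_less: "rank a < S" if "a \<in> A" for a
    using rank[OF that] h by (auto simp: bij_betw_def)
  obtain a0 where "a0 \<in> A" using X(2) walk by (auto simp: A_def)
  then have S: "0 < S" using rank_less by fastforce
  have "\<forall>a\<in>A. coverable (src (lab a))" using lab X(1) coverable_En by blast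
  then obtain c e where c: "c \<in> reachable" and e: "inj_on e A"
    "\<And>a. a \<in> A \<Longrightarrow> e a < length c \<and> c ! e a = src (lab a)"
    using cover_family[OF finA, of "\<lambda>a. src (lab a)"] by blast
  \<comment> \<open>Time \<open>n\<close> is step \<open>n mod S\<close> of round
    \<open>n div S\<close>. A client has already advanced in this round iff its position has a rank
    below the current step.\<close>
  define st where "st n a = (let v = node (n div S) a in
    if rank v < n mod S then src (lab (node (Suc (n div S)) a)) else src (lab v))" for n a
  define cs where "cs n = map (\<lambda>i. if i \<in> e ` A then st n (inv_into A e i) else c ! i) [0..<length c]" for n
  define ts where "ts n = e ` {a \<in> A. rank (node (n div S) a) = n mod S}" for n
  define as where "as n = msg (inv_into NS h (n mod S))" for n
  have cs_e: "cs n ! e a = st n a" if "a \<in> A" for n a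
    using that e by (simp add: cs_def)
  \<comment> \<open>In the last step of a round no rank exceeds \<open>n mod S\<close>, so
    afterwards everybody has advanced, which is the start of the next round.\<close>
  have st_Suc: "st (Suc n) a = (let v = node (n div S) a in
    if rank v \<le> n mod S then src (lab (node (Suc (n div S)) a)) else src (lab v))" if "a \<in> A" for n a
  proof (cases "Suc (n mod S) = S")
    case True
    then have "Suc n div S = Suc (n div S)" "Suc n mod S = 0" by (auto simp: div_Suc mod_Suc)
    moreover have "rank (node (n div S) a) \<le> n mod S"
      using rank_less[OF node[OF that]] True by (metis less_Suc_eq_le)
    ultimately show ?thesis by (simp add: st_def)
  next
    case False
    then have "Suc n div S = n div S" "Suc n mod S = Suc (n mod S)" by (auto simp: div_Suc mod_Suc)
    then show ?thesis unfolding st_def by (simp only: less_Suc_eq_le)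
  qed
  have "bstep delta (cs n) (as n) (ts n) (cs (Suc n))" for n
  proof -
    let ?k = "n mod S" and ?r = "n div S"
    have "?k < S" using S by simp
    then obtain z where z: "z \<in> NS" "h z = ?k" using h by (metis bij_betw_def imageE lessThan_iff)
    then have as: "as n = msg z" using h by (metis as_def bij_betw_inv_into_left)
    have zA: "z \<in> A" using z by (simp add: NS_def)
    obtain a where a: "a \<in> A" "node ?r a = z" using surj[OF zA] by blast
    have rz: "rank z = ?k" using z by (simp add: rank_def)
    \<comment> \<open>\<open>h\<close> is injective on sending positions and \<open>node ?r\<close>
      on clients, so \<open>a\<close> is the only sender among the clients that move now.\<close>
    have moved: "(cs n ! e b, opr (lab (node ?r b)), cs (Suc n) ! e b) \<in> delta \<and> msg (node ?r b) = as n \<and>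
        (b \<noteq> a \<longrightarrow> node ?r b \<notin> NS)"
      if "b \<in> A" "rank (node ?r b) = ?k" for b
    proof -
      have b: "node ?r b \<in> A" using node that by simp
      have "lab (node ?r b) \<in> P" using lab[OF b] X(1) En_subset by blast
      moreover have "cs n ! e b = src (lab (node ?r b))" using that cs_e by (simp add: st_def)
      moreover have "cs (Suc n) ! e b = tgt (lab (node ?r b))"
        using that cs_e st_Suc tgt_lab by simp
      ultimately have 1: "(cs n ! e b, opr (lab (node ?r b)), cs (Suc n) ! e b) \<in> delta"
        by (auto simp: delta_def)
      obtain y where y: "y \<in> NS" "rank (node ?r b) = h y" "msg y = msg (node ?r b)"
        "node ?r b \<in> NS \<longrightarrow> y = node ?r b" using rank[OF b] by blast
      have "y = z" using y z that h by (auto simp: bij_betw_def inj_on_def)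
      moreover have "b = a" if "node ?r b = z"
        using that a \<open>b \<in> A\<close> inj[of ?r] by (auto simp: inj_on_def)
      ultimately show ?thesis using 1 y as by auto
    qed
    have send: "(cs n ! e a, Snd (as n), cs (Suc n) ! e a) \<in> delta"
      using moved[OF a(1)] a(2) rz z as by (auto simp: NS_def sends_def msg_def)
    have recv: "(cs n ! j, Rcv (as n), cs (Suc n) ! j) \<in> delta" if j: "j \<in> ts n - {e a}" for j
    proof -
      obtain b where b: "b \<in> A" "rank (node ?r b) = ?k" "j = e b" "b \<noteq> a"
        using j by (auto simp: ts_def)
      have "node ?r b \<in> A - NS" using moved[OF b(1,2)] b node by auto
      then have "opr (lab (node ?r b)) = Rcv (msg (node ?r b))"
        by (cases "opr (lab (node ?r b))") (auto simp: NS_def sends_def msg_def)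
      then show ?thesis using moved[OF b(1,2)] b(3) by simp
    qed
    have idle: "cs n ! j = cs (Suc n) ! j" if "j < length c" "j \<notin> ts n" for j
    proof (cases "j \<in> e ` A")
      case True
      then obtain b where b: "b \<in> A" "j = e b" by blast
      then have "rank (node ?r b) \<noteq> ?k" using that by (auto simp: ts_def)
      then show ?thesis using b cs_e st_Suc by (auto simp: st_def Let_def)
    next
      case False
      then show ?thesis using that by (simp add: cs_def)
    qed
    have "e a \<in> ts n" using a rz by (auto simp: ts_def)
    moreover have "ts n \<subseteq> {..<length c}" using e by (auto simp: ts_def)
    moreover have "length (cs m) = length c" for m by (simp add: cs_def)
    ultimately show ?thesis unfolding bstep_def using send recv idle by auto
  qed
  then have comp: "is_computation delta cs as ts" by (simp add: is_computation_def)
  have cs0: "cs 0 = c"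
  proof (rule nth_equalityI)
    fix i assume "i < length (cs 0)"
    then have i: "i < length c" by (simp add: cs_def)
    show "cs 0 ! i = c ! i"
    proof (cases "i \<in> e ` A")
      case True
      then obtain a where "a \<in> A" "i = e a" by blast
      then show ?thesis using cs_e e node_0 by (simp add: st_def)
    qed (use i in \<open>simp add: cs_def\<close>)
  qed (simp add: cs_def)
  have "Inf_set ts \<subseteq> Fin_set F cs"
  proof
    fix i assume "i \<in> Inf_set ts"
    \<comment> \<open>Only the clients selected by \<open>e\<close> ever move; the others keep their
      state forever.\<close>
    then have "{j. i \<in> ts j} \<noteq> {}" unfolding Inf_set_def by (auto dest: infinite_imp_nonempty)
    then obtain a where a: "a \<in> A" "i = e a" by (auto simp: ts_def)
    obtain t j where tj: "a = (t, j)" "t \<in> X" "j < ln t" using a(1) by (auto simp: A_def)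
    obtain m where m: "m < ln t" "src (wk t m) \<in> F" using walk[OF tj(2)] by blast
    have "\<exists>n\<ge>N. i < length (cs n) \<and> cs n ! i \<in> F" for N
    proof (intro exI conjI)
      \<comment> \<open>Advancing by \<open>m + (ln t - j)\<close> rotates position \<open>j\<close>
        to \<open>m\<close>; the multiple of \<open>ln t\<close> preserves this and pushes the round
        beyond \<open>N\<close>. At time \<open>S * ?r\<close> the round has just begun.\<close>
      let ?r = "m + (ln t - j) + ln t * N"
      have "1 * N \<le> ln t * N" using m(1) by (intro mult_le_mono1) simp
      then have "N \<le> ?r" by linarith
      moreover have "1 * ?r \<le> S * ?r" using S by (intro mult_le_mono1) simp
      ultimately show "N \<le> S * ?r" by (metis order_trans mult_1)
      show "i < length (cs (S * ?r))" using a e by (simp add: cs_def)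
      have "(j + ?r) mod ln t = (m + ln t * Suc N) mod ln t" using tj(3) by (simp add: algebra_simps)
      also have "\<dots> = m" using m(1) by (simp del: mult_Suc_right)
      finally have "node ?r a = (t, m)" using tj(1) by (simp add: node_def)
      then show "cs (S * ?r) ! i \<in> F" using a cs_e S m(2) by (simp add: st_def lab_def)
    qed
    then show "i \<in> Fin_set F cs" unfolding Fin_set_def infinite_nat_iff_unbounded_le by blast
  qed
  then show ?thesis
    using fair_live_if_fair_from[OF c] comp cs0 unfolding fair_from_def by blast
qed

theorem fair_live_iff_good_set:
  "fair_live I delta F \<longleftrightarrow> (\<exists>X\<subseteq>En. X \<noteq> {} \<and> (\<forall>t\<in>X. good X t))"
  using exists_good_set fair_live_if_good_set unfolding fair_live_def by blast

end

subsection \<open>Programs on tracks\<close>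

definition reaches :: "tm \<Rightarrow> nat \<Rightarrow> tm_conf \<Rightarrow> tm_conf \<Rightarrow> bool" where
  "reaches M t c c' \<longleftrightarrow> (tm_step M ^^ t) c = c'"

lemma reaches_0 [simp]: "reaches M 0 c c' \<longleftrightarrow> c = c'"
  by (simp add: reaches_def)

lemma reaches_trans:
  assumes "reaches M t c c'" and "reaches M t' c' c''"
  shows "reaches M (t + t') c c''"
  using assms unfolding reaches_def by (subst add.commute) (simp add: funpow_add)

lemma reaches_Suc:
  assumes "tm_step M c = c'" and "reaches M t c' c''"
  shows "reaches M (Suc t) c c''"
  using assms unfolding reaches_def funpow_Suc_right by simp

lemma reaches_step: "tm_step M c = c' \<Longrightarrow> reaches M 1 c c'"
  by (simp add: reaches_def)

text \<open>The scanned symbol is taken from the part of the tape that the head enters, with a blank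
  past its stored end. This merges the two cases of a head movement.\<close>

fun rconf :: "nat \<Rightarrow> nat list \<Rightarrow> nat list \<Rightarrow> tm_conf" where
  "rconf q ls [] = (q, ls, 0, [])"
| "rconf q ls (x # rs) = (q, ls, x, rs)"

fun lconf :: "nat \<Rightarrow> nat list \<Rightarrow> nat list \<Rightarrow> tm_conf" where
  "lconf q [] rs = (q, [], 0, rs)"
| "lconf q (x # ls) rs = (q, ls, x, rs)"

lemma step_Rgt:
  assumes "M q h = (q', s', Rgt)" and "q \<noteq> 1" and "q \<noteq> 2"
  shows "tm_step M (q, ls, h, rs) = rconf q' (s' # ls) rs"
  using assms by (cases rs) auto

lemma step_Lft:
  assumes "M q h = (q', s', Lft)" and "q \<noteq> 1" and "q \<noteq> 2"
  shows "tm_step M (q, ls, h, rs) = lconf q' ls (s' # rs)"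
  using assms by (cases ls) auto

lemma step_Stay:
  assumes "M q h = (q', s', Stay)" and "q \<noteq> 1" and "q \<noteq> 2"
  shows "tm_step M (q, ls, h, rs) = (q', ls, s', rs)"
  using assms by auto

declare tm_step.simps [simp del]

text \<open>The head rests on the blank cell to the left of the word between two fragments.\<close>

definition home :: "nat \<Rightarrow> nat list \<Rightarrow> nat \<Rightarrow> tm_conf" where
  "home q u z = (q, [], 0, u @ replicate z 0)"

text \<open>A fragment is given by its transitions as a function of the number of its first state, of the
  two states to which it exits with the answers yes and no, of the state relative to the first one,
  and of the scanned symbol.\<close>

type_synonym frag = "nat \<Rightarrow> nat \<Rightarrow> nat \<Rightarrow> nat \<Rightarrow> nat \<Rightarrow> nat \<times> nat \<times> dir"

definition installed :: "nat \<Rightarrow> tm \<Rightarrow> nat \<Rightarrow> frag \<Rightarrow> nat \<Rightarrow> nat \<Rightarrow> nat \<Rightarrow> bool" where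
  "installed A M Q g b ey en \<longleftrightarrow> (\<forall>q<Q. \<forall>s<A. M (b + q) s = g b ey en q s)"

definition frag_ok :: "nat \<Rightarrow> nat \<Rightarrow> frag \<Rightarrow> bool" where
  "frag_ok A Q g \<longleftrightarrow> 0 < Q \<and> (\<forall>b ey en. \<forall>q<Q. \<forall>s<A. \<exists>q' s' d. g b ey en q s = (q', s', d) \<and>
     s' < A \<and> (b \<le> q' \<and> q' < b + Q \<or> q' = ey \<or> q' = en))"

text \<open>State 0 leaves the home cell, states 1 to \<open>S\<close> carry the memory values 0 to
  \<open>S - 1\<close> to the right, and the last two states bring the answer back to the
  left.\<close>

definition sweep_frag ::
  "nat \<Rightarrow> nat \<Rightarrow> (nat \<Rightarrow> nat \<Rightarrow> nat) \<Rightarrow> (nat \<Rightarrow> nat \<Rightarrow> nat) \<Rightarrow> (nat \<Rightarrow> bool) \<Rightarrow> frag" where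
  "sweep_frag S m0 mu out fin b ey en q s =
     (if q = 0 then (b + 1 + m0, s, Rgt)
      else if q \<le> S then
        (if s = 0 then (if fin (q - 1) then b + S + 1 else b + S + 2, 0, Lft)
         else (b + 1 + mu (q - 1) s, out (q - 1) s, Rgt))
      else if s = 0 then (if q = S + 1 then ey else en, 0, Stay)
      else (b + q, s, Lft))"

fun mealy :: "(nat \<Rightarrow> nat \<Rightarrow> nat) \<Rightarrow> (nat \<Rightarrow> nat \<Rightarrow> nat) \<Rightarrow> nat \<Rightarrow> nat list \<Rightarrow> nat list" where
  "mealy mu out m [] = []"
| "mealy mu out m (s # u) = out m s # mealy mu out (mu m s) u"

lemma length_mealy [simp]: "length (mealy mu out m u) = length u"
  by (induction u arbitrary: m) auto

lemma nth_mealy: "i < length u \<Longrightarrow> mealy mu out m u ! i = out (foldl mu m (take i u)) (u ! i)"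
  by (induction u arbitrary: m i) (auto simp: nth_Cons' take_Cons' )

text \<open>Blanks delimit the word on both sides, so a sweep must turn nonblank symbols into
  nonblank symbols.\<close>

locale sweep =
  fixes A S m0 :: nat and mu out :: "nat \<Rightarrow> nat \<Rightarrow> nat" and fin :: "nat \<Rightarrow> bool"
  assumes m0: "m0 < S"
    and mu: "\<And>m s. m < S \<Longrightarrow> s < A \<Longrightarrow> mu m s < S"
    and out: "\<And>m s. m < S \<Longrightarrow> 0 < s \<Longrightarrow> s < A \<Longrightarrow> 0 < out m s \<and> out m s < A"
begin

lemma frag_ok_sweep: "frag_ok A (S + 3) (sweep_frag S m0 mu out fin)"
  unfolding frag_ok_def
proof (intro conjI allI impI)
  fix b ey en q s assume "q < S + 3" "s < A"
  then show "\<exists>q' s' d. sweep_frag S m0 mu out fin b ey en q s = (q', s', d) \<and>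
     s' < A \<and> (b \<le> q' \<and> q' < b + (S + 3) \<or> q' = ey \<or> q' = en)"
  proof (cases "0 < q \<and> q \<le> S \<and> s \<noteq> 0")
    case True
    then have "q - 1 < S" by linarith
    then show ?thesis
      using mu[of "q - 1" s] out[of "q - 1" s] True \<open>s < A\<close> by (auto simp: sweep_frag_def)
  qed (use m0 \<open>q < S + 3\<close> \<open>s < A\<close> in \<open>auto simp: sweep_frag_def\<close>)
qed simp

context
  fixes M b ey en
  assumes inst: "installed A M (S + 3) (sweep_frag S m0 mu out fin) b ey en"
    and b: "3 \<le> b"
begin

lemma M_eq: "q < S + 3 \<Longrightarrow> s < A \<Longrightarrow> M (b + q) s = sweep_frag S m0 mu out fin b ey en q s"
  using inst by (simp add: installed_def)

lemma right_phase:
  assumes "set u \<subseteq> {0<..<A}" and "m < S"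
  shows "reaches M (length u) (rconf (b + 1 + m) ls (u @ v))
           (rconf (b + 1 + foldl mu m u) (rev (mealy mu out m u) @ ls) v) \<and> foldl mu m u < S"
  using assms
proof (induction u arbitrary: m ls)
  case (Cons s u)
  have "M (b + 1 + m) s = (b + 1 + mu m s, out m s, Rgt)"
    using M_eq[of "Suc m" s] Cons.prems by (simp add: sweep_frag_def)
  then have "tm_step M (rconf (b + 1 + m) ls ((s # u) @ v))
      = rconf (b + 1 + mu m s) (out m s # ls) (u @ v)"
    using b by (subst append_Cons, subst rconf.simps) (rule step_Rgt; simp)
  moreover have "mu m s < S" using mu Cons.prems by simp
  ultimately show ?case
    using Cons.IH[of "mu m s" "out m s # ls"] Cons.prems
    by (simp add: reaches_Suc[of M _ "rconf (b + 1 + mu m s) (out m s # ls) (u @ v)"] del: rconf.simps)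
qed simp

lemma left_phase:
  assumes "set u \<subseteq> {0<..<A}" and "r = S + 1 \<or> r = S + 2"
  shows "reaches M (length u) (lconf (b + r) (u @ [0]) v) (b + r, [], 0, rev u @ v)"
  using assms(1)
proof (induction u arbitrary: v)
  case (Cons s u)
  have "M (b + r) s = (b + r, s, Lft)"
    using M_eq[of r s] Cons.prems assms(2) by (auto simp: sweep_frag_def)
  then have "tm_step M (lconf (b + r) ((s # u) @ [0]) v) = lconf (b + r) (u @ [0]) (s # v)"
    using b by (subst append_Cons, subst lconf.simps) (rule step_Lft; simp)
  then show ?case
    using reaches_Suc Cons.IH[of "s # v"] Cons.prems by fastforce
qed simp

lemma set_mealy:
  assumes "set u \<subseteq> {0<..<A}" and "m < S"
  shows "set (mealy mu out m u) \<subseteq> {0<..<A}"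
  using assms
proof (induction u arbitrary: m)
  case (Cons s u)
  then show ?case using out[of m s] mu[of m s] by auto
qed simp

text \<open>One step leaves home, one turns around at the blank behind the word, one exits, and the
  word is crossed twice. The number of trailing blanks may change because the blank at the turning
  point becomes part of the stored tape.\<close>

lemma sweep_run:
  assumes u: "set u \<subseteq> {0<..<A}" and A: "0 < A"
  shows "\<exists>z'. reaches M (2 * length u + 3) (home b u z)
     (home (if fin (foldl mu m0 u) then ey else en) (mealy mu out m0 u) z')"
proof -
  let ?m = "foldl mu m0 u" and ?v = "mealy mu out m0 u"
  let ?r = "if fin ?m then S + 1 else S + 2"
  have "M (b + 0) 0 = (b + 1 + m0, 0, Rgt)"
    using M_eq[of 0 0] A by (simp add: sweep_frag_def)
  then have 1: "reaches M 1 (home b u z) (rconf (b + 1 + m0) [0] (u @ replicate z 0))"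
    unfolding home_def using b by (intro reaches_step step_Rgt) auto
  have 2: "reaches M (length u) (rconf (b + 1 + m0) [0] (u @ replicate z 0))
      (rconf (b + 1 + ?m) (rev ?v @ [0]) (replicate z 0))" and m: "?m < S"
    using right_phase[OF u m0] by blast+
  have M: "M (b + 1 + ?m) 0 = (b + ?r, 0, Lft)"
    using M_eq[of "Suc ?m" 0] A m by (simp add: sweep_frag_def)
  have 3: "reaches M 1 (rconf (b + 1 + ?m) (rev ?v @ [0]) (replicate z 0))
      (lconf (b + ?r) (rev ?v @ [0]) (replicate (Suc (z - 1)) 0))"
  proof (cases z)
    case 0
    then show ?thesis
      using step_Lft[of M, OF M] b by (intro reaches_step) simp
  next
    case (Suc z')
    then show ?thesis
      using step_Lft[of M, OF M] b by (intro reaches_step) simp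
  qed
  have 4: "reaches M (length (rev ?v)) (lconf (b + ?r) (rev ?v @ [0]) (replicate (Suc (z - 1)) 0))
      (b + ?r, [], 0, ?v @ replicate (Suc (z - 1)) 0)"
    using left_phase[of "rev ?v" ?r "replicate (Suc (z - 1)) 0"] set_mealy[OF u m0] by simp
  have "M (b + ?r) 0 = (if fin ?m then ey else en, 0, Stay)"
    using M_eq[of ?r 0] A m by (simp add: sweep_frag_def)
  then have 5: "reaches M 1 (b + ?r, [], 0, ?v @ replicate (Suc (z - 1)) 0)
      (home (if fin ?m then ey else en) ?v (Suc (z - 1)))"
    unfolding home_def using b by (intro reaches_step step_Stay) auto
  have "reaches M (1 + length u + 1 + length (rev ?v) + 1) (home b u z)
      (home (if fin ?m then ey else en) ?v (Suc (z - 1)))"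
    using reaches_trans[OF reaches_trans[OF reaches_trans[OF reaches_trans[OF 1 2] 3] 4] 5] .
  moreover have "1 + length u + 1 + length (rev ?v) + 1 = 2 * length u + 3"
    by simp
  ultimately show ?thesis by metis
qed

end

end

section \<open>Polynomial bounds\<close>

definition poly_bound :: "(nat \<Rightarrow> nat) \<Rightarrow> bool" where
  "poly_bound B \<longleftrightarrow> (\<exists>c d. \<forall>L. B L \<le> c * (L + 1) ^ d)"

lemma poly_bound_const: "poly_bound (\<lambda>_. k)"
  unfolding poly_bound_def by (rule exI[of _ k], rule exI[of _ 0]) simp

lemma poly_bound_mult:
  assumes "poly_bound B" and "poly_bound C"
  shows "poly_bound (\<lambda>L. B L * C L)"
proof -
  obtain c d c' d' where "\<And>L. B L \<le> c * (L + 1) ^ d" "\<And>L. C L \<le> c' * (L + 1) ^ d'"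
    using assms unfolding poly_bound_def by blast
  then have "B L * C L \<le> (c * (L + 1) ^ d) * (c' * (L + 1) ^ d')" for L
    by (rule mult_le_mono)
  then have "B L * C L \<le> (c * c') * (L + 1) ^ (d + d')" for L
    by (simp add: power_add mult_ac)
  then show ?thesis unfolding poly_bound_def by blast
qed

lemma poly_bound_add:
  assumes "poly_bound B" and "poly_bound C"
  shows "poly_bound (\<lambda>L. B L + C L)"
proof -
  obtain c d c' d' where *: "\<And>L. B L \<le> c * (L + 1) ^ d" "\<And>L. C L \<le> c' * (L + 1) ^ d'"
    using assms unfolding poly_bound_def by blast
  have "B L + C L \<le> (c + c') * (L + 1) ^ (d + d')" for L
  proof -
    have "(L + 1) ^ d \<le> (L + 1) ^ (d + d')" "(L + 1) ^ d' \<le> (L + 1) ^ (d + d')"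
      by (rule power_increasing; simp)+
    then have "c * (L + 1) ^ d \<le> c * (L + 1) ^ (d + d')" "c' * (L + 1) ^ d' \<le> c' * (L + 1) ^ (d + d')"
      using mult_le_mono2 by blast+
    then show ?thesis
      using *(1)[of L] *(2)[of L] unfolding add_mult_distrib by (meson add_mono order_trans)
  qed
  then show ?thesis unfolding poly_bound_def by blast
qed

section \<open>Tapes with bit tracks and single-sweep programs\<close>

type_synonym tracks = "nat \<Rightarrow> nat set"
type_synonym prog = "nat list \<Rightarrow> tracks \<Rightarrow> bool \<times> tracks"

text \<open>Besides a letter of the input word, which is 1, 2 or 3, a cell carries \<open>K\<close> bits, packed into the
  symbol so that the input itself is the tape on which all bits are unset. Bit \<open>k\<close> is set at the
  positions in \<open>\<sigma> k\<close>.\<close>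

definition cell :: "nat \<Rightarrow> nat list \<Rightarrow> tracks \<Rightarrow> nat \<Rightarrow> nat \<times> nat set" where
  "cell K w \<sigma> p = (w ! p, {k. k < K \<and> p \<in> \<sigma> k})"

definition enc_cell :: "nat \<times> nat set \<Rightarrow> nat" where
  "enc_cell c = fst c + 4 * set_encode (snd c)"

definition dec_cell :: "nat \<Rightarrow> nat \<times> nat set" where
  "dec_cell s = (s mod 4, set_decode (s div 4))"

definition tape :: "nat \<Rightarrow> nat list \<Rightarrow> tracks \<Rightarrow> nat list" where
  "tape K w \<sigma> = map (\<lambda>p. enc_cell (cell K w \<sigma> p)) [0..<length w]"

lemma dec_enc_cell: "fst c < 4 \<Longrightarrow> finite (snd c) \<Longrightarrow> dec_cell (enc_cell c) = c"
  by (simp add: dec_cell_def enc_cell_def prod_eq_iff)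

lemma set_encode_less:
  assumes "X \<subseteq> {..<K}"
  shows "set_encode X < 2 ^ K"
proof -
  have "set_encode X \<le> (\<Sum>k<K. 2 ^ k)"
    unfolding set_encode_def using assms by (intro sum_mono2) auto
  also have "\<dots> < 2 ^ K" by (simp add: lessThan_atLeast0 sum_power2)
  finally show ?thesis .
qed

lemma enc_cell_bounds:
  assumes "0 < fst c" and "fst c < 4" and "snd c \<subseteq> {..<K}"
  shows "0 < enc_cell c" and "enc_cell c < 4 * 2 ^ K"
  using assms set_encode_less[OF assms(3)] by (auto simp: enc_cell_def)

lemma cell_bounds:
  assumes "set w \<subseteq> {1, 2, 3}" and "p < length w"
  shows "0 < fst (cell K w \<sigma> p)" and "fst (cell K w \<sigma> p) < 4" and "snd (cell K w \<sigma> p) \<subseteq> {..<K}"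
proof -
  have "w ! p \<in> {1, 2, 3}" using assms nth_mem by blast
  then show "0 < fst (cell K w \<sigma> p)" "fst (cell K w \<sigma> p) < 4" by (auto simp: cell_def)
  show "snd (cell K w \<sigma> p) \<subseteq> {..<K}" by (auto simp: cell_def)
qed

lemma dec_enc_cell_cell:
  assumes "set w \<subseteq> {1, 2, 3}" and "p < length w"
  shows "dec_cell (enc_cell (cell K w \<sigma> p)) = cell K w \<sigma> p"
  using cell_bounds[OF assms, of K \<sigma>] finite_subset by (intro dec_enc_cell) auto

lemma length_tape [simp]: "length (tape K w \<sigma>) = length w"
  by (simp add: tape_def)

lemma set_tape:
  assumes "set w \<subseteq> {1, 2, 3}"
  shows "set (tape K w \<sigma>) \<subseteq> {0<..<4 * 2 ^ K}"
  using enc_cell_bounds[OF cell_bounds[OF assms]] by (auto simp: tape_def)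

text \<open>Quantifying over every machine that contains the fragment makes fragments composable;
  \<open>3 \<le> b\<close> keeps them clear of the start state and the two halting states. The time
  bound is uniform in the tracks.\<close>

definition realizes :: "nat \<Rightarrow> nat \<Rightarrow> frag \<Rightarrow> (nat \<Rightarrow> nat) \<Rightarrow> prog \<Rightarrow> bool" where
  "realizes K Q g B F \<longleftrightarrow> poly_bound B \<and> frag_ok (4 * 2 ^ K) Q g \<and>
     (\<forall>M b ey en w \<sigma> z. 3 \<le> b \<longrightarrow> installed (4 * 2 ^ K) M Q g b ey en \<longrightarrow> set w \<subseteq> {1, 2, 3} \<longrightarrow>
        (\<exists>t z'. t \<le> B (length w) \<and>
           reaches M t (home b (tape K w \<sigma>) z)
             (home (if fst (F w \<sigma>) then ey else en) (tape K w (snd (F w \<sigma>))) z')))"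

definition realizable :: "nat \<Rightarrow> prog \<Rightarrow> bool" where
  "realizable K F \<longleftrightarrow> (\<exists>Q g B. realizes K Q g B F)"

lemma realizesD:
  assumes "realizes K Q g B F" and "3 \<le> b" and "installed (4 * 2 ^ K) M Q g b ey en"
    and "set w \<subseteq> {1, 2, 3}"
  obtains t z' where "t \<le> B (length w)"
    and "reaches M t (home b (tape K w \<sigma>) z)
           (home (if fst (F w \<sigma>) then ey else en) (tape K w (snd (F w \<sigma>))) z')"
  using assms unfolding realizes_def by blast

definition mem :: "nat \<Rightarrow> (nat \<Rightarrow> nat \<times> nat set \<Rightarrow> nat) \<Rightarrow> nat \<Rightarrow> nat list \<Rightarrow> tracks \<Rightarrow> nat \<Rightarrow> nat" where
  "mem K mu m0 w \<sigma> p = foldl mu m0 (map (cell K w \<sigma>) [0..<p])"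

text \<open>The memory is computed from the cells as they were before the sweep, which allows a
  track to be shifted in place. The answer is always no; see \<open>realizable_ifc\<close> for how
  such programs are sequenced.\<close>

definition upd :: "nat \<Rightarrow> nat \<Rightarrow> (nat \<Rightarrow> nat \<times> nat set \<Rightarrow> nat) \<Rightarrow> nat \<Rightarrow> (nat \<Rightarrow> nat \<times> nat set \<Rightarrow> bool) \<Rightarrow> prog" where
  "upd K x mu m0 \<phi> w \<sigma> =
     (False, \<sigma>(x := {p. p < length w \<and> \<phi> (mem K mu m0 w \<sigma> p) (cell K w \<sigma> p)}))"

definition test :: "nat \<Rightarrow> (nat \<times> nat set \<Rightarrow> bool) \<Rightarrow> prog" where
  "test K \<phi> w \<sigma> = (\<exists>p<length w. \<phi> (cell K w \<sigma> p), \<sigma>)"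

lemma foldl_mu_tape:
  assumes "set w \<subseteq> {1, 2, 3}" and "p \<le> length w"
  shows "foldl (\<lambda>m s. mu m (dec_cell s)) m (take p (tape K w \<sigma>)) = mem K mu m w \<sigma> p"
  using assms(2)
proof (induction p)
  case (Suc p)
  then show ?case
    using dec_enc_cell_cell[OF assms(1), of p K \<sigma>]
    by (simp add: take_Suc_conv_app_nth mem_def tape_def)
qed (simp add: mem_def)

lemma poly_bound_sweep: "poly_bound (\<lambda>L. 2 * L + 3)"
  unfolding poly_bound_def by (rule exI[of _ 3], rule exI[of _ 1]) simp

lemma realizable_upd:
  assumes x: "x < K" and m0: "m0 < S" and mu: "\<And>m c. m < S \<Longrightarrow> mu m c < S"
  shows "realizable K (upd K x mu m0 \<phi>)"
proof -
  define A :: nat where "A = 4 * 2 ^ K"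
  \<comment> \<open>\<open>sweep\<close> demands nonblank output on every nonblank symbol, including
    those with letter 0, which encode no cell of a tape; 1 is a default for them.\<close>
  define out where "out m s = (if 0 < fst (dec_cell s) \<and> snd (dec_cell s) \<subseteq> {..<K}
    then enc_cell (fst (dec_cell s), if \<phi> m (dec_cell s) then insert x (snd (dec_cell s)) else snd (dec_cell s) - {x})
    else 1)" for m s
  have A: "0 < A" by (simp add: A_def)
  interpret sweep A S m0 "\<lambda>m s. mu m (dec_cell s)" out "\<lambda>_. False"
  proof
    fix m s :: nat assume "m < S" "0 < s" "s < A"
    have 1: "fst (dec_cell s) < 4" by (simp add: dec_cell_def)
    have 2: "1 < A" using one_le_power[of "2::nat" K] unfolding A_def by linarith
    show "0 < out m s \<and> out m s < A"
    proof (cases "0 < fst (dec_cell s) \<and> snd (dec_cell s) \<subseteq> {..<K}")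
      case True
      let ?X = "if \<phi> m (dec_cell s) then insert x (snd (dec_cell s)) else snd (dec_cell s) - {x}"
      have "?X \<subseteq> {..<K}" using True x by auto
      then show ?thesis
        using enc_cell_bounds[of "(fst (dec_cell s), ?X)" K] True 1 by (simp add: out_def A_def)
    next
      case False
      then show ?thesis using 2 by (auto simp: out_def)
    qed
  qed (use m0 mu in auto)
  have "realizes K (S + 3) (sweep_frag S m0 (\<lambda>m s. mu m (dec_cell s)) out (\<lambda>_. False)) (\<lambda>L. 2 * L + 3)
     (upd K x mu m0 \<phi>)"
    unfolding realizes_def A_def[symmetric]
  proof (intro conjI allI impI)
    fix M b ey en and w :: "nat list" and \<sigma> z
    assume b: "3 \<le> b" and inst: "installed A M (S + 3)
      (sweep_frag S m0 (\<lambda>m s. mu m (dec_cell s)) out (\<lambda>_. False)) b ey en" and w: "set w \<subseteq> {1, 2, 3}"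
    let ?u = "tape K w \<sigma>"
    have eq: "mealy (\<lambda>m s. mu m (dec_cell s)) out m0 ?u = tape K w (snd (upd K x mu m0 \<phi> w \<sigma>))"
    proof (rule nth_equalityI)
      fix p assume "p < length (mealy (\<lambda>m s. mu m (dec_cell s)) out m0 ?u)"
      then have p: "p < length w" by simp
      have "mealy (\<lambda>m s. mu m (dec_cell s)) out m0 ?u ! p = out (mem K mu m0 w \<sigma> p) (enc_cell (cell K w \<sigma> p))"
        using p foldl_mu_tape[OF w, of p] by (subst nth_mealy) (auto simp: tape_def)
      also have "\<dots> = enc_cell (fst (cell K w \<sigma> p), if \<phi> (mem K mu m0 w \<sigma> p) (cell K w \<sigma> p)
          then insert x (snd (cell K w \<sigma> p)) else snd (cell K w \<sigma> p) - {x})"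
        using dec_enc_cell_cell[OF w p] cell_bounds[OF w p] by (simp add: out_def)
      also have "\<dots> = tape K w (snd (upd K x mu m0 \<phi> w \<sigma>)) ! p"
        using p x by (auto simp: tape_def upd_def cell_def intro!: arg_cong[where f = enc_cell])
      finally show "mealy (\<lambda>m s. mu m (dec_cell s)) out m0 ?u ! p
        = tape K w (snd (upd K x mu m0 \<phi> w \<sigma>)) ! p" .
    qed simp
    show "\<exists>t z'. t \<le> 2 * length w + 3 \<and> reaches M t (home b ?u z)
        (home (if fst (upd K x mu m0 \<phi> w \<sigma>) then ey else en) (tape K w (snd (upd K x mu m0 \<phi> w \<sigma>))) z')"
      using sweep_run[OF inst b set_tape[OF w, of K \<sigma>, folded A_def] A, of z] unfolding eq
      by (auto simp: upd_def)
  qed (use poly_bound_sweep frag_ok_sweep in auto)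
  then show ?thesis unfolding realizable_def by blast
qed

lemma realizable_test: "realizable K (test K \<phi>)"
proof -
  define A :: nat where "A = 4 * 2 ^ K"
  \<comment> \<open>Memory value 1 is absorbing and records that a witness has been seen.\<close>
  define mu :: "nat \<Rightarrow> nat \<times> nat set \<Rightarrow> nat" where "mu m c = (if m = 1 \<or> \<phi> c then 1 else 0)" for m c
  have A: "0 < A" by (simp add: A_def)
  interpret sweep A 2 0 "\<lambda>m s. mu m (dec_cell s)" "\<lambda>m s. s" "\<lambda>m. m = 1"
    by unfold_locales (auto simp: mu_def)
  have mem: "(mem K mu 0 w \<sigma> p = 1) = (\<exists>q<p. \<phi> (cell K w \<sigma> q))" for w \<sigma> p
    by (induction p) (auto simp: mem_def mu_def less_Suc_eq)
  have id: "mealy f (\<lambda>m s. s) m u = u" for f m u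
    by (induction u arbitrary: m) auto
  have "realizes K (2 + 3) (sweep_frag 2 0 (\<lambda>m s. mu m (dec_cell s)) (\<lambda>m s. s) (\<lambda>m. m = 1)) (\<lambda>L. 2 * L + 3)
     (test K \<phi>)"
    unfolding realizes_def A_def[symmetric]
  proof (intro conjI allI impI)
    fix M b ey en and w :: "nat list" and \<sigma> z
    assume b: "3 \<le> b" and inst: "installed A M (2 + 3)
      (sweep_frag 2 0 (\<lambda>m s. mu m (dec_cell s)) (\<lambda>m s. s) (\<lambda>m. m = 1)) b ey en" and w: "set w \<subseteq> {1, 2, 3}"
    let ?u = "tape K w \<sigma>"
    have "foldl (\<lambda>m s. mu m (dec_cell s)) 0 ?u = mem K mu 0 w \<sigma> (length w)"
      using foldl_mu_tape[OF w, of "length w"] by simp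
    then show "\<exists>t z'. t \<le> 2 * length w + 3 \<and> reaches M t (home b ?u z)
        (home (if fst (test K \<phi> w \<sigma>) then ey else en) (tape K w (snd (test K \<phi> w \<sigma>))) z')"
      using sweep_run[OF inst b set_tape[OF w, of K \<sigma>, folded A_def] A, of z]
      unfolding test_def id by (simp only: mem fst_conv snd_conv length_tape) blast
  qed (use poly_bound_sweep frag_ok_sweep in auto)
  then show ?thesis unfolding realizable_def by blast
qed

section \<open>Branching and sequencing\<close>

definition ifc :: "prog \<Rightarrow> prog \<Rightarrow> prog \<Rightarrow> prog" where
  "ifc F G H w \<sigma> = (if fst (F w \<sigma>) then G w (snd (F w \<sigma>)) else H w (snd (F w \<sigma>)))"

lemma frag_okD:
  assumes "frag_ok A Q g" and "q < Q" and "s < A"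
  shows "\<exists>q' s' d. g b ey en q s = (q', s', d) \<and> s' < A \<and> (b \<le> q' \<and> q' < b + Q \<or> q' = ey \<or> q' = en)"
  using assms unfolding frag_ok_def by blast

lemma installed_part:
  assumes "installed A M Q g b ey en" and "k + Q' \<le> Q"
    and "\<And>q s. q < Q' \<Longrightarrow> g b ey en (k + q) s = g' (b + k) ey' en' q s"
  shows "installed A M Q' g' (b + k) ey' en'"
  using assms by (auto simp: installed_def add.assoc)

text \<open>The three fragments occupy consecutive state intervals, and the exits of the first are
  the entry states of the other two. Sequencing is a special case: if \<open>F\<close> always
  answers no, \<open>ifc F (skip K) G\<close> runs \<open>F\<close> and then
  \<open>G\<close>.\<close>

lemma realizable_ifc:
  assumes "realizable K F" and "realizable K G" and "realizable K H"
  shows "realizable K (ifc F G H)"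
proof -
  define A :: nat where "A = 4 * 2 ^ K"
  obtain Q1 g1 B1 where F: "realizes K Q1 g1 B1 F" using assms(1) unfolding realizable_def by blast
  obtain Q2 g2 B2 where G: "realizes K Q2 g2 B2 G" using assms(2) unfolding realizable_def by blast
  obtain Q3 g3 B3 where H: "realizes K Q3 g3 B3 H" using assms(3) unfolding realizable_def by blast
  define g :: frag where "g b ey en q s = (if q < Q1 then g1 b (b + Q1) (b + (Q1 + Q2)) q s
     else if q < Q1 + Q2 then g2 (b + Q1) ey en (q - Q1) s
     else g3 (b + (Q1 + Q2)) ey en (q - (Q1 + Q2)) s)" for b ey en q s
  have ok: "frag_ok A Q1 g1" "frag_ok A Q2 g2" "frag_ok A Q3 g3"
    using F G H by (auto simp: realizes_def A_def)
  have inst: "installed A M Q1 g1 b (b + Q1) (b + (Q1 + Q2))" "installed A M Q2 g2 (b + Q1) ey en"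
    "installed A M Q3 g3 (b + (Q1 + Q2)) ey en"
    if "installed A M (Q1 + Q2 + Q3) g b ey en" for M b ey en
    using that installed_part[OF that, of 0 Q1 g1] installed_part[OF that, of Q1 Q2 g2]
      installed_part[OF that, of "Q1 + Q2" Q3 g3]
    by (simp_all add: g_def)
  have "realizes K (Q1 + Q2 + Q3) g (\<lambda>L. B1 L + (B2 L + B3 L)) (ifc F G H)"
    unfolding realizes_def A_def[symmetric]
  proof (intro conjI allI impI)
    show "poly_bound (\<lambda>L. B1 L + (B2 L + B3 L))"
      using F G H by (intro poly_bound_add) (auto simp: realizes_def)
    show "frag_ok A (Q1 + Q2 + Q3) g"
      unfolding frag_ok_def
    proof (intro conjI allI impI)
      fix b ey en q s assume q: "q < Q1 + Q2 + Q3" and s: "s < A"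
      consider "q < Q1" | "Q1 \<le> q" "q - Q1 < Q2" | "Q1 + Q2 \<le> q" "q - (Q1 + Q2) < Q3"
        using q by linarith
      then show "\<exists>q' s' d. g b ey en q s = (q', s', d) \<and> s' < A \<and>
        (b \<le> q' \<and> q' < b + (Q1 + Q2 + Q3) \<or> q' = ey \<or> q' = en)"
      proof cases
        case 1
        then show ?thesis using frag_okD[OF ok(1) 1 s, of b "b + Q1" "b + (Q1 + Q2)"] ok
          by (auto simp: g_def frag_ok_def)
      next
        case 2
        then show ?thesis using frag_okD[OF ok(2) 2(2) s, of "b + Q1" ey en]
          by (auto simp: g_def)
      next
        case 3
        then show ?thesis using frag_okD[OF ok(3) 3(2) s, of "b + (Q1 + Q2)" ey en]
          by (auto simp: g_def)
      qed
    qed (use ok in \<open>auto simp: frag_ok_def\<close>)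
  next
    fix M b ey en and w :: "nat list" and \<sigma> z
    assume b: "3 \<le> b" and i: "installed A M (Q1 + Q2 + Q3) g b ey en" and w: "set w \<subseteq> {1, 2, 3}"
    obtain t z' where t: "t \<le> B1 (length w)" "reaches M t (home b (tape K w \<sigma>) z)
        (home (if fst (F w \<sigma>) then b + Q1 else b + (Q1 + Q2)) (tape K w (snd (F w \<sigma>))) z')"
      using realizesD[OF F b inst(1)[OF i, unfolded A_def] w] by metis
    show "\<exists>t z'. t \<le> B1 (length w) + (B2 (length w) + B3 (length w)) \<and>
       reaches M t (home b (tape K w \<sigma>) z)
        (home (if fst (ifc F G H w \<sigma>) then ey else en) (tape K w (snd (ifc F G H w \<sigma>))) z')"
    proof (cases "fst (F w \<sigma>)")
      case True
      obtain t' z'' where t': "t' \<le> B2 (length w)"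
        "reaches M t' (home (b + Q1) (tape K w (snd (F w \<sigma>))) z')
          (home (if fst (ifc F G H w \<sigma>) then ey else en) (tape K w (snd (ifc F G H w \<sigma>))) z'')"
        using realizesD[OF G _ inst(2)[OF i, unfolded A_def] w, of "snd (F w \<sigma>)" z'] b True
        by (auto simp: ifc_def)
      have "reaches M (t + t') (home b (tape K w \<sigma>) z)
          (home (if fst (ifc F G H w \<sigma>) then ey else en) (tape K w (snd (ifc F G H w \<sigma>))) z'')"
        using reaches_trans[OF t(2)] t'(2) True by simp
      then show ?thesis using t(1) t'(1) by (intro exI conjI) auto
    next
      case False
      obtain t' z'' where t': "t' \<le> B3 (length w)"
        "reaches M t' (home (b + (Q1 + Q2)) (tape K w (snd (F w \<sigma>))) z')
          (home (if fst (ifc F G H w \<sigma>) then ey else en) (tape K w (snd (ifc F G H w \<sigma>))) z'')"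
        using realizesD[OF H _ inst(3)[OF i, unfolded A_def] w, of "snd (F w \<sigma>)" z'] b False
        by (auto simp: ifc_def)
      have "reaches M (t + t') (home b (tape K w \<sigma>) z)
          (home (if fst (ifc F G H w \<sigma>) then ey else en) (tape K w (snd (ifc F G H w \<sigma>))) z'')"
        using reaches_trans[OF t(2)] t'(2) False by simp
      then show ?thesis using t(1) t'(1) by (intro exI conjI) auto
    qed
  qed
  then show ?thesis unfolding realizable_def by blast
qed

section \<open>Loops over the positions of the word\<close>

definition first_pos :: "nat \<Rightarrow> nat \<Rightarrow> prog" where
  "first_pos K x = upd K x (\<lambda>_ _. 1) 0 (\<lambda>m _. m = 0)"

definition shift :: "nat \<Rightarrow> nat \<Rightarrow> prog" where
  "shift K x = upd K x (\<lambda>_ c. if x \<in> snd c then 1 else 0) 0 (\<lambda>m _. m = 1)"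

lemma mem_0 [simp]: "mem K mu m0 w \<sigma> 0 = m0"
  and mem_Suc [simp]: "mem K mu m0 w \<sigma> (Suc p) = mu (mem K mu m0 w \<sigma> p) (cell K w \<sigma> p)"
  by (simp_all add: mem_def)

lemma first_pos_eq: "first_pos K x w \<sigma> = (False, \<sigma>(x := {p. p = 0 \<and> p < length w}))"
proof -
  have "mem K (\<lambda>_ _. 1) 0 w \<sigma> p = 0 \<longleftrightarrow> p = 0" for p by (cases p) auto
  then show ?thesis by (auto simp: first_pos_def upd_def)
qed

lemma shift_eq:
  assumes "x < K"
  shows "shift K x w \<sigma> = (False, \<sigma>(x := {p. p < length w \<and> (\<exists>q\<in>\<sigma> x. p = Suc q)}))"
proof -
  have "mem K (\<lambda>_ c. if x \<in> snd c then 1 else 0) 0 w \<sigma> p = 1 \<longleftrightarrow> (\<exists>q\<in>\<sigma> x. p = Suc q)" for p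
    using assms by (cases p) (auto simp: cell_def)
  then show ?thesis by (auto simp: shift_def upd_def)
qed

lemma realizable_first_pos: "x < K \<Longrightarrow> realizable K (first_pos K x)"
  unfolding first_pos_def by (rule realizable_upd[of _ _ _ 2]) auto

lemma realizable_shift: "x < K \<Longrightarrow> realizable K (shift K x)"
  unfolding shift_def by (rule realizable_upd[of _ _ _ 2]) auto

text \<open>A yes of the body stops the loop and leaves the tracks as they are, so the loop is a
  search. With a body that always answers no it is a plain iteration, see
  \<open>forc_fold\<close>.\<close>

fun loop :: "nat \<Rightarrow> prog \<Rightarrow> nat list \<Rightarrow> nat list \<Rightarrow> tracks \<Rightarrow> bool \<times> tracks" where
  "loop x F [] w \<sigma> = (False, \<sigma>(x := {}))"
| "loop x F (p # ps) w \<sigma> = (let r = F w (\<sigma>(x := {p})) in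
     if fst r then r else loop x F ps w (snd r))"

definition forc :: "nat \<Rightarrow> prog \<Rightarrow> prog" where
  "forc x F w \<sigma> = loop x F [0..<length w] w \<sigma>"

lemma loop_upd: "loop x F ps w (\<sigma>(x := X)) = loop x F ps w \<sigma>"
  by (cases ps) auto

text \<open>The loop counter is a marker on track \<open>x\<close>: set it on the first cell, test
  whether it is still there, run the body, shift it, and return to the test. Shifted off the last
  cell it vanishes. Each round costs one test, one body and one shift, and one failing test ends the
  loop.\<close>

lemma realizable_forc:
  assumes "realizable K F" and x: "x < K" and pres: "\<And>w \<sigma>. snd (F w \<sigma>) x = \<sigma> x"
  shows "realizable K (forc x F)"
proof -
  define A :: nat where "A = 4 * 2 ^ K"
  define T where "T = test K (\<lambda>c. x \<in> snd c)"
  obtain Q1 g1 B1 where I: "realizes K Q1 g1 B1 (first_pos K x)"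
    using realizable_first_pos[OF x] unfolding realizable_def by blast
  obtain Q2 g2 B2 where T: "realizes K Q2 g2 B2 T"
    using realizable_test unfolding realizable_def T_def by blast
  obtain Q3 g3 B3 where F: "realizes K Q3 g3 B3 F"
    using assms(1) unfolding realizable_def by blast
  obtain Q4 g4 B4 where S: "realizes K Q4 g4 B4 (shift K x)"
    using realizable_shift[OF x] unfolding realizable_def by blast
  define g :: frag where "g b ey en q s = (
     if q < Q1 then g1 b (b + Q1) (b + Q1) q s
     else if q < Q1 + Q2 then g2 (b + Q1) (b + (Q1 + Q2)) en (q - Q1) s
     else if q < Q1 + Q2 + Q3 then g3 (b + (Q1 + Q2)) ey (b + (Q1 + Q2 + Q3)) (q - (Q1 + Q2)) s
     else g4 (b + (Q1 + Q2 + Q3)) (b + Q1) (b + Q1) (q - (Q1 + Q2 + Q3)) s)" for b ey en q s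
  let ?Q = "Q1 + Q2 + Q3 + Q4"
  have ok: "frag_ok A Q1 g1" "frag_ok A Q2 g2" "frag_ok A Q3 g3" "frag_ok A Q4 g4"
    using I F T S by (auto simp: realizes_def A_def)
  have inst: "installed A M Q1 g1 b (b + Q1) (b + Q1)"
    "installed A M Q2 g2 (b + Q1) (b + (Q1 + Q2)) en"
    "installed A M Q3 g3 (b + (Q1 + Q2)) ey (b + (Q1 + Q2 + Q3))"
    "installed A M Q4 g4 (b + (Q1 + Q2 + Q3)) (b + Q1) (b + Q1)"
    if "installed A M ?Q g b ey en" for M b ey en
    using installed_part[OF that, of 0 Q1 g1] installed_part[OF that, of Q1 Q2 g2]
      installed_part[OF that, of "Q1 + Q2" Q3 g3] installed_part[OF that, of "Q1 + Q2 + Q3" Q4 g4]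
    by (simp_all add: g_def)
  define B where "B L = B1 L + (L * (B2 L + (B3 L + B4 L)) + B2 L)" for L
  have "realizes K ?Q g B (forc x F)"
    unfolding realizes_def A_def[symmetric]
  proof (intro conjI allI impI)
    have "poly_bound (\<lambda>L. L)"
      unfolding poly_bound_def by (rule exI[of _ 1], rule exI[of _ 1]) simp
    then show "poly_bound B"
      unfolding B_def using I F T S by (intro poly_bound_add poly_bound_mult) (auto simp: realizes_def)
    show "frag_ok A ?Q g"
      unfolding frag_ok_def
    proof (intro conjI allI impI)
      fix b ey en q s assume q: "q < ?Q" and s: "s < A"
      consider "q < Q1" | "Q1 \<le> q" "q - Q1 < Q2" | "Q1 + Q2 \<le> q" "q - (Q1 + Q2) < Q3"
        | "Q1 + Q2 + Q3 \<le> q" "q - (Q1 + Q2 + Q3) < Q4"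
        using q by linarith
      then show "\<exists>q' s' d. g b ey en q s = (q', s', d) \<and> s' < A \<and>
        (b \<le> q' \<and> q' < b + ?Q \<or> q' = ey \<or> q' = en)"
      proof cases
        case 1
        then show ?thesis using frag_okD[OF ok(1) 1 s, of b "b + Q1" "b + Q1"] ok
          by (auto simp: g_def frag_ok_def)
      next
        case 2
        then show ?thesis using frag_okD[OF ok(2) 2(2) s, of "b + Q1" "b + (Q1 + Q2)" en] ok
          by (auto simp: g_def frag_ok_def)
      next
        case 3
        then show ?thesis
          using frag_okD[OF ok(3) 3(2) s, of "b + (Q1 + Q2)" ey "b + (Q1 + Q2 + Q3)"] ok
          by (auto simp: g_def frag_ok_def)
      next
        case 4
        then show ?thesis
          using frag_okD[OF ok(4) 4(2) s, of "b + (Q1 + Q2 + Q3)" "b + Q1" "b + Q1"] ok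
          by (auto simp: g_def frag_ok_def)
      qed
    qed (use ok in \<open>auto simp: frag_ok_def\<close>)
  next
    fix M b ey en and w :: "nat list" and \<sigma> z
    assume b: "3 \<le> b" and i: "installed A M ?Q g b ey en" and w: "set w \<subseteq> {1, 2, 3}"
    let ?L = "length w"
    \<comment> \<open>Invariant: the marker is on cell \<open>p\<close>, or gone if \<open>p\<close>
      is the length of the word.\<close>
    have iter: "\<exists>t z'. t \<le> (?L - p) * (B2 ?L + (B3 ?L + B4 ?L)) + B2 ?L \<and>
       reaches M t (home (b + Q1) (tape K w \<sigma>) z)
        (home (if fst (loop x F [p..<?L] w \<sigma>) then ey else en) (tape K w (snd (loop x F [p..<?L] w \<sigma>))) z')"
      if "p \<le> ?L" "\<sigma> x = {q. q = p \<and> q < ?L}" for p \<sigma> z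
      using that
    proof (induction "?L - p" arbitrary: p \<sigma> z)
      case 0
      then have p: "p = ?L" "\<sigma> x = {}" by auto
      have "\<not> fst (T w \<sigma>)" "snd (T w \<sigma>) = \<sigma>" using p by (auto simp: T_def test_def cell_def)
      then obtain t z' where "t \<le> B2 ?L"
        "reaches M t (home (b + Q1) (tape K w \<sigma>) z) (home en (tape K w \<sigma>) z')"
        using realizesD[OF T _ inst(2)[OF i, unfolded A_def] w, of \<sigma> z] b by auto
      moreover have "loop x F [p..<?L] w \<sigma> = (False, \<sigma>)" using p by (auto simp: fun_upd_idem)
      ultimately show ?case using p by (intro exI[of _ t] exI[of _ z']) simp
    next
      case (Suc n)
      then have p: "p < ?L" "\<sigma> x = {p}" by auto
      have up: "[p..<?L] = p # [Suc p..<?L]" using p by (simp add: upt_conv_Cons)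
      have \<sigma>: "\<sigma>(x := {p}) = \<sigma>" using p by (simp add: fun_upd_idem)
      have "fst (T w \<sigma>)" "snd (T w \<sigma>) = \<sigma>" using p x by (auto simp: T_def test_def cell_def)
      then obtain t1 z1 where t1: "t1 \<le> B2 ?L"
        "reaches M t1 (home (b + Q1) (tape K w \<sigma>) z) (home (b + (Q1 + Q2)) (tape K w \<sigma>) z1)"
        using realizesD[OF T _ inst(2)[OF i, unfolded A_def] w, of \<sigma> z] b by auto
      let ?s = "snd (F w \<sigma>)"
      obtain t2 z2 where t2: "t2 \<le> B3 ?L"
        "reaches M t2 (home (b + (Q1 + Q2)) (tape K w \<sigma>) z1)
          (home (if fst (F w \<sigma>) then ey else b + (Q1 + Q2 + Q3)) (tape K w ?s) z2)"
        using realizesD[OF F _ inst(3)[OF i, unfolded A_def] w, of \<sigma> z1] b by auto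
      have t12: "reaches M (t1 + t2) (home (b + Q1) (tape K w \<sigma>) z)
          (home (if fst (F w \<sigma>) then ey else b + (Q1 + Q2 + Q3)) (tape K w ?s) z2)"
        by (rule reaches_trans[OF t1(2) t2(2)])
      obtain m where m: "?L - p = Suc m" using p by (metis Suc_diff_Suc)
      show ?case
      proof (cases "fst (F w \<sigma>)")
        case True
        have "t1 + t2 \<le> (?L - p) * (B2 ?L + (B3 ?L + B4 ?L)) + B2 ?L"
          using t1(1) t2(1) unfolding m by simp
        then show ?thesis using t12 True up \<sigma> by (intro exI[of _ "t1 + t2"] exI[of _ z2]) (simp add: Let_def)
      next
        case False
        let ?s' = "?s(x := {q. q = Suc p \<and> q < ?L})"
        have "snd (shift K x w ?s) = ?s'" using pres[of w \<sigma>] p by (auto simp: shift_eq[OF x])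
        then obtain t3 z3 where t3: "t3 \<le> B4 ?L"
          "reaches M t3 (home (b + (Q1 + Q2 + Q3)) (tape K w ?s) z2) (home (b + Q1) (tape K w ?s') z3)"
          using realizesD[OF S _ inst(4)[OF i, unfolded A_def] w, of ?s z2] b by auto
        obtain t4 z4 where t4: "t4 \<le> (?L - Suc p) * (B2 ?L + (B3 ?L + B4 ?L)) + B2 ?L"
          "reaches M t4 (home (b + Q1) (tape K w ?s') z3)
           (home (if fst (loop x F [Suc p..<?L] w ?s') then ey else en) (tape K w (snd (loop x F [Suc p..<?L] w ?s'))) z4)"
          using Suc.hyps(1)[of "Suc p" ?s' z3] Suc.hyps(2) p by (simp only: fun_upd_same) fastforce
        have eq: "loop x F [p..<?L] w \<sigma> = loop x F [Suc p..<?L] w ?s'"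
          using False by (simp add: up \<sigma> loop_upd Let_def)
        have "reaches M (t1 + t2 + t3 + t4) (home (b + Q1) (tape K w \<sigma>) z)
           (home (if fst (loop x F [p..<?L] w \<sigma>) then ey else en) (tape K w (snd (loop x F [p..<?L] w \<sigma>))) z4)"
          unfolding eq using t12 False by (intro reaches_trans[OF reaches_trans[OF _ t3(2)] t4(2)]) simp
        moreover have "?L - Suc p = m" using m by simp
        then have "t1 + t2 + t3 + t4 \<le> (?L - p) * (B2 ?L + (B3 ?L + B4 ?L)) + B2 ?L"
          using t1(1) t2(1) t3(1) t4(1) unfolding m by simp
        ultimately show ?thesis by blast
      qed
    qed
    let ?s = "\<sigma>(x := {p. p = 0 \<and> p < ?L})"
    obtain t1 z1 where t1: "t1 \<le> B1 ?L"
      "reaches M t1 (home b (tape K w \<sigma>) z) (home (b + Q1) (tape K w ?s) z1)"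
      using realizesD[OF I b inst(1)[OF i, unfolded A_def] w, of \<sigma> z] by (auto simp: first_pos_eq)
    obtain t2 z2 where t2: "t2 \<le> ?L * (B2 ?L + (B3 ?L + B4 ?L)) + B2 ?L"
      "reaches M t2 (home (b + Q1) (tape K w ?s) z1)
        (home (if fst (loop x F [0..<?L] w ?s) then ey else en) (tape K w (snd (loop x F [0..<?L] w ?s))) z2)"
      using iter[of 0 ?s z1] by auto
    have "forc x F w \<sigma> = loop x F [0..<?L] w ?s" by (simp add: forc_def loop_upd)
    then show "\<exists>t z'. t \<le> B ?L \<and> reaches M t (home b (tape K w \<sigma>) z)
        (home (if fst (forc x F w \<sigma>) then ey else en) (tape K w (snd (forc x F w \<sigma>))) z')"
      using reaches_trans[OF t1(2) t2(2)] add_mono[OF t1(1) t2(1)] unfolding B_def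
      by (intro exI[of _ "t1 + t2"] exI[of _ z2]) simp
  qed
  then show ?thesis unfolding realizable_def by blast
qed

subsection \<open>First-order definable properties\<close>

definition notp :: "prog \<Rightarrow> prog" where
  "notp F w \<sigma> = (\<not> fst (F w \<sigma>), snd (F w \<sigma>))"

lemma realizable_notp:
  assumes "realizable K F"
  shows "realizable K (notp F)"
proof -
  obtain Q g B where F: "realizes K Q g B F" using assms unfolding realizable_def by blast
  have "installed A M Q (\<lambda>b ey en. g b en ey) b ey en = installed A M Q g b en ey" for A M b ey en
    by (simp add: installed_def)
  moreover have "frag_ok A Q (\<lambda>b ey en. g b en ey)" if "frag_ok A Q g" for A
    using that unfolding frag_ok_def by meson
  moreover have "(if fst (notp F w \<sigma>) then ey else en) = (if fst (F w \<sigma>) then en else ey)"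
    "snd (notp F w \<sigma>) = snd (F w \<sigma>)" for w \<sigma> and ey en :: nat
    by (auto simp: notp_def)
  ultimately have "realizes K Q (\<lambda>b ey en. g b en ey) B (notp F)"
    using F unfolding realizes_def by simp
  then show ?thesis unfolding realizable_def by blast
qed

definition skip :: "nat \<Rightarrow> prog" where
  "skip K = test K (\<lambda>_. False)"

lemma skip_eq [simp]: "skip K w \<sigma> = (False, \<sigma>)"
  by (simp add: skip_def test_def)

lemma realizable_skip: "realizable K (skip K)"
  unfolding skip_def by (rule realizable_test)

definition local_set :: "nat \<Rightarrow> nat \<Rightarrow> (nat \<times> nat set \<Rightarrow> bool) \<Rightarrow> prog" where
  "local_set K x \<phi> = upd K x (\<lambda>_ _. 0) 0 (\<lambda>_. \<phi>)"

lemma local_set_eq: "local_set K x \<phi> w \<sigma> = (False, \<sigma>(x := {p. p < length w \<and> \<phi> (cell K w \<sigma> p)}))"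
  by (simp add: local_set_def upd_def)

lemma realizable_local_set: "x < K \<Longrightarrow> realizable K (local_set K x \<phi>)"
  unfolding local_set_def by (rule realizable_upd[of _ _ _ 1]) auto

lemmas realizable_intros =
  realizable_ifc realizable_forc realizable_notp realizable_skip realizable_test
  realizable_local_set realizable_shift

definition agree :: "nat \<Rightarrow> tracks \<Rightarrow> tracks \<Rightarrow> bool" where
  "agree d \<sigma> \<tau> \<longleftrightarrow> (\<forall>k<d. \<sigma> k = \<tau> k)"

lemma agree_refl [simp]: "agree d \<sigma> \<sigma>"
  by (simp add: agree_def)

lemma agree_trans: "agree d \<sigma> \<tau> \<Longrightarrow> agree d \<tau> \<rho> \<Longrightarrow> agree d \<sigma> \<rho>"
  by (simp add: agree_def)

lemma agree_mono: "agree d \<sigma> \<tau> \<Longrightarrow> d' \<le> d \<Longrightarrow> agree d' \<sigma> \<tau>"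
  by (simp add: agree_def)

lemma agree_upd [simp]: "d \<le> x \<Longrightarrow> agree d (\<sigma>(x := X)) \<tau> \<longleftrightarrow> agree d \<sigma> \<tau>"
  by (auto simp: agree_def)

lemma agree_upd_right [simp]: "d \<le> x \<Longrightarrow> agree d \<tau> (\<sigma>(x := X)) \<longleftrightarrow> agree d \<tau> \<sigma>"
  by (auto simp: agree_def)

text \<open>\<open>testable K d P\<close>: the property \<open>P\<close> of the tracks below \<open>d\<close> can be decided by a program
  that uses the tracks from \<open>d\<close> on as scratch space.\<close>

definition testable :: "nat \<Rightarrow> nat \<Rightarrow> (nat list \<Rightarrow> tracks \<Rightarrow> bool) \<Rightarrow> bool" where
  "testable K d P \<longleftrightarrow> (\<forall>w \<sigma> \<tau>. agree d \<sigma> \<tau> \<longrightarrow> P w \<sigma> = P w \<tau>) \<and>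
     (\<exists>F. realizable K F \<and> (\<forall>w \<sigma>. fst (F w \<sigma>) = P w \<sigma> \<and> agree d (snd (F w \<sigma>)) \<sigma>))"

text \<open>The set is delivered in track \<open>d\<close>, the first free one, so that it becomes a
  further variable for what follows; see \<open>testable_let\<close>.\<close>

definition definable :: "nat \<Rightarrow> nat \<Rightarrow> (nat list \<Rightarrow> tracks \<Rightarrow> nat set) \<Rightarrow> bool" where
  "definable K d S \<longleftrightarrow> (\<forall>w \<sigma> \<tau>. agree d \<sigma> \<tau> \<longrightarrow> S w \<sigma> = S w \<tau>) \<and>
     (\<exists>F. realizable K F \<and> (\<forall>w \<sigma>. snd (F w \<sigma>) d = S w \<sigma> \<and> agree d (snd (F w \<sigma>)) \<sigma>))"

lemma testable_cong: "testable K d P \<Longrightarrow> agree d \<sigma> \<tau> \<Longrightarrow> P w \<sigma> = P w \<tau>"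
  by (simp add: testable_def)

lemma testable_one:
  assumes "x < d" and "d \<le> K"
  shows "testable K d (\<lambda>w \<sigma>. \<exists>p<length w. p \<in> \<sigma> x \<and> w ! p = 1)"
  unfolding testable_def
  using assms realizable_test[of K "\<lambda>c. x \<in> snd c \<and> fst c = 1"]
  by (intro conjI exI[of _ "test K (\<lambda>c. x \<in> snd c \<and> fst c = 1)"])
    (auto simp: test_def cell_def agree_def)

lemma testable_meet:
  assumes "x < d" and "y < d" and "d \<le> K"
  shows "testable K d (\<lambda>w \<sigma>. \<exists>p<length w. p \<in> \<sigma> x \<and> p \<in> \<sigma> y)"
  unfolding testable_def
  using assms realizable_test[of K "\<lambda>c. x \<in> snd c \<and> y \<in> snd c"]
  by (intro conjI exI[of _ "test K (\<lambda>c. x \<in> snd c \<and> y \<in> snd c)"])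
    (auto simp: test_def cell_def agree_def)

lemma testable_not:
  assumes "testable K d P"
  shows "testable K d (\<lambda>w \<sigma>. \<not> P w \<sigma>)"
proof -
  obtain F where F: "realizable K F" "\<And>w \<sigma>. fst (F w \<sigma>) = P w \<sigma>" "\<And>w \<sigma>. agree d (snd (F w \<sigma>)) \<sigma>"
    using assms unfolding testable_def by blast
  then show ?thesis unfolding testable_def
    using testable_cong[OF assms] realizable_notp[OF F(1)]
    by (intro conjI exI[of _ "notp F"]) (auto simp: notp_def)
qed

lemma testable_conj:
  assumes "testable K d P" and "testable K d R"
  shows "testable K d (\<lambda>w \<sigma>. P w \<sigma> \<and> R w \<sigma>)"
proof -
  obtain F where F: "realizable K F" "\<And>w \<sigma>. fst (F w \<sigma>) = P w \<sigma>" "\<And>w \<sigma>. agree d (snd (F w \<sigma>)) \<sigma>"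
    using assms(1) unfolding testable_def by blast
  obtain G where G: "realizable K G" "\<And>w \<sigma>. fst (G w \<sigma>) = R w \<sigma>" "\<And>w \<sigma>. agree d (snd (G w \<sigma>)) \<sigma>"
    using assms(2) unfolding testable_def by blast
  have "fst (ifc F G (skip K) w \<sigma>) = (P w \<sigma> \<and> R w \<sigma>)" for w \<sigma>
    using F G testable_cong[OF assms(2) F(3)] by (simp add: ifc_def)
  moreover have "agree d (snd (ifc F G (skip K) w \<sigma>)) \<sigma>" for w \<sigma>
    using F(3) agree_trans[OF G(3) F(3)] by (simp add: ifc_def)
  moreover have "realizable K (ifc F G (skip K))"
    using F G by (intro realizable_intros)
  ultimately show ?thesis unfolding testable_def
    using testable_cong[OF assms(1)] testable_cong[OF assms(2)] by blast
qed

lemma testable_disj: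
  assumes "testable K d P" and "testable K d R"
  shows "testable K d (\<lambda>w \<sigma>. P w \<sigma> \<or> R w \<sigma>)"
  using testable_not[OF testable_conj[OF testable_not[OF assms(1)] testable_not[OF assms(2)]]] by simp

text \<open>A round may leave garbage on the tracks above \<open>d\<close>, but \<open>P\<close>
  does not depend on them, and track \<open>d\<close> is overwritten by the next round.\<close>

lemma loop_ex:
  assumes F: "\<And>\<sigma>. fst (F w \<sigma>) = P \<sigma>" "\<And>\<sigma>. agree (Suc d) (snd (F w \<sigma>)) \<sigma>"
    and P: "\<And>\<sigma> \<tau>. agree (Suc d) \<sigma> \<tau> \<Longrightarrow> P \<sigma> = P \<tau>"
  shows "fst (loop d F ps w \<sigma>) = (\<exists>p\<in>set ps. P (\<sigma>(d := {p}))) \<and> agree d (snd (loop d F ps w \<sigma>)) \<sigma>"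
proof (induction ps arbitrary: \<sigma>)
  case (Cons p ps)
  let ?s = "snd (F w (\<sigma>(d := {p})))"
  have a: "agree d ?s \<sigma>" using F(2)[of "\<sigma>(d := {p})"] by (auto simp: agree_def)
  then have "P (?s(d := {q})) = P (\<sigma>(d := {q}))" for q
    by (intro P) (auto simp: agree_def)
  then have "fst (loop d F ps w ?s) = (\<exists>p\<in>set ps. P (\<sigma>(d := {p})))"
    and "agree d (snd (loop d F ps w ?s)) \<sigma>"
    using Cons[of ?s] agree_trans[OF _ a] by (simp_all del: fun_upd_apply)
  then show ?case using a F(1)[of "\<sigma>(d := {p})"]
    by (cases "P (\<sigma>(d := {p}))") (simp_all add: Let_def del: fun_upd_apply)
qed simp

lemma testable_ex:
  assumes "testable K (Suc d) P" and "d < K"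
  shows "testable K d (\<lambda>w \<sigma>. \<exists>p<length w. P w (\<sigma>(d := {p})))"
proof -
  obtain F where F: "realizable K F" "\<And>w \<sigma>. fst (F w \<sigma>) = P w \<sigma>"
    "\<And>w \<sigma>. agree (Suc d) (snd (F w \<sigma>)) \<sigma>" using assms(1) unfolding testable_def by blast
  have "realizable K (forc d F)"
    using F assms(2) by (intro realizable_forc) (auto simp: agree_def)
  moreover have "fst (forc d F w \<sigma>) = (\<exists>p<length w. P w (\<sigma>(d := {p}))) \<and> agree d (snd (forc d F w \<sigma>)) \<sigma>"
    for w \<sigma>
    using loop_ex[of F w "P w" d "[0..<length w]" \<sigma>] F testable_cong[OF assms(1)]
    unfolding forc_def by (auto simp: Bex_def)
  moreover have "P w (\<sigma>(d := X)) = P w (\<tau>(d := X))" if "agree d \<sigma> \<tau>" for w \<sigma> \<tau> X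
    using that by (intro testable_cong[OF assms(1)]) (auto simp: agree_def less_Suc_eq)
  ultimately show ?thesis unfolding testable_def by (intro conjI) (auto 0 4)
qed

lemma testable_let:
  assumes "definable K d S" and "testable K (Suc d) P"
  shows "testable K d (\<lambda>w \<sigma>. P w (\<sigma>(d := S w \<sigma>)))"
proof -
  obtain F where F: "realizable K F" "\<And>w \<sigma>. snd (F w \<sigma>) d = S w \<sigma>" "\<And>w \<sigma>. agree d (snd (F w \<sigma>)) \<sigma>"
    and S: "\<And>w \<sigma> \<tau>. agree d \<sigma> \<tau> \<Longrightarrow> S w \<sigma> = S w \<tau>"
    using assms(1) unfolding definable_def by blast
  obtain G where G: "realizable K G" "\<And>w \<sigma>. fst (G w \<sigma>) = P w \<sigma>"
    "\<And>w \<sigma>. agree (Suc d) (snd (G w \<sigma>)) \<sigma>" using assms(2) unfolding testable_def by blast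
  have *: "P w \<sigma> = P w (\<tau>(d := S w \<tau>))" if "agree d \<sigma> \<tau>" "\<sigma> d = S w \<tau>" for w \<sigma> \<tau>
    using that by (intro testable_cong[OF assms(2)]) (auto simp: agree_def less_Suc_eq)
  \<comment> \<open>\<open>F\<close> is run for the track that it fills; its answer is ignored,
    hence the equal branches.\<close>
  have "fst (ifc F G G w \<sigma>) = P w (\<sigma>(d := S w \<sigma>))" for w \<sigma>
    using F G *[of "snd (F w \<sigma>)" \<sigma> w] by (simp add: ifc_def)
  moreover have "agree d (snd (ifc F G G w \<sigma>)) \<sigma>" for w \<sigma>
    using agree_trans[OF agree_mono[OF G(3), of d] F(3)] by (simp add: ifc_def)
  moreover have "realizable K (ifc F G G)"
    using F G by (intro realizable_intros)
  moreover have "P w (\<sigma>(d := S w \<sigma>)) = P w (\<tau>(d := S w \<tau>))" if "agree d \<sigma> \<tau>" for w \<sigma> \<tau>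
    using that S[OF that] by (intro *) auto
  ultimately show ?thesis unfolding testable_def by blast
qed

section \<open>Unary blocks: finding the next one and comparing two\<close>

definition val :: "nat list \<Rightarrow> nat \<Rightarrow> nat" where
  "val w p = length (takeWhile ((=) 1) (drop p w))"

definition next_block :: "nat list \<Rightarrow> nat \<Rightarrow> nat" where
  "next_block w p = p + val w p + 1"

lemma val_less: "p + i < length w \<Longrightarrow> i < val w p \<longleftrightarrow> (\<forall>k\<le>i. w ! (p + k) = 1)"
proof (induction i)
  case 0
  then show ?case by (cases "drop p w") (auto simp: val_def hd_drop_conv_nth[symmetric])
next
  case (Suc i)
  let ?u = "drop p w"
  show ?case
  proof
    assume *: "Suc i < val w p"
    then have "\<forall>k\<le>i. w ! (p + k) = 1" using Suc by simp
    moreover have "w ! (p + Suc i) = 1"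
    proof -
      have "takeWhile ((=) 1) ?u ! Suc i = 1"
        using * set_takeWhileD[OF nth_mem, of "Suc i" "(=) 1" ?u] by (simp add: val_def)
      moreover have "takeWhile ((=) 1) ?u ! Suc i = ?u ! Suc i"
        using * by (intro takeWhile_nth) (simp add: val_def)
      ultimately show ?thesis using Suc.prems by simp
    qed
    ultimately show "\<forall>k\<le>Suc i. w ! (p + k) = 1" by (auto simp: le_Suc_eq)
  next
    assume *: "\<forall>k\<le>Suc i. w ! (p + k) = 1"
    have "val w p \<noteq> Suc i"
    proof
      assume v: "val w p = Suc i"
      then have "1 \<noteq> ?u ! Suc i"
        using nth_length_takeWhile[of "(=) 1" ?u] Suc.prems by (simp add: val_def)
      then show False using * Suc.prems by auto
    qed
    moreover have "i < val w p" using * Suc by simp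
    ultimately show "Suc i < val w p" by simp
  qed
qed

lemma next_block_eq_iff:
  assumes "q \<le> p" and "p < length w"
  shows "next_block w q = Suc p \<longleftrightarrow> (\<forall>i. q \<le> i \<and> i < p \<longrightarrow> w ! i = 1) \<and> w ! p \<noteq> 1"
proof -
  define n where "n = p - q"
  have p: "p = q + n" using assms(1) by (simp add: n_def)
  have *: "i < val w q \<longleftrightarrow> (\<forall>k\<le>i. w ! (q + k) = 1)" if "i \<le> n" for i
    using that assms(2) p by (intro val_less) simp
  have range: "(\<forall>i. q \<le> i \<and> i < p \<longrightarrow> w ! i = 1) \<longleftrightarrow> (\<forall>k<n. w ! (q + k) = 1)"
  proof (intro iffI allI impI)
    fix i assume "\<forall>k<n. w ! (q + k) = 1" "q \<le> i \<and> i < p"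
    then show "w ! i = 1" using p by (auto dest: spec[of _ "i - q"])
  qed (simp add: p)
  have "val w q = n \<longleftrightarrow> (\<forall>k<n. w ! (q + k) = 1) \<and> w ! (q + n) \<noteq> 1"
  proof
    assume v: "val w q = n"
    have ones: "w ! (q + k) = 1" if "k < n" for k using *[of k] v that by simp
    have "\<not> (\<forall>k\<le>n. w ! (q + k) = 1)" using *[of n] v by simp
    then show "(\<forall>k<n. w ! (q + k) = 1) \<and> w ! (q + n) \<noteq> 1" using ones by (metis le_less)
  next
    assume a: "(\<forall>k<n. w ! (q + k) = 1) \<and> w ! (q + n) \<noteq> 1"
    then have "\<not> n < val w q" using *[of n] by auto
    moreover have "n \<le> val w q"
    proof (cases n)
      case (Suc m)
      then show ?thesis using *[of m] a by auto
    qed simp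
    ultimately show "val w q = n" by simp
  qed
  then show ?thesis using range p by (simp add: next_block_def)
qed

text \<open>Value 1: only ones have been read since some marked position. Value 2: a block starting
  at a marked position has just ended. Marks inside one run of ones share its end, so three values
  suffice for any set of marks.\<close>

definition block_mem :: "nat \<Rightarrow> nat \<Rightarrow> nat \<times> nat set \<Rightarrow> nat" where
  "block_mem x m c = (if x \<in> snd c \<or> m = 1 then if fst c = 1 then 1 else 2 else 0)"

lemma mem_block_mem:
  assumes "x < K"
  shows "p \<le> length w \<Longrightarrow>
    (mem K (block_mem x) 0 w \<sigma> p = 1 \<longleftrightarrow> (\<exists>q\<in>\<sigma> x. q < p \<and> (\<forall>i. q \<le> i \<and> i < p \<longrightarrow> w ! i = 1))) \<and>
    (mem K (block_mem x) 0 w \<sigma> p = 2 \<longleftrightarrow> (\<exists>q\<in>\<sigma> x. next_block w q = p))"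
proof (induction p)
  case (Suc p)
  define C where "C \<longleftrightarrow> (\<exists>q\<in>\<sigma> x. q \<le> p \<and> (\<forall>i. q \<le> i \<and> i < p \<longrightarrow> w ! i = 1))"
  have "C \<longleftrightarrow> p \<in> \<sigma> x \<or> (\<exists>q\<in>\<sigma> x. q < p \<and> (\<forall>i. q \<le> i \<and> i < p \<longrightarrow> w ! i = 1))"
  proof
    assume C
    then obtain q where q: "q \<in> \<sigma> x" "q \<le> p" "\<forall>i. q \<le> i \<and> i < p \<longrightarrow> w ! i = 1"
      unfolding C_def by blast
    then show "p \<in> \<sigma> x \<or> (\<exists>q\<in>\<sigma> x. q < p \<and> (\<forall>i. q \<le> i \<and> i < p \<longrightarrow> w ! i = 1))"
      by (metis le_neq_implies_less)
  next
    assume "p \<in> \<sigma> x \<or> (\<exists>q\<in>\<sigma> x. q < p \<and> (\<forall>i. q \<le> i \<and> i < p \<longrightarrow> w ! i = 1))"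
    then show C unfolding C_def by (meson leD less_imp_le order_refl)
  qed
  then have "x \<in> snd (cell K w \<sigma> p) \<or> mem K (block_mem x) 0 w \<sigma> p = 1 \<longleftrightarrow> C"
    using Suc assms by (simp add: cell_def)
  then have 1: "mem K (block_mem x) 0 w \<sigma> (Suc p) = (if C then if w ! p = 1 then 1 else 2 else 0)"
    by (simp add: block_mem_def cell_def)
  have "next_block w q = Suc p \<longleftrightarrow> q \<le> p \<and> (\<forall>i. q \<le> i \<and> i < p \<longrightarrow> w ! i = 1) \<and> w ! p \<noteq> 1" for q
  proof -
    have "q \<le> p" if "next_block w q = Suc p" using that by (simp add: next_block_def)
    then show ?thesis using next_block_eq_iff[of q p w] Suc.prems by (meson Suc_le_lessD)
  qed
  then have 2: "(\<exists>q\<in>\<sigma> x. next_block w q = Suc p) \<longleftrightarrow> C \<and> w ! p \<noteq> 1"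
    unfolding C_def by blast
  have 3: "(\<exists>q\<in>\<sigma> x. q < Suc p \<and> (\<forall>i. q \<le> i \<and> i < Suc p \<longrightarrow> w ! i = 1)) \<longleftrightarrow> C \<and> w ! p = 1"
  proof -
    have "(\<forall>i. q \<le> i \<and> i < Suc p \<longrightarrow> w ! i = 1) \<longleftrightarrow> (\<forall>i. q \<le> i \<and> i < p \<longrightarrow> w ! i = 1) \<and> w ! p = 1"
      if "q \<le> p" for q
      using that less_Suc_eq by auto
    then show ?thesis unfolding C_def less_Suc_eq_le[of _ p] by blast
  qed
  show ?case unfolding 1 2 3 by simp
qed (auto simp: next_block_def)

lemma definable_next_block:
  assumes "x < d" and "d < K"
  shows "definable K d (\<lambda>w \<sigma>. {p. p < length w \<and> (\<exists>q\<in>\<sigma> x. next_block w q = p)})"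
proof -
  let ?F = "upd K d (block_mem x) 0 (\<lambda>m _. m = 2)"
  have "realizable K ?F"
    using assms(2) by (intro realizable_upd[of _ _ _ 3]) (auto simp: block_mem_def)
  moreover have "?F w \<sigma> = (False, \<sigma>(d := {p. p < length w \<and> (\<exists>q\<in>\<sigma> x. next_block w q = p)}))" for w \<sigma>
    using mem_block_mem[of x K _ w \<sigma>] assms by (simp add: upd_def cong: conj_cong)
  ultimately show ?thesis
    unfolding definable_def using assms by (intro conjI exI[of _ ?F]) (auto simp: agree_def)
qed

lemma loop_fold:
  assumes "\<And>\<sigma>. fst (F w \<sigma>) = False"
  shows "loop x F ps w \<sigma> = (False, (fold (\<lambda>p \<sigma>. snd (F w (\<sigma>(x := {p})))) ps \<sigma>)(x := {}))"
  using assms by (induction ps arbitrary: \<sigma>) (auto simp: Let_def)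

lemma forc_fold:
  assumes "\<And>\<sigma>. fst (F w \<sigma>) = False"
  shows "forc x F w \<sigma> = (False, (fold (\<lambda>p \<sigma>. snd (F w (\<sigma>(x := {p})))) [0..<length w] \<sigma>)(x := {}))"
  unfolding forc_def using loop_fold[of F w, OF assms] .

definition shifted :: "nat \<Rightarrow> nat set \<Rightarrow> nat set" where
  "shifted L U = {p. p < L \<and> (\<exists>q\<in>U. p = Suc q)}"

definition walk :: "nat list \<Rightarrow> nat set \<times> nat set \<Rightarrow> nat set \<times> nat set" where
  "walk w = (\<lambda>(U, V). if (\<exists>p<length w. p \<in> U \<and> w ! p = 1) \<and> (\<exists>p<length w. p \<in> V \<and> w ! p = 1)
     then (shifted (length w) U, shifted (length w) V) else (U, V))"

text \<open>Only meant for singletons; see \<open>same_val_singleton\<close>.\<close>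

definition same_val :: "nat list \<Rightarrow> nat set \<Rightarrow> nat set \<Rightarrow> bool" where
  "same_val w U V \<longleftrightarrow>
     (case (walk w ^^ length w) (U \<inter> {..<length w}, V \<inter> {..<length w}) of (U', V') \<Rightarrow>
       \<not> (\<exists>p<length w. p \<in> U' \<and> w ! p = 1) \<and> \<not> (\<exists>p<length w. p \<in> V' \<and> w ! p = 1))"

lemma shifted_singleton: "shifted L {a} = (if Suc a < L then {Suc a} else {})"
  by (auto simp: shifted_def)

lemma ex_singleton: "(\<exists>p<L. p \<in> {a} \<and> R p) \<longleftrightarrow> a < (L::nat) \<and> R a"
  by auto

text \<open>The markers advance together until one of them is off the ones, that is, by the minimum
  of the two values. Both are then off the ones iff the values are equal. The blocks end inside the
  word, so as many rounds as the word has letters are enough.\<close>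

lemma same_val_singleton:
  assumes p: "p + val w p < length w" and q: "q + val w q < length w"
  shows "same_val w {p} {q} \<longleftrightarrow> val w p = val w q"
proof -
  let ?m = "min (val w p) (val w q)"
  have one: "w ! (r + k) = 1 \<longleftrightarrow> k < val w r" if "r + val w r < length w" "k \<le> val w r" for r k
  proof (cases "k < val w r")
    case True
    then show ?thesis using val_less[of r k w] that by simp
  next
    case False
    then have k: "k = val w r" using that by simp
    have "\<forall>i<k. w ! (r + i) = 1"
    proof (intro allI impI)
      fix i assume "i < k"
      then show "w ! (r + i) = 1" using val_less[of r i w] that k by simp
    qed
    moreover have "\<not> (\<forall>i\<le>k. w ! (r + i) = 1)" using val_less[of r k w] that k by simp
    ultimately show ?thesis using False by (metis le_neq_implies_less)
  qed
  have "(walk w ^^ n) ({p}, {q}) = ({p + min n ?m}, {q + min n ?m})" for n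
  proof (induction n)
    case (Suc n)
    have 1: "w ! (p + min n ?m) = 1 \<longleftrightarrow> min n ?m < val w p" "w ! (q + min n ?m) = 1 \<longleftrightarrow> min n ?m < val w q"
      using one[OF p, of "min n ?m"] one[OF q, of "min n ?m"] by auto
    show ?case
    proof (cases "n < ?m")
      case True
      then have "p + Suc n < length w" "q + Suc n < length w" using p q by auto
      then have "walk w ({p + n}, {q + n}) = ({p + Suc n}, {q + Suc n})"
        using 1 True by (simp only: walk_def prod.case shifted_singleton ex_singleton) simp
      then show ?thesis using Suc True by simp
    next
      case False
      then have m: "min n ?m = ?m" "min (Suc n) ?m = ?m" by (simp_all add: min_def)
      then have "\<not> (w ! (p + ?m) = 1 \<and> w ! (q + ?m) = 1)" using 1 by auto
      then have "walk w ({p + ?m}, {q + ?m}) = ({p + ?m}, {q + ?m})"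
        unfolding walk_def prod.case ex_singleton by (intro if_not_P) blast
      then show ?thesis using Suc unfolding m by simp
    qed
  qed simp
  moreover have "min (length w) ?m = ?m" using p by simp
  ultimately have "(walk w ^^ length w) ({p}, {q}) = ({p + ?m}, {q + ?m})" by metis
  moreover have "w ! (p + ?m) = 1 \<longleftrightarrow> ?m < val w p" "w ! (q + ?m) = 1 \<longleftrightarrow> ?m < val w q"
    using one[OF p, of ?m] one[OF q, of ?m] by auto
  moreover have "{p} \<inter> {..<length w} = {p}" "{q} \<inter> {..<length w} = {q}"
    using p q by auto
  moreover have "p + ?m < length w" "q + ?m < length w" using p q by auto
  ultimately have "same_val w {p} {q} \<longleftrightarrow> \<not> ?m < val w p \<and> \<not> ?m < val w q"
    unfolding same_val_def by (simp only: prod.case ex_singleton) blast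
  also have "\<dots> \<longleftrightarrow> val w p = val w q" by linarith
  finally show ?thesis .
qed

text \<open>Walking destroys the markers, so they are copied to tracks \<open>d\<close> and
  \<open>d + 1\<close>, with \<open>d + 2\<close> as loop counter. Copying transfers only positions
  inside the word, whence the intersections in \<open>same_val\<close>.\<close>

lemma testable_same_val:
  assumes "x < d" and "y < d" and K: "Suc (Suc d) < K"
  shows "testable K d (\<lambda>w \<sigma>. same_val w (\<sigma> x) (\<sigma> y))"
proof -
  define one :: "nat \<Rightarrow> prog" where "one k = test K (\<lambda>c. k \<in> snd c \<and> fst c = 1)" for k
  define copy :: "nat \<Rightarrow> nat \<Rightarrow> prog" where "copy k l = local_set K k (\<lambda>c. l \<in> snd c)" for k l
  define body where
    "body = ifc (one d) (ifc (one (Suc d)) (ifc (shift K d) (skip K) (shift K (Suc d))) (skip K)) (skip K)"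
  define result where "result = notp (ifc (one d) (notp (skip K)) (one (Suc d)))"
  define F where "F = ifc (copy d x) (skip K) (ifc (copy (Suc d) y) (skip K)
    (ifc (forc (d + 2) body) (skip K) result))"
  let ?one = "\<lambda>w U. \<exists>p<length w. p \<in> U \<and> w ! p = 1"
  have one_eq: "one k w \<sigma> = (?one w (\<sigma> k), \<sigma>)" if "k < K" for k w \<sigma>
    using that by (simp add: one_def test_def cell_def)
  have copy_eq: "copy k l w \<sigma> = (False, \<sigma>(k := \<sigma> l \<inter> {..<length w}))" if "l < K" for k l w \<sigma>
  proof -
    have "{p. p < length w \<and> p \<in> \<sigma> l} = \<sigma> l \<inter> {..<length w}" by auto
    then show ?thesis using that by (simp add: copy_def local_set_eq cell_def)
  qed
  have body: "fst (body w \<sigma>) = False" "(snd (body w \<sigma>) d, snd (body w \<sigma>) (Suc d)) = walk w (\<sigma> d, \<sigma> (Suc d))"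
    "k \<noteq> d \<Longrightarrow> k \<noteq> Suc d \<Longrightarrow> snd (body w \<sigma>) k = \<sigma> k" for w \<sigma> k
    using K by (auto simp: body_def ifc_def one_eq shift_eq walk_def shifted_def)
  have fold: "let \<tau> = fold (\<lambda>p \<sigma>. snd (body w (\<sigma>(d + 2 := {p})))) ps \<sigma> in
      (\<tau> d, \<tau> (Suc d)) = (walk w ^^ length ps) (\<sigma> d, \<sigma> (Suc d)) \<and> agree d \<tau> \<sigma>" for w ps \<sigma>
  proof (induction ps arbitrary: \<sigma>)
    case (Cons p ps)
    let ?s = "snd (body w (\<sigma>(d + 2 := {p})))"
    have "(?s d, ?s (Suc d)) = walk w (\<sigma> d, \<sigma> (Suc d))" "agree d ?s \<sigma>"
      using body(2)[of w "\<sigma>(d + 2 := {p})"] body(3)[of _ w "\<sigma>(d + 2 := {p})"] by (auto simp: agree_def)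
    then show ?case using Cons[of ?s] agree_trans[of d _ ?s \<sigma>]
      by (simp add: Let_def funpow_swap1 del: fun_upd_apply)
  qed simp
  have result: "result w \<sigma> = (\<not> ?one w (\<sigma> d) \<and> \<not> ?one w (\<sigma> (Suc d)), \<sigma>)" for w \<sigma>
    using K by (auto simp: result_def notp_def ifc_def one_eq)
  have "fst (F w \<sigma>) = same_val w (\<sigma> x) (\<sigma> y) \<and> agree d (snd (F w \<sigma>)) \<sigma>" for w \<sigma>
  proof -
    let ?s = "\<sigma>(d := \<sigma> x \<inter> {..<length w}, Suc d := \<sigma> y \<inter> {..<length w})"
    let ?t = "fold (\<lambda>p \<sigma>. snd (body w (\<sigma>(d + 2 := {p})))) [0..<length w] ?s"
    have "F w \<sigma> = result w (?t(d + 2 := {}))"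
      using assms K by (simp add: F_def ifc_def copy_eq forc_fold[of body w, OF body(1)])
    then have F: "F w \<sigma> = (\<not> ?one w (?t d) \<and> \<not> ?one w (?t (Suc d)), ?t(d + 2 := {}))"
      by (simp add: result)
    have "(?t d, ?t (Suc d)) = (walk w ^^ length w) (\<sigma> x \<inter> {..<length w}, \<sigma> y \<inter> {..<length w})"
      and "agree d ?t ?s" using fold[of w "[0..<length w]" ?s] by (simp_all add: Let_def)
    then show ?thesis unfolding F same_val_def
      by (auto split: prod.splits simp del: fun_upd_apply)
  qed
  moreover have "realizable K F"
    unfolding F_def copy_def body_def one_def result_def using K assms body(3)[of "d + 2"]
    by (intro realizable_intros) (auto simp: body_def one_def)
  moreover have "same_val w (\<sigma> x) (\<sigma> y) = same_val w (\<tau> x) (\<tau> y)" if "agree d \<sigma> \<tau>" for w \<sigma> \<tau>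
    using that assms by (simp add: agree_def)
  ultimately show ?thesis unfolding testable_def by blast
qed

subsection \<open>Least fixed points\<close>

text \<open>Elements are inserted in place as soon as they are found, so the old set need not be
  stored on a track of its own while the new one is built.\<close>

definition pass :: "nat \<Rightarrow> (nat set \<Rightarrow> nat set) \<Rightarrow> nat set \<Rightarrow> nat set" where
  "pass L \<Phi> = fold (\<lambda>p X. if p \<in> \<Phi> X then insert p X else X) [0..<L]"

text \<open>By monotonicity an in-place pass adds at least what one application of
  \<open>\<Phi>\<close> would add and never leaves the least fixed point. A pass that does not reach
  closure adds an element, and there are only \<open>L\<close> candidates.\<close>

lemma pass_iterates_to_lfp:
  assumes mono: "mono \<Phi>" and bound: "\<And>X. \<Phi> X \<subseteq> {..<L}"
  shows "(pass L \<Phi> ^^ L) {} = lfp \<Phi>"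
proof -
  let ?f = "\<lambda>p X. if p \<in> \<Phi> X then insert p X else X"
  have incr: "X \<subseteq> fold ?f ps X" for ps X
  proof (induction ps arbitrary: X)
    case (Cons p ps)
    have "X \<subseteq> ?f p X" by auto
    also have "\<dots> \<subseteq> fold ?f ps (?f p X)" by (rule Cons)
    finally show ?case by simp
  qed simp
  have catch: "\<Phi> X \<inter> set ps \<subseteq> fold ?f ps Y" if "X \<subseteq> Y" for ps X Y
    using that
  proof (induction ps arbitrary: Y)
    case (Cons p ps)
    have "X \<subseteq> ?f p Y" using Cons.prems by auto
    moreover have "p \<in> \<Phi> X \<Longrightarrow> p \<in> ?f p Y" using monoD[OF mono Cons.prems] by auto
    ultimately show ?case using Cons.IH[of "?f p Y"] incr[of "?f p Y" ps] by auto
  qed simp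
  have below: "X \<subseteq> lfp \<Phi> \<Longrightarrow> fold ?f ps X \<subseteq> lfp \<Phi>" for ps X
  proof (induction ps arbitrary: X)
    case (Cons p ps)
    have "\<Phi> X \<subseteq> lfp \<Phi>" using monoD[OF mono Cons.prems] lfp_unfold[OF mono] by simp
    then have "?f p X \<subseteq> lfp \<Phi>" using Cons.prems by auto
    from Cons.IH[OF this] show ?case by simp
  qed simp
  let ?Y = "\<lambda>n. (pass L \<Phi> ^^ n) {}"
  have Y_below: "?Y n \<subseteq> lfp \<Phi>" for n
  proof (induction n)
    case (Suc n)
    then show ?case using below[of "?Y n" "[0..<L]"] by (simp add: pass_def)
  qed simp
  have lfp_bound: "lfp \<Phi> \<subseteq> {..<L}" using bound lfp_unfold[OF mono] by metis
  have Y_Suc: "?Y n \<subseteq> ?Y (Suc n)" "\<Phi> (?Y n) \<subseteq> ?Y (Suc n)" for n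
    using incr[of "?Y n" "[0..<L]"] catch[of "?Y n" "?Y n" "[0..<L]"] bound[of "?Y n"]
    by (simp_all add: pass_def atLeast0LessThan Int_absorb2)
  have fin: "finite (?Y n)" for n
    using finite_subset[OF subset_trans[OF Y_below lfp_bound] finite_lessThan] .
  \<comment> \<open>As long as the iteration is not closed, every pass increases the
    cardinality.\<close>
  have "\<Phi> (?Y n) \<subseteq> ?Y n \<or> n \<le> card (?Y n)" for n
  proof (induction n)
    case (Suc n)
    show ?case
    proof (cases "?Y (Suc n) = ?Y n")
      case True
      then show ?thesis using Y_Suc(2)[of n] by simp
    next
      case False
      then have lt: "card (?Y n) < card (?Y (Suc n))"
        using Y_Suc(1)[of n] psubset_card_mono[OF fin[of "Suc n"]] by (metis psubsetI)
      show ?thesis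
      proof (cases "\<Phi> (?Y n) \<subseteq> ?Y n")
        case True
        then have "lfp \<Phi> \<subseteq> ?Y n" by (rule lfp_lowerbound)
        then show ?thesis using Y_below[of "Suc n"] Y_Suc(1)[of n] False by blast
      next
        case False
        then show ?thesis using Suc lt by linarith
      qed
    qed
  qed simp
  then have "\<Phi> (?Y L) \<subseteq> ?Y L"
  proof (rule disjE)
    assume "L \<le> card (?Y L)"
    then have "?Y L = {..<L}"
      using subset_trans[OF Y_below lfp_bound, of L] card_mono[of "{..<L}" "?Y L"]
      by (intro card_subset_eq) auto
    then show ?thesis using bound by simp
  qed
  then have "lfp \<Phi> \<subseteq> ?Y L" by (rule lfp_lowerbound)
  then show ?thesis using Y_below by blast
qed

definition lfp_set :: "nat \<Rightarrow> (nat list \<Rightarrow> tracks \<Rightarrow> bool) \<Rightarrow> nat list \<Rightarrow> tracks \<Rightarrow> nat set" where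
  "lfp_set d P w \<sigma> = lfp (\<lambda>X. {p. p < length w \<and> P w (\<sigma>(d := X, d + 2 := {p}))})"

text \<open>Track \<open>d + 1\<close> counts the passes over the word, so \<open>P\<close> must not look at it.\<close>

lemma definable_lfp_set:
  assumes P: "testable K (d + 3) P" and K: "d + 2 < K"
    and indep: "\<And>w \<sigma> X. P w (\<sigma>(Suc d := X)) = P w \<sigma>"
    and mono: "\<And>w \<sigma> X Y. X \<subseteq> Y \<Longrightarrow> P w (\<sigma>(d := X)) \<Longrightarrow> P w (\<sigma>(d := Y))"
  shows "definable K d (lfp_set d P)"
proof -
  obtain G where G: "realizable K G" "\<And>w \<sigma>. fst (G w \<sigma>) = P w \<sigma>" "\<And>w \<sigma>. agree (d + 3) (snd (G w \<sigma>)) \<sigma>"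
    using P unfolding testable_def by blast
  \<comment> \<open>While track \<open>d + 2\<close> holds the single loop position
    \<open>p\<close>, the union of the tracks \<open>d\<close> and \<open>d + 2\<close> is the
    insertion of \<open>p\<close>.\<close>
  define add where "add = local_set K d (\<lambda>c. d \<in> snd c \<or> d + 2 \<in> snd c)"
  define body where "body = ifc G add (skip K)"
  define sweep where "sweep = forc (d + 2) body"
  define F where "F = ifc (local_set K d (\<lambda>_. False)) (skip K) (forc (Suc d) sweep)"
  define \<Phi> where "\<Phi> w \<sigma> X = {p. p < length w \<and> P w (\<sigma>(d := X, d + 2 := {p}))}" for w \<sigma> X
  have lfp_set_eq: "lfp_set d P w \<sigma> = lfp (\<Phi> w \<sigma>)" for w \<sigma>
    by (simp only: lfp_set_def \<Phi>_def[abs_def])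
  have P_cong: "P w \<sigma> = P w \<tau>" if "agree d \<sigma> \<tau>" "\<sigma> d = \<tau> d" "\<sigma> (d + 2) = \<tau> (d + 2)" for w \<sigma> \<tau>
  proof -
    \<comment> \<open>Clearing the counter track on both sides makes the tracks agree below
      \<open>d + 3\<close>, and \<open>indep\<close> says that clearing is invisible to
      \<open>P\<close>.\<close>
    have "P w (\<sigma>(Suc d := {})) = P w (\<tau>(Suc d := {}))"
      using that by (intro testable_cong[OF P]) (auto simp: agree_def less_Suc_eq numeral_3_eq_3)
    then show ?thesis by (simp only: indep)
  qed
  have \<Phi>_cong: "\<Phi> w \<sigma> = \<Phi> w \<tau>" if "agree d \<sigma> \<tau>" for w \<sigma> \<tau>
  proof -
    have "P w (\<sigma>(d := X, d + 2 := {p})) = P w (\<tau>(d := X, d + 2 := {p}))" for X p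
      using that by (intro P_cong) auto
    then show ?thesis by (auto simp: \<Phi>_def fun_eq_iff)
  qed
  have mono_\<Phi>: "mono (\<Phi> w \<sigma>)" for w \<sigma>
  proof
    fix X Y :: "nat set" assume "X \<subseteq> Y"
    then have "P w (\<sigma>(d := X, d + 2 := {p})) \<Longrightarrow> P w (\<sigma>(d := Y, d + 2 := {p}))" for p
      using mono[of X Y w "\<sigma>(d + 2 := {p})"] by (simp add: fun_upd_twist)
    then show "\<Phi> w \<sigma> X \<subseteq> \<Phi> w \<sigma> Y" by (auto simp: \<Phi>_def)
  qed
  have body_False: "fst (body w \<sigma>) = False" for w \<sigma>
    by (simp add: body_def ifc_def add_def local_set_eq)
  have body_agree: "agree d (snd (body w \<sigma>)) \<sigma>" "snd (body w \<sigma>) (Suc d) = \<sigma> (Suc d)"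
    "snd (body w \<sigma>) (d + 2) = \<sigma> (d + 2)" for w \<sigma>
    using G(3)[of w \<sigma>] by (auto simp: body_def ifc_def add_def local_set_eq agree_def)
  have body_d: "snd (body w (\<sigma>(d + 2 := {p}))) d = (if p \<in> \<Phi> w \<sigma> (\<sigma> d) then insert p (\<sigma> d) else \<sigma> d)"
    if "\<sigma> d \<subseteq> {..<length w}" "p < length w" for w \<sigma> p
    using G(2)[of w "\<sigma>(d + 2 := {p})"] G(3)[of w "\<sigma>(d + 2 := {p})"] that K
    by (auto simp: body_def ifc_def add_def local_set_eq agree_def \<Phi>_def cell_def)
  have body_fold: "let \<tau> = fold (\<lambda>p \<sigma>. snd (body w (\<sigma>(d + 2 := {p})))) ps \<sigma> in
      \<tau> d = fold (\<lambda>p X. if p \<in> \<Phi> w \<sigma> X then insert p X else X) ps (\<sigma> d) \<and>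
      \<tau> d \<subseteq> {..<length w} \<and> agree d \<tau> \<sigma> \<and> \<tau> (Suc d) = \<sigma> (Suc d)"
    if "set ps \<subseteq> {..<length w}" "\<sigma> d \<subseteq> {..<length w}" for w ps \<sigma>
    using that
  proof (induction ps arbitrary: \<sigma>)
    case (Cons p ps)
    let ?s = "snd (body w (\<sigma>(d + 2 := {p})))"
    have s: "?s d = (if p \<in> \<Phi> w \<sigma> (\<sigma> d) then insert p (\<sigma> d) else \<sigma> d)"
      "agree d ?s \<sigma>" "?s (Suc d) = \<sigma> (Suc d)"
      using body_d[of \<sigma> w p] Cons.prems body_agree[of w "\<sigma>(d + 2 := {p})"] by auto
    then have "?s d \<subseteq> {..<length w}" "\<Phi> w ?s = \<Phi> w \<sigma>" using Cons.prems \<Phi>_cong by auto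
    then show ?case using Cons.IH[of ?s] Cons.prems(1) s agree_trans[OF _ s(2)]
      by (cases "p \<in> \<Phi> w \<sigma> (\<sigma> d)") (auto simp: Let_def simp del: fun_upd_apply)
  qed simp
  have sweep_eq: "sweep w \<sigma> = (False, (fold (\<lambda>p \<sigma>. snd (body w (\<sigma>(d + 2 := {p})))) [0..<length w] \<sigma>)(d + 2 := {}))"
    for w \<sigma> unfolding sweep_def by (rule forc_fold) (rule body_False)
  have sweep: "snd (sweep w \<sigma>) d = pass (length w) (\<Phi> w \<sigma>) (\<sigma> d) \<and>
      snd (sweep w \<sigma>) d \<subseteq> {..<length w} \<and> agree d (snd (sweep w \<sigma>)) \<sigma>"
    if "\<sigma> d \<subseteq> {..<length w}" for w \<sigma>
    using body_fold[of "[0..<length w]" w \<sigma>] that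
    by (simp add: sweep_eq pass_def Let_def atLeast0LessThan del: fun_upd_apply) auto
  have sweep_Suc: "snd (sweep w \<sigma>) (Suc d) = \<sigma> (Suc d)" for w \<sigma>
  proof -
    have "fold (\<lambda>p \<sigma>. snd (body w (\<sigma>(d + 2 := {p})))) ps \<sigma> (Suc d) = \<sigma> (Suc d)" for ps
      by (induction ps arbitrary: \<sigma>) (simp_all add: body_agree)
    then show ?thesis by (simp add: sweep_eq)
  qed
  have sweep_fold: "let \<tau> = fold (\<lambda>p \<sigma>. snd (sweep w (\<sigma>(Suc d := {p})))) ps \<sigma> in
      \<tau> d = (pass (length w) (\<Phi> w \<sigma>) ^^ length ps) (\<sigma> d) \<and> agree d \<tau> \<sigma>"
    if "\<sigma> d \<subseteq> {..<length w}" for w ps \<sigma>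
    using that
  proof (induction ps arbitrary: \<sigma>)
    case (Cons p ps)
    let ?s = "snd (sweep w (\<sigma>(Suc d := {p})))"
    have "\<Phi> w (\<sigma>(Suc d := {p})) = \<Phi> w \<sigma>" by (rule \<Phi>_cong) simp
    then have s: "?s d = pass (length w) (\<Phi> w \<sigma>) (\<sigma> d)" "?s d \<subseteq> {..<length w}" "agree d ?s \<sigma>"
      using sweep[of "\<sigma>(Suc d := {p})" w] Cons.prems by auto
    then show ?case using Cons.IH[of ?s] \<Phi>_cong[OF s(3)] agree_trans[OF _ s(3)]
      by (simp add: Let_def funpow_swap1 del: fun_upd_apply)
  qed simp
  have "snd (F w \<sigma>) d = lfp_set d P w \<sigma> \<and> agree d (snd (F w \<sigma>)) \<sigma>" for w \<sigma>
  proof -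
    let ?t = "fold (\<lambda>p \<sigma>. snd (sweep w (\<sigma>(Suc d := {p})))) [0..<length w] (\<sigma>(d := {}))"
    have "F w \<sigma> = (False, ?t(Suc d := {}))"
      by (simp add: F_def ifc_def local_set_eq forc_fold sweep_eq)
    moreover have "\<Phi> w (\<sigma>(d := {})) = \<Phi> w \<sigma>" by (rule \<Phi>_cong) simp
    then have "?t d = (pass (length w) (\<Phi> w \<sigma>) ^^ length w) {}" "agree d ?t \<sigma>"
      using sweep_fold[of "\<sigma>(d := {})" w "[0..<length w]"] by (simp_all add: Let_def)
    moreover have "(pass (length w) (\<Phi> w \<sigma>) ^^ length w) {} = lfp (\<Phi> w \<sigma>)"
      by (rule pass_iterates_to_lfp[OF mono_\<Phi>]) (auto simp: \<Phi>_def)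
    ultimately show ?thesis by (simp add: lfp_set_eq)
  qed
  moreover have "realizable K F"
    unfolding F_def
  proof (intro realizable_intros)
    show "realizable K sweep" unfolding sweep_def
      using K G(1) body_agree(3) by (intro realizable_forc) (auto simp: body_def add_def intro!: realizable_intros)
  qed (use K sweep_Suc in auto)
  moreover have "lfp_set d P w \<sigma> = lfp_set d P w \<tau>" if "agree d \<sigma> \<tau>" for w \<sigma> \<tau>
    using \<Phi>_cong[OF that, of w] by (simp add: lfp_set_eq)
  ultimately show ?thesis unfolding definable_def by blast
qed

subsection \<open>Fair liveness as a fixed-point formula\<close>

type_synonym form = "nat list \<Rightarrow> tracks \<Rightarrow> bool"

definition meetf :: "nat \<Rightarrow> nat \<Rightarrow> form" where
  "meetf x y w \<sigma> \<longleftrightarrow> (\<exists>p<length w. p \<in> \<sigma> x \<and> p \<in> \<sigma> y)"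

definition onef :: "nat \<Rightarrow> form" where
  "onef x w \<sigma> \<longleftrightarrow> (\<exists>p<length w. p \<in> \<sigma> x \<and> w ! p = 1)"

definition samef :: "nat \<Rightarrow> nat \<Rightarrow> form" where
  "samef x y w \<sigma> \<longleftrightarrow> same_val w (\<sigma> x) (\<sigma> y)"

definition notf :: "form \<Rightarrow> form" where
  "notf P w \<sigma> \<longleftrightarrow> \<not> P w \<sigma>"

definition andf :: "form \<Rightarrow> form \<Rightarrow> form" (infixr "\<and>\<^sub>f" 53) where
  "(P \<and>\<^sub>f R) w \<sigma> \<longleftrightarrow> P w \<sigma> \<and> R w \<sigma>"

definition orf :: "form \<Rightarrow> form \<Rightarrow> form" (infixr "\<or>\<^sub>f" 52) where
  "(P \<or>\<^sub>f R) w \<sigma> \<longleftrightarrow> P w \<sigma> \<or> R w \<sigma>"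

definition exf :: "nat \<Rightarrow> form \<Rightarrow> form" where
  "exf x P w \<sigma> \<longleftrightarrow> (\<exists>p<length w. P w (\<sigma>(x := {p})))"

definition letf :: "nat \<Rightarrow> (nat list \<Rightarrow> tracks \<Rightarrow> nat set) \<Rightarrow> form \<Rightarrow> form" where
  "letf x S P w \<sigma> \<longleftrightarrow> P w (\<sigma>(x := S w \<sigma>))"

definition next_in :: "nat list \<Rightarrow> nat set \<Rightarrow> nat set" where
  "next_in w X = {p. p < length w \<and> (\<exists>q\<in>X. next_block w q = p)}"

definition next_set :: "nat \<Rightarrow> nat list \<Rightarrow> tracks \<Rightarrow> nat set" where
  "next_set x w \<sigma> = next_in w (\<sigma> x)"

lemmas form_defs = meetf_def onef_def samef_def notf_def andf_def orf_def exf_def letf_def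

lemma testable_meetf: "x < d \<Longrightarrow> y < d \<Longrightarrow> d \<le> K \<Longrightarrow> testable K d (meetf x y)"
  unfolding meetf_def[abs_def] by (rule testable_meet)

lemma testable_onef: "x < d \<Longrightarrow> d \<le> K \<Longrightarrow> testable K d (onef x)"
  unfolding onef_def[abs_def] by (rule testable_one)

lemma testable_samef: "x < d \<Longrightarrow> y < d \<Longrightarrow> Suc (Suc d) < K \<Longrightarrow> testable K d (samef x y)"
  unfolding samef_def[abs_def] by (rule testable_same_val)

lemma testable_notf: "testable K d P \<Longrightarrow> testable K d (notf P)"
  unfolding notf_def[abs_def] by (rule testable_not)

lemma testable_andf: "testable K d P \<Longrightarrow> testable K d R \<Longrightarrow> testable K d (P \<and>\<^sub>f R)"
  unfolding andf_def[abs_def] by (rule testable_conj)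

lemma testable_orf: "testable K d P \<Longrightarrow> testable K d R \<Longrightarrow> testable K d (P \<or>\<^sub>f R)"
  unfolding orf_def[abs_def] by (rule testable_disj)

text \<open>The premise \<open>x = d\<close> lets the rule match a numeral \<open>x\<close> against
  a depth in \<open>Suc\<close> form; the simplifier settles it afterwards.\<close>

lemma testable_exf: "x = d \<Longrightarrow> d < K \<Longrightarrow> testable K (Suc d) P \<Longrightarrow> testable K d (exf x P)"
  unfolding exf_def[abs_def] by (simp add: testable_ex)

lemma testable_letf: "x = d \<Longrightarrow> definable K d S \<Longrightarrow> testable K (Suc d) P \<Longrightarrow> testable K d (letf x S P)"
  unfolding letf_def[abs_def] by (simp add: testable_let)

lemma definable_next_set: "x < d \<Longrightarrow> d < K \<Longrightarrow> definable K d (next_set x)"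
  unfolding next_set_def[abs_def] next_in_def by (rule definable_next_block)

lemmas testable_intros =
  testable_meetf testable_onef testable_samef testable_notf testable_andf testable_orf testable_exf
  testable_letf definable_next_set

text \<open>Tracks \<open>x\<close> and \<open>y\<close> hold the starts of two transitions, the tracks from \<open>d\<close> on are free.
  A transition is encoded by the consecutive blocks source, operation, message, target.\<close>

definition followf :: "nat \<Rightarrow> nat \<Rightarrow> nat \<Rightarrow> form" where
  "followf d x y = letf d (next_set x) (letf (d + 1) (next_set d) (letf (d + 2) (next_set (d + 1))
     (samef (d + 2) y)))"

definition msgf :: "nat \<Rightarrow> nat \<Rightarrow> nat \<Rightarrow> form" where
  "msgf d x y = letf d (next_set x) (letf (d + 1) (next_set d)
     (letf (d + 2) (next_set y) (letf (d + 3) (next_set (d + 2)) (samef (d + 1) (d + 3)))))"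

text \<open>The operation block of a send encodes 0, so it begins directly with its terminator and
  not with a one.\<close>

definition sendf :: "nat \<Rightarrow> nat \<Rightarrow> form" where
  "sendf d x = letf d (next_set x) (notf (onef d))"

lemma testable_followf:
  "e = d \<Longrightarrow> x < d \<Longrightarrow> y < d \<Longrightarrow> d + 5 < K \<Longrightarrow> testable K d (followf e x y)"
  unfolding followf_def by (intro testable_intros) simp_all

lemma testable_msgf:
  "e = d \<Longrightarrow> x < d \<Longrightarrow> y < d \<Longrightarrow> d + 6 < K \<Longrightarrow> testable K d (msgf e x y)"
  unfolding msgf_def by (intro testable_intros) simp_all

lemma testable_sendf:
  "e = d \<Longrightarrow> x < d \<Longrightarrow> d < K \<Longrightarrow> testable K d (sendf e x)"
  unfolding sendf_def by (intro testable_intros) simp_all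

lemmas testable_all = testable_intros testable_followf testable_msgf testable_sendf

lemma followf_eq: "x < d \<Longrightarrow> y < d \<Longrightarrow>
    followf d x y w \<sigma> = same_val w (next_in w (next_in w (next_in w (\<sigma> x)))) (\<sigma> y)"
  by (simp add: followf_def form_defs next_set_def)

lemma msgf_eq: "x < d \<Longrightarrow> y < d \<Longrightarrow>
    msgf d x y w \<sigma> = same_val w (next_in w (next_in w (\<sigma> x))) (next_in w (next_in w (\<sigma> y)))"
  by (simp add: msgf_def form_defs next_set_def)

lemma sendf_eq: "sendf d x w \<sigma> \<longleftrightarrow> \<not> (\<exists>p<length w. p \<in> next_in w (\<sigma> x) \<and> w ! p = 1)"
  by (simp add: sendf_def form_defs next_set_def)

text \<open>Tracks 0, 1, 2 hold the starts of the initial states, of the transitions, and of the final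
  states. Track 3 receives the fireable transitions, and track 4 the transitions that can not be
  part of any self-supporting set.\<close>

definition enf :: form where
  "enf = meetf 1 5 \<and>\<^sub>f
     (exf 6 (meetf 0 6 \<and>\<^sub>f samef 6 5) \<or>\<^sub>f exf 6 (meetf 3 6 \<and>\<^sub>f meetf 1 6 \<and>\<^sub>f followf 7 6 5)) \<and>\<^sub>f
     (sendf 6 5 \<or>\<^sub>f exf 6 (meetf 3 6 \<and>\<^sub>f meetf 1 6 \<and>\<^sub>f sendf 7 6 \<and>\<^sub>f msgf 7 6 5))"

definition keptf :: "nat \<Rightarrow> form" where
  "keptf x = meetf 3 x \<and>\<^sub>f notf (meetf 4 x)"

text \<open>Reachability from the transition in track 6. The set grows in track 7, its candidate is
  in track 9, and track 8 in between counts the passes; fresh variables start at 10.\<close>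

definition forwardf :: form where
  "forwardf = meetf 6 9 \<or>\<^sub>f keptf 9 \<and>\<^sub>f exf 10 (meetf 7 10 \<and>\<^sub>f keptf 10 \<and>\<^sub>f followf 11 10 9)"

definition visitf :: form where
  "visitf = (meetf 7 10 \<and>\<^sub>f meetf 3 10 \<and>\<^sub>f exf 11 (meetf 2 11 \<and>\<^sub>f samef 11 10)) \<or>\<^sub>f
     keptf 10 \<and>\<^sub>f exf 11 (meetf 8 11 \<and>\<^sub>f keptf 11 \<and>\<^sub>f followf 12 11 10)"

text \<open>The negation of \<open>good\<close> for the candidate set of fireable transitions
  outside track 4: a sender for the message, then the transitions on walks from track 6, then those
  reached after a final state, one of which must lead back.\<close>

definition badf :: form where
  "badf = notf (meetf 3 6 \<and>\<^sub>f exf 7 (keptf 7 \<and>\<^sub>f sendf 8 7 \<and>\<^sub>f msgf 8 7 6) \<and>\<^sub>f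
     letf 7 (lfp_set 7 forwardf) (letf 8 (lfp_set 8 visitf)
       (exf 9 (meetf 8 9 \<and>\<^sub>f meetf 3 9 \<and>\<^sub>f followf 10 9 6))))"

definition fairf :: form where
  "fairf = letf 3 (lfp_set 3 enf) (letf 4 (lfp_set 4 badf) (exf 5 (keptf 5)))"

lemma testable_enf: "testable 18 6 enf"
  unfolding enf_def by (intro testable_all) simp_all

lemma testable_keptf: "3 < d \<Longrightarrow> 4 < d \<Longrightarrow> x < d \<Longrightarrow> d \<le> K \<Longrightarrow> testable K d (keptf x)"
  unfolding keptf_def by (intro testable_all) simp_all

lemma testable_forwardf: "testable 18 10 forwardf"
  unfolding forwardf_def by (intro testable_all testable_keptf) simp_all

text \<open>This formula fixes the number 18 of tracks. Its \<open>followf 12\<close> needs tracks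
  12 to 14 for three successive blocks and tracks 15 to 17 for comparing values.\<close>

lemma testable_visitf: "testable 18 11 visitf"
  unfolding visitf_def by (intro testable_all testable_keptf) simp_all

lemma definable_forwardf: "definable 18 7 (lfp_set 7 forwardf)"
proof (rule definable_lfp_set)
  show "testable 18 (7 + 3) forwardf" using testable_forwardf by simp
  show "forwardf w (\<sigma>(Suc 7 := X)) = forwardf w \<sigma>" for w \<sigma> X
    by (simp add: forwardf_def keptf_def form_defs followf_eq)
  show "forwardf w (\<sigma>(7 := Y))" if "X \<subseteq> Y" "forwardf w (\<sigma>(7 := X))" for w \<sigma> X Y
    using that by (auto simp: forwardf_def keptf_def form_defs followf_eq)
qed simp

lemma definable_visitf: "definable 18 8 (lfp_set 8 visitf)"
proof (rule definable_lfp_set)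
  show "testable 18 (8 + 3) visitf" using testable_visitf by simp
  show "visitf w (\<sigma>(Suc 8 := X)) = visitf w \<sigma>" for w \<sigma> X
    by (simp add: visitf_def keptf_def form_defs followf_eq)
  show "visitf w (\<sigma>(8 := Y))" if "X \<subseteq> Y" "visitf w (\<sigma>(8 := X))" for w \<sigma> X Y
    using that by (auto simp: visitf_def keptf_def form_defs followf_eq)
qed simp

lemma definable_enf: "definable 18 3 (lfp_set 3 enf)"
proof (rule definable_lfp_set)
  show "testable 18 (3 + 3) enf" using testable_enf by simp
  show "enf w (\<sigma>(Suc 3 := X)) = enf w \<sigma>" for w \<sigma> X
    by (simp add: enf_def form_defs followf_eq msgf_eq sendf_eq)
  show "enf w (\<sigma>(3 := Y))" if "X \<subseteq> Y" "enf w (\<sigma>(3 := X))" for w \<sigma> X Y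
    using that unfolding enf_def form_defs by (auto simp: followf_eq msgf_eq sendf_eq)
qed simp

lemma testable_badf: "testable 18 7 badf"
proof -
  have "definable 18 (Suc 7) (lfp_set 8 visitf)" using definable_visitf by simp
  then show ?thesis
    unfolding badf_def using definable_forwardf by (intro testable_all testable_keptf) simp_all
qed

lemma lfp_set_mono:
  assumes "\<And>X p. P w (\<sigma>(d := X, d + 2 := {p})) \<Longrightarrow> P w (\<tau>(d := X, d + 2 := {p}))"
  shows "lfp_set d P w \<sigma> \<subseteq> lfp_set d P w \<tau>"
  unfolding lfp_set_def using assms by (intro lfp_mono) auto

lemma lfp_set_cong:
  assumes "\<And>X p. P w (\<sigma>(d := X, d + 2 := {p})) = P w (\<tau>(d := X, d + 2 := {p}))"
  shows "lfp_set d P w \<sigma> = lfp_set d P w \<tau>"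
  using assms by (intro antisym lfp_set_mono) blast+

text \<open>Enlarging track 4 shrinks the kept transitions, hence the forward set, hence the visited
  set built on it; the outer negation makes the operator monotone. The visited sets must be compared
  for two different forward sets in track 7.\<close>

lemma definable_badf: "definable 18 4 (lfp_set 4 badf)"
proof (rule definable_lfp_set)
  show "testable 18 (4 + 3) badf" using testable_badf by simp
  show "badf w (\<sigma>(Suc 4 := X)) = badf w \<sigma>" for w \<sigma> X
  proof -
    have "lfp_set 7 forwardf w (\<sigma>(5 := X)) = lfp_set 7 forwardf w \<sigma>"
      by (rule lfp_set_cong) (simp add: forwardf_def keptf_def form_defs followf_eq)
    moreover have "lfp_set 8 visitf w (\<sigma>(5 := X, 7 := Y)) = lfp_set 8 visitf w (\<sigma>(7 := Y))" for Y
      by (rule lfp_set_cong) (simp add: visitf_def keptf_def form_defs followf_eq)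
    ultimately show ?thesis
      by (simp add: badf_def keptf_def form_defs followf_eq msgf_eq sendf_eq)
  qed
  show "badf w (\<sigma>(4 := Y))" if "X \<subseteq> Y" "badf w (\<sigma>(4 := X))" for w \<sigma> X Y
  proof -
    have 1: "lfp_set 7 forwardf w (\<sigma>(4 := Y)) \<subseteq> lfp_set 7 forwardf w (\<sigma>(4 := X))"
      using that(1) by (intro lfp_set_mono) (auto simp: forwardf_def keptf_def form_defs followf_eq)
    have 2: "lfp_set 8 visitf w (\<sigma>(4 := Y, 7 := V)) \<subseteq> lfp_set 8 visitf w (\<sigma>(4 := X, 7 := U))"
      if "V \<subseteq> U" for U V
      using that \<open>X \<subseteq> Y\<close> by (intro lfp_set_mono) (auto simp: visitf_def keptf_def form_defs followf_eq)
    show ?thesis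
      using that(1,2) 2[OF 1] unfolding badf_def keptf_def form_defs
      by (simp add: followf_eq msgf_eq sendf_eq) (meson subsetD)
  qed
qed simp

lemma testable_fairf: "testable 18 3 fairf"
proof -
  have "definable 18 (Suc 3) (lfp_set 4 badf)" using definable_badf by simp
  then show ?thesis
    unfolding fairf_def using definable_enf by (intro testable_all testable_keptf) simp_all
qed

text \<open>Needed because \<open>enf\<close> consults its set only at positions that start
  transitions: comparing blocks elsewhere would be meaningless. As all values of the operator lie in
  \<open>S\<close>, the restriction does not change the fixed point.\<close>

lemma lfp_restrict:
  assumes "mono f" and "\<And>X. f X \<subseteq> S"
  shows "lfp (\<lambda>X. f (X \<inter> S)) = lfp f"
proof (rule antisym)
  have "f (lfp f \<inter> S) \<subseteq> f (lfp f)" by (rule monoD[OF assms(1)]) simp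
  then show "lfp (\<lambda>X. f (X \<inter> S)) \<subseteq> lfp f"
    using lfp_unfold[OF assms(1)] by (intro lfp_lowerbound) simp
  have "mono (\<lambda>X. f (X \<inter> S))" by (rule monoI, rule monoD[OF assms(1)]) auto
  then have *: "lfp (\<lambda>X. f (X \<inter> S)) = f (lfp (\<lambda>X. f (X \<inter> S)) \<inter> S)" by (rule lfp_unfold)
  then have "lfp (\<lambda>X. f (X \<inter> S)) \<subseteq> S" using assms(2) by metis
  then have "f (lfp (\<lambda>X. f (X \<inter> S))) \<subseteq> lfp (\<lambda>X. f (X \<inter> S))" using * by (simp add: Int_absorb2)
  then show "lfp f \<subseteq> lfp (\<lambda>X. f (X \<inter> S))" by (rule lfp_lowerbound)
qed

section \<open>Meaning of the formulas on a word with marked entries\<close>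

definition block_at :: "nat list \<Rightarrow> nat \<Rightarrow> bool" where
  "block_at w p \<longleftrightarrow> p + val w p < length w"

text \<open>\<open>block_at\<close> says that the block ends inside the word, which is what
  \<open>same_val_singleton\<close> asks for; a transition needs it for all four of its blocks. A
  transition listed twice yields two indices with the same triple.\<close>

locale parsed_word =
  fixes w :: "nat list" and Is Ts Fs :: "nat set"
  assumes Is: "p \<in> Is \<Longrightarrow> block_at w p" and Fs: "p \<in> Fs \<Longrightarrow> block_at w p"
    and Ts: "p \<in> Ts \<Longrightarrow> block_at w p \<and> block_at w (next_block w p) \<and>
      block_at w (next_block w (next_block w p)) \<and>
      block_at w (next_block w (next_block w (next_block w p)))"
begin

abbreviation nb :: "nat \<Rightarrow> nat" where
  "nb \<equiv> next_block w"

definition op_at :: "nat \<Rightarrow> nat bop" where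
  "op_at p = (if val w (nb p) = 0 then Snd else Rcv) (val w (nb (nb p)))"

definition tgt_at :: "nat \<Rightarrow> nat" where
  "tgt_at p = val w (nb (nb (nb p)))"

lemma block_at_less: "block_at w p \<Longrightarrow> p < length w"
  by (simp add: block_at_def)

lemmas less_length = Is[THEN block_at_less] Fs[THEN block_at_less] Ts[THEN conjunct1, THEN block_at_less]

sublocale client Ts "val w" op_at tgt_at "val w ` Is" "val w ` Fs"
  by unfold_locales (rule finite_subset[of _ "{..<length w}"], auto intro: less_length)

lemma next_in_singleton: "block_at w (nb p) \<Longrightarrow> next_in w {p} = {nb p}"
  by (auto simp: next_in_def block_at_def)

lemma same: "block_at w p \<Longrightarrow> block_at w q \<Longrightarrow> same_val w {p} {q} \<longleftrightarrow> val w p = val w q"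
  by (simp add: same_val_singleton block_at_def)

lemma follow:
  assumes "p \<in> Ts" and "q \<in> Ts"
  shows "same_val w (next_in w (next_in w (next_in w {p}))) {q} \<longleftrightarrow> tgt_at p = val w q"
  using Ts[OF assms(1)] Ts[OF assms(2)] by (simp add: next_in_singleton same tgt_at_def)

lemma msg:
  assumes "p \<in> Ts" and "q \<in> Ts"
  shows "same_val w (next_in w (next_in w {p})) (next_in w (next_in w {q})) \<longleftrightarrow>
    bop_msg (op_at p) = bop_msg (op_at q)"
  using Ts[OF assms(1)] Ts[OF assms(2)] by (simp add: next_in_singleton same op_at_def)

lemma send:
  assumes "p \<in> Ts"
  shows "(\<forall>r<length w. r \<in> next_in w {p} \<longrightarrow> w ! r \<noteq> 1) \<longleftrightarrow> sends p (bop_msg (op_at p))"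
proof -
  have b: "block_at w (nb p)" using Ts[OF assms] by simp
  then have "w ! nb p = 1 \<longleftrightarrow> 0 < val w (nb p)"
    using val_less[of "nb p" 0 w] by (simp add: block_at_def)
  then show ?thesis
    using block_at_less[OF b] by (auto simp: next_in_singleton[OF b] sends_def op_at_def)
qed

text \<open>Splits the sending of a given message into the two tests that formulas provide,
  \<open>sendf\<close> for the operation and \<open>msgf\<close> for equality of messages.\<close>

lemma sends_other: "sends z (bop_msg (op_at p)) \<longleftrightarrow> sends z (bop_msg (op_at z)) \<and> bop_msg (op_at z) = bop_msg (op_at p)"
  by (auto simp: sends_def)

lemma En_Ts: "p \<in> En \<Longrightarrow> p \<in> Ts"
  using En_subset by blast

lemma ex_less:
  "(\<exists>p<length w. p \<in> Is \<and> R p) \<longleftrightarrow> (\<exists>p\<in>Is. R p)"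
  "(\<exists>p<length w. p \<in> Fs \<and> R p) \<longleftrightarrow> (\<exists>p\<in>Fs. R p)"
  "(\<exists>p<length w. p \<in> Y \<and> p \<in> Ts \<and> R p) \<longleftrightarrow> (\<exists>p\<in>Y. p \<in> Ts \<and> R p)"
  "(\<exists>p<length w. p \<in> Y \<and> p \<in> En \<and> R p) \<longleftrightarrow> (\<exists>p\<in>Y. p \<in> En \<and> R p)"
  using less_length En_Ts by blast+

context
  fixes \<sigma> :: tracks
  assumes \<sigma>: "\<sigma> 0 = Is" "\<sigma> 1 = Ts" "\<sigma> 2 = Fs"
begin

lemma enf_iff:
  assumes "p < length w"
  shows "enf w (\<sigma>(3 := X, 5 := {p})) \<longleftrightarrow> p \<in> enabling (X \<inter> Ts)"
proof (cases "p \<in> Ts")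
  case True
  have "enf w (\<sigma>(3 := X, 5 := {p})) \<longleftrightarrow>
    ((\<exists>q<length w. q \<in> Is \<and> same_val w {q} {p}) \<or>
      (\<exists>q<length w. q \<in> X \<and> q \<in> Ts \<and> same_val w (next_in w (next_in w (next_in w {q}))) {p})) \<and>
    ((\<forall>r<length w. r \<in> next_in w {p} \<longrightarrow> w ! r \<noteq> 1) \<or>
      (\<exists>q<length w. q \<in> X \<and> q \<in> Ts \<and> (\<forall>r<length w. r \<in> next_in w {q} \<longrightarrow> w ! r \<noteq> 1) \<and>
        same_val w (next_in w (next_in w {q})) (next_in w (next_in w {p}))))"
    using assms True \<sigma> unfolding enf_def form_defs
    by (auto simp: followf_eq msgf_eq sendf_eq)
  also have "\<dots> \<longleftrightarrow> ((\<exists>q<length w. q \<in> Is \<and> val w q = val w p) \<or>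
      (\<exists>q<length w. q \<in> X \<and> q \<in> Ts \<and> tgt_at q = val w p)) \<and>
    (sends p (bop_msg (op_at p)) \<or>
      (\<exists>q<length w. q \<in> X \<and> q \<in> Ts \<and> sends q (bop_msg (op_at q)) \<and> bop_msg (op_at q) = bop_msg (op_at p)))"
    using True Ts[OF True] Is by (simp add: same follow msg send[unfolded One_nat_def] cong: conj_cong)
  also have "\<dots> \<longleftrightarrow> p \<in> enabling (X \<inter> Ts)"
  proof -
    have "(\<exists>q\<in>Is. val w q = val w p) \<longleftrightarrow> val w p \<in> val w ` Is" by (metis imageE imageI)
    moreover have "(\<exists>q\<in>X. q \<in> Ts \<and> sends q (bop_msg (op_at q)) \<and> bop_msg (op_at q) = bop_msg (op_at p)) \<longleftrightarrow>
        (\<exists>q\<in>X \<inter> Ts. sends q (bop_msg (op_at p)))"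
      using sends_other[of _ p] by blast
    moreover have "(\<exists>q\<in>X. q \<in> Ts \<and> tgt_at q = val w p) \<longleftrightarrow> (\<exists>q\<in>X \<inter> Ts. tgt_at q = val w p)"
      by blast
    ultimately show ?thesis
      using True unfolding enabling_def ex_less mem_Collect_eq by simp
  qed
  finally show ?thesis .
next
  case False
  then show ?thesis using \<sigma> by (auto simp: enf_def form_defs enabling_def)
qed

lemma lfp_enf: "lfp_set 3 enf w \<sigma> = En"
proof -
  have "{p. p < length w \<and> enf w (\<sigma>(3 := X, 5 := {p}))} = enabling (X \<inter> Ts)" for X
    using enf_iff[of _ X] less_length by (auto simp: enabling_def)
  then have "lfp_set 3 enf w \<sigma> = lfp (\<lambda>X. enabling (X \<inter> Ts))" by (simp add: lfp_set_def)
  also have "\<dots> = En"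
    unfolding En_def by (rule lfp_restrict[OF mono_enabling]) (auto simp: enabling_def)
  finally show ?thesis .
qed

end

context
  fixes \<sigma> :: tracks
  assumes \<sigma>: "\<sigma> 0 = Is" "\<sigma> 1 = Ts" "\<sigma> 2 = Fs" "\<sigma> 3 = En"
begin

text \<open>The start \<open>t\<close> enters without the test \<open>keptf\<close>, matching the
  reflexive part of the closure; every further step requires both ends to be kept, as in
  \<open>succ_rel (En - Z)\<close>.\<close>

lemma lfp_forwardf:
  assumes t: "t \<in> En" "\<sigma> 4 = Z" "\<sigma> 6 = {t}"
  shows "lfp_set 7 forwardf w \<sigma> = {v. (t, v) \<in> (succ_rel (En - Z))\<^sup>*}"
proof -
  let ?r = "succ_rel (En - Z)"
  have tL: "t < length w" using t En_Ts less_length by blast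
  have iff: "forwardf w (\<sigma>(7 := Y, 9 := {v})) \<longleftrightarrow> v = t \<or> (\<exists>u\<in>Y. (u, v) \<in> ?r)"
    if v: "v < length w" for v Y
  proof -
    have "forwardf w (\<sigma>(7 := Y, 9 := {v})) \<longleftrightarrow>
      v = t \<or> (v \<in> En \<and> v \<notin> Z \<and> (\<exists>u<length w. u \<in> Y \<and> u \<in> En \<and> u \<notin> Z \<and>
        same_val w (next_in w (next_in w (next_in w {u}))) {v}))"
      using v \<sigma> t tL unfolding forwardf_def keptf_def form_defs by (auto simp: followf_eq)
    also have "\<dots> \<longleftrightarrow> v = t \<or> (v \<in> En \<and> v \<notin> Z \<and> (\<exists>u<length w. u \<in> Y \<and> u \<in> En \<and> u \<notin> Z \<and>
        tgt_at u = val w v))"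
      by (simp add: follow En_Ts cong: conj_cong)
    also have "\<dots> \<longleftrightarrow> v = t \<or> (\<exists>u\<in>Y. (u, v) \<in> ?r)"
      unfolding ex_less by (auto simp: succ_rel_def)
    finally show ?thesis .
  qed
  define f where "f Y = {v. v < length w \<and> forwardf w (\<sigma>(7 := Y, 9 := {v}))}" for Y
  have f: "f Y = insert t (?r `` Y)" for Y
    using iff[of _ Y] tL En_Ts less_length by (auto simp: f_def succ_rel_def)
  have "lfp f = {v. (t, v) \<in> ?r\<^sup>*}"
  proof (rule antisym)
    show "lfp f \<subseteq> {v. (t, v) \<in> ?r\<^sup>*}" by (rule lfp_lowerbound) (auto simp: f)
    have "mono f" by (rule monoI) (auto simp: f)
    then have unf: "lfp f = insert t (?r `` lfp f)" using lfp_unfold f by metis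
    have "v \<in> lfp f" if "(t, v) \<in> ?r\<^sup>*" for v
      using that by induction (use unf in blast)+
    then show "{v. (t, v) \<in> ?r\<^sup>*} \<subseteq> lfp f" by blast
  qed
  moreover have "lfp_set 7 forwardf w \<sigma> = lfp f" by (simp add: lfp_set_def f_def[abs_def])
  ultimately show ?thesis by simp
qed

lemma lfp_visitf:
  assumes Y: "\<sigma> 4 = Z" "\<sigma> 7 \<subseteq> En"
  shows "lfp_set 8 visitf w \<sigma> = {u. \<exists>v\<in>\<sigma> 7. val w v \<in> val w ` Fs \<and> (v, u) \<in> (succ_rel (En - Z))\<^sup>*}"
proof -
  let ?r = "succ_rel (En - Z)" and ?B = "{v \<in> \<sigma> 7. val w v \<in> val w ` Fs}"
  have iff: "visitf w (\<sigma>(8 := Y, 10 := {v})) \<longleftrightarrow> v \<in> ?B \<or> (\<exists>u\<in>Y. (u, v) \<in> ?r)"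
    if v: "v < length w" for v Y
  proof -
    have "visitf w (\<sigma>(8 := Y, 10 := {v})) \<longleftrightarrow>
      (v \<in> \<sigma> 7 \<and> v \<in> En \<and> (\<exists>q<length w. q \<in> Fs \<and> same_val w {q} {v})) \<or>
      (v \<in> En \<and> v \<notin> Z \<and> (\<exists>u<length w. u \<in> Y \<and> u \<in> En \<and> u \<notin> Z \<and>
        same_val w (next_in w (next_in w (next_in w {u}))) {v}))"
      using v \<sigma> assms unfolding visitf_def keptf_def form_defs by (auto simp: followf_eq)
    also have "\<dots> \<longleftrightarrow> (v \<in> \<sigma> 7 \<and> v \<in> En \<and> (\<exists>q<length w. q \<in> Fs \<and> val w q = val w v)) \<or>
      (v \<in> En \<and> v \<notin> Z \<and> (\<exists>u<length w. u \<in> Y \<and> u \<in> En \<and> u \<notin> Z \<and> tgt_at u = val w v))"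
      by (simp add: follow En_Ts Fs same Ts[OF En_Ts] cong: conj_cong)
    also have "\<dots> \<longleftrightarrow> v \<in> ?B \<or> (\<exists>u\<in>Y. (u, v) \<in> ?r)"
      using Y(2) unfolding ex_less by (auto simp: succ_rel_def) (metis imageI)
    finally show ?thesis .
  qed
  define f where "f Y = {v. v < length w \<and> visitf w (\<sigma>(8 := Y, 10 := {v}))}" for Y
  have f: "f Y = ?B \<union> ?r `` Y" for Y
    using iff[of _ Y] Y(2) En_Ts less_length by (auto simp: f_def succ_rel_def)
  have "lfp f = {u. \<exists>v\<in>?B. (v, u) \<in> ?r\<^sup>*}"
  proof (rule antisym)
    show "lfp f \<subseteq> {u. \<exists>v\<in>?B. (v, u) \<in> ?r\<^sup>*}"
      by (rule lfp_lowerbound) (auto simp: f intro: rtrancl_into_rtrancl)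
    have "mono f" by (rule monoI) (auto simp: f)
    then have unf: "lfp f = ?B \<union> ?r `` lfp f" using lfp_unfold f by metis
    have "u \<in> lfp f" if "(v, u) \<in> ?r\<^sup>*" "v \<in> ?B" for u v
      using that by induction (use unf in blast)+
    then show "{u. \<exists>v\<in>?B. (v, u) \<in> ?r\<^sup>*} \<subseteq> lfp f" by blast
  qed
  moreover have "lfp_set 8 visitf w \<sigma> = lfp f" by (simp add: lfp_set_def f_def[abs_def])
  ultimately show ?thesis by auto
qed

end

lemma badf_iff:
  assumes \<sigma>: "\<sigma> 0 = Is" "\<sigma> 1 = Ts" "\<sigma> 2 = Fs" "\<sigma> 3 = En" and t: "t < length w"
  shows "badf w (\<sigma>(4 := Z, 6 := {t})) \<longleftrightarrow> \<not> (t \<in> En \<and> good (En - Z) t)"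
proof (cases "t \<in> En")
  case True
  let ?s = "\<sigma>(4 := Z, 6 := {t})" and ?r = "succ_rel (En - Z)"
  define U where "U = lfp_set 7 forwardf w ?s"
  define V where "V = lfp_set 8 visitf w (?s(7 := U))"
  have U: "U = {v. (t, v) \<in> ?r\<^sup>*}"
    unfolding U_def using \<sigma> True by (intro lfp_forwardf) auto
  have En_if: "v \<in> En" if "(u, v) \<in> ?r\<^sup>*" "u \<in> En" for u v
    using that by (cases rule: rtranclE) (auto simp: succ_rel_def)
  have UEn: "U \<subseteq> En" using U En_if True by blast
  have V: "V = {u. \<exists>v\<in>U. val w v \<in> val w ` Fs \<and> (v, u) \<in> ?r\<^sup>*}"
    unfolding V_def using \<sigma> UEn lfp_visitf[of "?s(7 := U)" Z] by simp
  have VEn: "V \<subseteq> En" using V UEn En_if by blast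
  have "badf w ?s \<longleftrightarrow> \<not> ((\<exists>z<length w. z \<in> En \<and> z \<notin> Z \<and>
      (\<forall>r<length w. r \<in> next_in w {z} \<longrightarrow> w ! r \<noteq> 1) \<and>
      same_val w (next_in w (next_in w {z})) (next_in w (next_in w {t}))) \<and>
      (\<exists>u<length w. u \<in> V \<and> u \<in> En \<and> same_val w (next_in w (next_in w (next_in w {u}))) {t}))"
    using t True \<sigma> unfolding badf_def keptf_def form_defs U_def[symmetric] V_def[symmetric]
    by (simp add: followf_eq msgf_eq sendf_eq cong: conj_cong) blast
  also have "\<dots> \<longleftrightarrow> \<not> ((\<exists>z<length w. z \<in> En \<and> z \<notin> Z \<and> sends z (bop_msg (op_at z)) \<and>
      bop_msg (op_at z) = bop_msg (op_at t)) \<and> (\<exists>u<length w. u \<in> V \<and> u \<in> En \<and> tgt_at u = val w t))"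
    using True by (simp add: follow msg send[unfolded One_nat_def] En_Ts cong: conj_cong)
  also have "(\<exists>z<length w. z \<in> En \<and> z \<notin> Z \<and> sends z (bop_msg (op_at z)) \<and>
      bop_msg (op_at z) = bop_msg (op_at t)) \<longleftrightarrow> (\<exists>z\<in>En - Z. sends z (bop_msg (op_at t)))"
    unfolding sends_other[of _ t] using En_Ts less_length by blast
  also have "(\<exists>u<length w. u \<in> V \<and> u \<in> En \<and> tgt_at u = val w t) \<longleftrightarrow> (\<exists>u\<in>V. tgt_at u = val w t)"
    using VEn En_Ts less_length by blast
  finally show ?thesis
    using True unfolding good_def V U by (simp del: fun_upd_apply) blast
next
  case False
  then show ?thesis using \<sigma> by (auto simp: badf_def form_defs)
qed

lemma fairf_iff:
  assumes \<sigma>: "\<sigma> 0 = Is" "\<sigma> 1 = Ts" "\<sigma> 2 = Fs"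
  shows "fairf w \<sigma> \<longleftrightarrow> fair_live (val w ` Is) delta (val w ` Fs)"
proof -
  let ?s = "\<sigma>(3 := En)"
  define f where "f Z = {t. t < length w \<and> \<not> (t \<in> En \<and> good (En - Z) t)}" for Z
  define Z where "Z = lfp f"
  have s: "?s 0 = Is" "?s 1 = Ts" "?s 2 = Fs" "?s 3 = En" using \<sigma> by simp_all
  have "lfp_set 4 badf w ?s = Z"
    using badf_iff[OF s] by (simp add: lfp_set_def Z_def f_def[abs_def] cong: conj_cong del: fun_upd_apply)
  then have "fairf w \<sigma> \<longleftrightarrow> (\<exists>t<length w. t \<in> En \<and> t \<notin> Z)"
    unfolding fairf_def keptf_def form_defs lfp_enf[OF \<sigma>] by auto
  also have "\<dots> \<longleftrightarrow> (\<exists>t\<in>En. t \<notin> Z)"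
    using En_Ts less_length by blast
  also have "\<dots> \<longleftrightarrow> (\<exists>X\<subseteq>En. X \<noteq> {} \<and> (\<forall>t\<in>X. good X t))"
  proof
    assume "\<exists>t\<in>En. t \<notin> Z"
    \<comment> \<open>\<open>Z\<close> is a fixed point of \<open>f\<close>, so a fireable
      transition outside \<open>Z\<close> escapes \<open>f Z\<close> and is good for
      \<open>En - Z\<close>.\<close>
    moreover have "good (En - Z) t" if "t \<in> En - Z" for t
    proof -
      have rel: "succ_rel X \<subseteq> succ_rel Y" if "X \<subseteq> Y" for X Y using that by (auto simp: succ_rel_def)
      have good: "good X t \<Longrightarrow> good Y t" if "X \<subseteq> Y" for X Y t
        using that rtrancl_mono[OF rel[OF that]] unfolding good_def by blast
      have "mono f"
      proof
        fix X Y :: "nat set" assume "X \<subseteq> Y"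
        then have "En - Y \<subseteq> En - X" by blast
        from good[OF this] show "f X \<subseteq> f Y" by (auto simp: f_def)
      qed
      then have "t \<notin> f Z" using that lfp_unfold[of f] by (simp add: Z_def)
      then show ?thesis using that En_Ts less_length by (auto simp: f_def)
    qed
    ultimately show "\<exists>X\<subseteq>En. X \<noteq> {} \<and> (\<forall>t\<in>X. good X t)"
      by (intro exI[of _ "En - Z"]) auto
  next
    assume "\<exists>X\<subseteq>En. X \<noteq> {} \<and> (\<forall>t\<in>X. good X t)"
    then obtain X where X: "X \<subseteq> En" "X \<noteq> {}" "\<forall>t\<in>X. good X t" by blast
    \<comment> \<open>The complement of any self-supporting set is closed under \<open>f\<close>, so
      the least fixed point avoids that set.\<close>
    have "En - - X = X" using X by blast
    then have "f (- X) \<subseteq> - X" using X by (auto simp: f_def)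
    then have "Z \<subseteq> - X" unfolding Z_def by (rule lfp_lowerbound)
    then show "\<exists>t\<in>En. t \<notin> Z" using X by blast
  qed
  also have "\<dots> \<longleftrightarrow> fair_live (val w ` Is) delta (val w ` Fs)"
    by (rule fair_live_iff_good_set[symmetric])
  finally show ?thesis .
qed

end

subsection \<open>The encoding of instances\<close>

text \<open>States 0 and 1 read the unary numbers \<open>n\<close> and \<open>m\<close>; 2 and 3 the initial states; 4 to 8 the
  transitions; 9 and 10 the final states. The states 2, 4, 9 mark the beginning of an entry.\<close>

definition scan :: "nat \<Rightarrow> nat \<Rightarrow> nat" where
  "scan q s =
     (if s = 1 then (if q = 2 then 3 else if q = 4 then 5 else if q = 9 then 10 else q)
      else if s = 2 then [1, 2, 2, 2, 6, 6, 7, 8, 4, 9, 9, 11] ! q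
      else if q = 2 then 4 else if q = 4 then 9 else 11)"

lemma scan_less: "q < 12 \<Longrightarrow> scan q s < 12"
proof -
  assume "q < 12"
  then have "q \<in> {0, 1, 2, 3, 4, 5, 6, 7, 8, 9, 10, 11}" unfolding insert_iff empty_iff by presburger
  then show ?thesis by (auto simp: scan_def)
qed

text \<open>In the states that mark the beginning of an entry, the letter 3 ends the section
  instead. The test excludes 3 and does not require 1, because an entry of value 0 starts with its
  terminator 2.\<close>

definition entries :: "nat \<Rightarrow> nat list \<Rightarrow> nat set" where
  "entries c w = {p. p < length w \<and> foldl scan 0 (take p w) = c \<and> w ! p \<noteq> 3}"

definition mark :: "nat \<Rightarrow> nat \<Rightarrow> prog" where
  "mark x c = upd 18 x (\<lambda>q s. if q < 12 then scan q (fst s) else q) 0 (\<lambda>q s. q = c \<and> fst s \<noteq> 3)"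

lemma realizable_mark: "x < 18 \<Longrightarrow> realizable 18 (mark x c)"
  unfolding mark_def by (rule realizable_upd[of _ _ _ 12]) (auto simp: scan_less)

lemma mark_eq: "mark x c w \<sigma> = (False, \<sigma>(x := entries c w))"
proof -
  have mem: "mem 18 (\<lambda>q s. if q < 12 then scan q (fst s) else q) 0 w \<sigma> p = foldl scan 0 (take p w) \<and>
      foldl scan 0 (take p w) < 12" if "p \<le> length w" for p
    using that
  proof (induction p)
    case (Suc p)
    then show ?case using scan_less by (simp add: take_Suc_conv_app_nth cell_def)
  qed simp
  have "{p. p < length w \<and> mem 18 (\<lambda>q s. if q < 12 then scan q (fst s) else q) 0 w \<sigma> p = c \<and>
      fst (cell 18 w \<sigma> p) \<noteq> 3} = entries c w"
    using mem by (auto simp: entries_def cell_def)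
  then show ?thesis by (simp add: mark_def upd_def)
qed

section \<open>Entries of an encoded instance, seen as suffixes\<close>

fun sufs :: "nat \<Rightarrow> nat \<Rightarrow> nat list \<Rightarrow> nat list set" where
  "sufs q c [] = {}"
| "sufs q c (s # u) = (if q = c \<and> s \<noteq> 3 then {s # u} else {}) \<union> sufs (scan q s) c u"

text \<open>Passing from positions to suffixes removes index arithmetic: an encoding can be peeled
  off from the left, block by block, and values depend on the suffix alone.\<close>

lemma sufs_eq: "(\<lambda>p. drop p u) ` {p. p < length u \<and> foldl scan q (take p u) = c \<and> u ! p \<noteq> 3} = sufs q c u"
proof (induction u arbitrary: q)
  case (Cons s u)
  let ?A = "{p. p < length u \<and> foldl scan (scan q s) (take p u) = c \<and> u ! p \<noteq> 3}"
  have "{p. p < length (s # u) \<and> foldl scan q (take p (s # u)) = c \<and> (s # u) ! p \<noteq> 3} =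
      (if q = c \<and> s \<noteq> 3 then {0} else {}) \<union> Suc ` ?A"
    by (rule set_eqI, rename_tac p, case_tac p) auto
  then show ?case using Cons[of "scan q s"] by (auto simp: image_Un image_image)
qed simp

definition vl :: "nat list \<Rightarrow> nat" where
  "vl u = length (takeWhile ((=) 1) u)"

definition nxt :: "nat list \<Rightarrow> nat list" where
  "nxt u = drop (vl u + 1) u"

definition triple :: "nat list \<Rightarrow> nat \<times> nat bop \<times> nat" where
  "triple u = (vl u, (if vl (nxt u) = 0 then Snd else Rcv) (vl (nxt (nxt u))), vl (nxt (nxt (nxt u))))"

definition wf1 :: "nat list \<Rightarrow> bool" where
  "wf1 u \<longleftrightarrow> vl u < length u"

lemma val_vl: "val w p = vl (drop p w)"
  by (simp add: val_def vl_def)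

lemma drop_next_block: "drop (next_block w p) w = nxt (drop p w)"
  by (simp add: nxt_def next_block_def val_vl add_ac)

lemma block_at_wf1: "block_at w p \<longleftrightarrow> wf1 (drop p w)"
  by (auto simp: block_at_def wf1_def val_vl)

definition blk :: "nat \<Rightarrow> nat list \<Rightarrow> nat list" where
  "blk k u = replicate k 1 @ 2 # u"

lemma blk_simps [simp]: "vl (blk k u) = k" "nxt (blk k u) = u" "wf1 (blk k u)"
proof -
  show v: "vl (blk k u) = k" by (induction k) (auto simp: vl_def blk_def)
  show "nxt (blk k u) = u" by (simp add: nxt_def v) (simp add: blk_def)
  show "wf1 (blk k u)" by (simp add: wf1_def v) (simp add: blk_def)
qed

lemma sufs_blk_other:
  assumes "scan q 1 = q" and "q \<noteq> c"
  shows "sufs q c (blk k u) = sufs (scan q 2) c u"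
  using assms by (induction k) (auto simp: blk_def)

text \<open>The first one of a block moves the automaton from \<open>q\<close> to the inner state
  \<open>r\<close>, so a block contributes its first position only. The equation for the terminator
  covers the empty block, which is left directly from \<open>q\<close>.\<close>

lemma sufs_blk_start:
  assumes "scan q 1 = r" and "scan r 1 = r" and "r \<noteq> c" and "scan r 2 = scan q 2"
  shows "sufs q c (blk k u) = (if q = c then {blk k u} else {}) \<union> sufs (scan q 2) c u"
proof (cases k)
  case (Suc j)
  have "sufs r c (blk j u) = sufs (scan q 2) c u"
    using sufs_blk_other[of r c j u] assms by simp
  then show ?thesis using assms(1) Suc by (simp add: blk_def)
qed (simp add: blk_def)

definition numbers :: "nat list \<Rightarrow> nat list \<Rightarrow> nat list" where
  "numbers xs u = concat (map enc_nat xs) @ 3 # u"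

lemma numbers_simps: "numbers [] u = 3 # u" "numbers (x # xs) u = blk x (numbers xs u)"
  by (simp_all add: numbers_def enc_nat_def blk_def)

lemma enc_instance_eq:
  "enc_instance n m I T F = blk n (blk m (numbers I (numbers (concat (map trans_nats T)) (numbers F []))))"
  by (simp add: enc_instance_def numbers_def enc_nats_def enc_nat_def blk_def)

lemma sufs_numbers:
  assumes "q = 2 \<or> q = 9"
  shows "vl ` sufs q q (numbers xs u) = set xs \<union> vl ` sufs (scan q 3) q u"
    and "(\<forall>v\<in>sufs (scan q 3) q u. wf1 v) \<Longrightarrow> v \<in> sufs q q (numbers xs u) \<Longrightarrow> wf1 v"
proof -
  have blk: "sufs q q (blk x y) = {blk x y} \<union> sufs q q y" for x y
    using assms sufs_blk_start[of 2 3 2] sufs_blk_start[of 9 10 9] by (auto simp: scan_def)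
  show "vl ` sufs q q (numbers xs u) = set xs \<union> vl ` sufs (scan q 3) q u"
    by (induction xs) (auto simp: numbers_simps blk)
  show "(\<forall>v\<in>sufs (scan q 3) q u. wf1 v) \<Longrightarrow> v \<in> sufs q q (numbers xs u) \<Longrightarrow> wf1 v"
    by (induction xs) (auto simp: numbers_simps blk)
qed

lemma sufs_numbers_other:
  assumes "q = 2 \<or> q = 9" and "c \<in> {2, 4, 9}" and "c \<noteq> q"
  shows "sufs q c (numbers xs u) = sufs (scan q 3) c u"
proof (induction xs)
  case (Cons x xs)
  have "sufs q c (blk x y) = sufs q c y" for y
    using assms sufs_blk_start[of 2 3 c] sufs_blk_start[of 9 10 c] by (auto simp: scan_def)
  then show ?case using Cons by (simp add: numbers_simps)
qed (use assms in \<open>simp add: numbers_simps\<close>)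

definition wf4 :: "nat list \<Rightarrow> bool" where
  "wf4 u \<longleftrightarrow> wf1 u \<and> wf1 (nxt u) \<and> wf1 (nxt (nxt u)) \<and> wf1 (nxt (nxt (nxt u)))"

lemma numbers_trans:
  "\<exists>k. numbers (trans_nats (q, b, q') @ xs) u = blk q (blk k (blk (bop_msg b) (blk q' (numbers xs u)))) \<and>
     (if k = 0 then Snd else Rcv) (bop_msg b) = b"
proof (cases b)
  case (Snd a)
  then show ?thesis by (intro exI[of _ 0]) (simp add: numbers_simps)
next
  case (Rcv a)
  then show ?thesis by (intro exI[of _ 1]) (simp add: numbers_simps)
qed

text \<open>\<open>scan\<close> returns to state 4 after four blocks, and the three blocks read in
  the states 6, 7, 8 start no entry, so each transition contributes exactly one suffix.\<close>

lemma sufs_quad: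
  assumes "c \<in> {2, 4, 9}"
  shows "sufs 4 c (blk q (blk k (blk a (blk q' u)))) =
    (if c = 4 then {blk q (blk k (blk a (blk q' u)))} else {}) \<union> sufs 4 c u"
proof -
  have "sufs 6 c (blk k (blk a (blk q' u))) = sufs 4 c u"
    using assms sufs_blk_other[of 6 c] sufs_blk_other[of 7 c] sufs_blk_other[of 8 c]
    by (auto simp: scan_def)
  then show ?thesis
    using assms sufs_blk_start[of 4 5 c] by (auto simp: scan_def)
qed

lemma sufs_trans:
  shows "triple ` sufs 4 4 (numbers (concat (map trans_nats ts)) u) = set ts \<union> triple ` sufs 9 4 u"
    and "(\<forall>v\<in>sufs 9 4 u. wf4 v) \<Longrightarrow> v \<in> sufs 4 4 (numbers (concat (map trans_nats ts)) u) \<Longrightarrow> wf4 v"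
    and "c = 2 \<or> c = 9 \<Longrightarrow> sufs 4 c (numbers (concat (map trans_nats ts)) u) = sufs 9 c u"
proof (induction ts)
  case Nil
  have "scan 4 3 = 9" by (simp add: scan_def)
  then show "triple ` sufs 4 4 (numbers (concat (map trans_nats [])) u) = set [] \<union> triple ` sufs 9 4 u"
    and "(\<forall>v\<in>sufs 9 4 u. wf4 v) \<Longrightarrow> v \<in> sufs 4 4 (numbers (concat (map trans_nats [])) u) \<Longrightarrow> wf4 v"
    and "c = 2 \<or> c = 9 \<Longrightarrow> sufs 4 c (numbers (concat (map trans_nats [])) u) = sufs 9 c u"
    by (auto simp: numbers_simps)
next
  case (Cons t ts)
  obtain q b q' where t: "t = (q, b, q')" by (cases t)
  have "concat (map trans_nats (t # ts)) = trans_nats (q, b, q') @ concat (map trans_nats ts)"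
    by (simp add: t)
  then obtain k where k: "numbers (concat (map trans_nats (t # ts))) u =
      blk q (blk k (blk (bop_msg b) (blk q' (numbers (concat (map trans_nats ts)) u))))"
    "(if k = 0 then Snd else Rcv) (bop_msg b) = b"
    using numbers_trans[of q b q' "concat (map trans_nats ts)" u] by (simp only:) blast
  show "triple ` sufs 4 4 (numbers (concat (map trans_nats (t # ts))) u) = set (t # ts) \<union> triple ` sufs 9 4 u"
  proof -
    have "triple (blk q (blk k (blk (bop_msg b) (blk q' (numbers (concat (map trans_nats ts)) u))))) = t"
      by (simp only: triple_def blk_simps k(2) t)
    then show ?thesis unfolding k(1) using Cons(1) by (simp add: sufs_quad)
  qed
  show "v \<in> sufs 4 4 (numbers (concat (map trans_nats (t # ts))) u) \<Longrightarrow> wf4 v" if "\<forall>v\<in>sufs 9 4 u. wf4 v"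
    unfolding k(1) using Cons(2)[OF that] by (auto simp: sufs_quad wf4_def)
  show "sufs 4 c (numbers (concat (map trans_nats (t # ts))) u) = sufs 9 c u" if "c = 2 \<or> c = 9"
  proof -
    have "c \<in> {2, 4, 9}" "c \<noteq> 4" using that by auto
    then show ?thesis unfolding k(1) sufs_quad[OF \<open>c \<in> {2, 4, 9}\<close>] using Cons(3)[OF that] by simp
  qed
qed

context
  fixes n m :: nat and I F :: "nat list" and T :: "(nat \<times> nat bop \<times> nat) list" and w
  assumes w: "w = enc_instance n m I T F"
begin

lemma sufs_enc:
  "vl ` sufs 0 2 w = set I" "triple ` sufs 0 4 w = set T" "vl ` sufs 0 9 w = set F"
  "v \<in> sufs 0 2 w \<Longrightarrow> wf1 v" "v \<in> sufs 0 4 w \<Longrightarrow> wf4 v" "v \<in> sufs 0 9 w \<Longrightarrow> wf1 v"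
proof -
  have scan3: "scan 2 3 = 4" "scan 9 3 = 11" by (simp_all add: scan_def)
  have pre: "sufs 0 c w = sufs 2 c (numbers I (numbers (concat (map trans_nats T)) (numbers F [])))"
    if "c \<in> {2, 4, 9}" for c
    using that sufs_blk_other[of 0 c] sufs_blk_other[of 1 c] by (auto simp: w enc_instance_eq scan_def)
  have last: "sufs 9 c (numbers F []) = {}" if "c \<in> {2, 4}" for c
    using that sufs_numbers_other[of 9 c F "[]"] by auto
  have s2: "sufs 4 2 (numbers (concat (map trans_nats T)) (numbers F [])) = {}"
    using sufs_trans(3)[of 2] last by simp
  have s4: "sufs 0 4 w = sufs 4 4 (numbers (concat (map trans_nats T)) (numbers F []))"
    using pre[of 4] sufs_numbers_other[of 2 4] scan3 by simp
  have s9: "sufs 0 9 w = sufs 9 9 (numbers F [])"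
    using pre[of 9] sufs_numbers_other[of 2 9] sufs_trans(3)[of 9] scan3 by simp
  show "vl ` sufs 0 2 w = set I"
    using pre[of 2] sufs_numbers(1)[of 2] scan3 s2 by simp
  show "triple ` sufs 0 4 w = set T"
    using s4 sufs_trans(1) last by simp
  show "vl ` sufs 0 9 w = set F"
    using s9 sufs_numbers(1)[of 9] by simp
  show "v \<in> sufs 0 2 w \<Longrightarrow> wf1 v"
    using pre[of 2] sufs_numbers(2)[of 2 "numbers (concat (map trans_nats T)) (numbers F [])" v I] scan3 s2
    by simp
  show "v \<in> sufs 0 4 w \<Longrightarrow> wf4 v"
    using s4 sufs_trans(2)[of "numbers F []"] last by simp
  show "v \<in> sufs 0 9 w \<Longrightarrow> wf1 v"
    using s9 sufs_numbers(2)[of 9 "[]"] by simp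
qed

lemma entries_sufs: "(\<lambda>p. drop p w) ` entries c w = sufs 0 c w"
  unfolding entries_def by (rule sufs_eq)

lemma parsed_enc: "parsed_word w (entries 2 w) (entries 4 w) (entries 9 w)"
proof
  have in_sufs: "drop p w \<in> sufs 0 c w" if "p \<in> entries c w" for p c
    using that entries_sufs by blast
  show "block_at w p" if "p \<in> entries 2 w" for p
    using sufs_enc(4) in_sufs[OF that] by (simp add: block_at_wf1)
  show "block_at w p" if "p \<in> entries 9 w" for p
    using sufs_enc(6) in_sufs[OF that] by (simp add: block_at_wf1)
  show "block_at w p \<and> block_at w (next_block w p) \<and> block_at w (next_block w (next_block w p)) \<and>
      block_at w (next_block w (next_block w (next_block w p)))" if "p \<in> entries 4 w" for p
    using sufs_enc(5) in_sufs[OF that] by (simp add: block_at_wf1 drop_next_block wf4_def)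
qed

lemma fairf_enc:
  assumes "\<sigma> 0 = entries 2 w" "\<sigma> 1 = entries 4 w" "\<sigma> 2 = entries 9 w"
  shows "fairf w \<sigma> \<longleftrightarrow> fair_live (set I) (set T) (set F)"
proof -
  interpret parsed_word w "entries 2 w" "entries 4 w" "entries 9 w" by (rule parsed_enc)
  have vals: "val w ` entries c w = vl ` sufs 0 c w" for c
    unfolding entries_sufs[symmetric] image_image val_vl ..
  have "delta = triple ` sufs 0 4 w"
    unfolding entries_sufs[symmetric] delta_def image_image
    by (simp add: triple_def op_at_def tgt_at_def val_vl drop_next_block)
  then show ?thesis
    using fairf_iff[OF assms] sufs_enc(1-3) by (simp add: vals)
qed

end

section \<open>Assembling the machine\<close>

lemma realizable_decides:
  assumes "realizable K F"
  shows "\<exists>N M c d. tm_wf N M \<and> (\<forall>w. w \<noteq> [] \<longrightarrow> set w \<subseteq> {1, 2, 3} \<longrightarrow>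
    tm_decides_within M (c * (length w + 1) ^ d) w (fst (F w (\<lambda>_. {}))))"
proof -
  define A :: nat where "A = 4 * 2 ^ K"
  obtain Q g B where F: "realizes K Q g B F" using assms unfolding realizable_def by blast
  \<comment> \<open>State 0 moves from the first letter to the blank at its left, where the fragment
    begins in state 3. The exits of the fragment are the accepting state 1 and the rejecting state
    2.\<close>
  define M :: tm where "M q s = (if q = 0 then (3, s, Lft)
    else if 3 \<le> q \<and> q < 3 + Q \<and> s < A then g 3 1 2 (q - 3) s else (0, 0, Stay))" for q s
  define N where "N = A + Q + 4"
  have inst: "installed A M Q g 3 1 2" by (simp add: installed_def M_def)
  have ok: "frag_ok A Q g" using F by (simp add: realizes_def A_def)
  have "tm_wf N M"
    unfolding tm_wf_def
  proof (intro conjI allI impI)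
    show "3 < N" by (simp add: N_def)
    fix q s assume "q < N" "s < N"
    show "fst (M q s) < N" "fst (snd (M q s)) < N"
    proof (atomize (full), cases "3 \<le> q \<and> q < 3 + Q \<and> s < A")
      case True
      then have "q - 3 < Q" by linarith
      then obtain q' s' d where "g 3 1 2 (q - 3) s = (q', s', d)"
        "s' < A \<and> (3 \<le> q' \<and> q' < 3 + Q \<or> q' = 1 \<or> q' = 2)"
        using frag_okD[OF ok] True by blast
      then show "fst (M q s) < N \<and> fst (snd (M q s)) < N"
        using True by (auto simp: M_def N_def)
    qed (use \<open>s < N\<close> in \<open>auto simp: M_def N_def\<close>)
  qed
  moreover obtain c d where cd: "\<And>L. Suc (B L) \<le> c * (L + 1) ^ d"
  proof -
    have "poly_bound (\<lambda>L. 1 + B L)"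
      using F by (intro poly_bound_add poly_bound_const) (simp add: realizes_def)
    then show thesis using that unfolding poly_bound_def by auto
  qed
  have "tm_decides_within M (c * (length w + 1) ^ d) w (fst (F w (\<lambda>_. {})))"
    if w: "w \<noteq> []" "set w \<subseteq> {1, 2, 3}" for w
  proof -
    \<comment> \<open>With all bits unset a cell is encoded by its letter, so the input needs no
      preparation.\<close>
    have tape: "tape K w (\<lambda>_. {}) = w"
      by (rule nth_equalityI) (auto simp: tape_def cell_def enc_cell_def)
    obtain x u where xu: "w = x # u" using w(1) by (cases w) auto
    have "tm_step M (tm_init w) = home 3 w 0"
      by (simp add: xu home_def tm_step.simps M_def)
    moreover obtain t z where t: "t \<le> B (length w)" "reaches M t (home 3 (tape K w (\<lambda>_. {})) 0)
        (home (if fst (F w (\<lambda>_. {})) then 1 else 2) (tape K w (snd (F w (\<lambda>_. {})))) z)"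
      using realizesD[OF F order_refl inst[unfolded A_def] w(2)] by blast
    ultimately have "reaches M (Suc t) (tm_init w)
        (home (if fst (F w (\<lambda>_. {})) then 1 else 2) (tape K w (snd (F w (\<lambda>_. {})))) z)"
      using reaches_Suc[of M "tm_init w" "home 3 w 0"] tape by simp
    moreover have "Suc t \<le> c * (length w + 1) ^ d" using t(1) cd[of "length w"] by linarith
    ultimately show ?thesis
      unfolding tm_decides_within_def reaches_def
      by (intro exI[of _ "Suc t"]) (simp add: home_def)
  qed
  ultimately show ?thesis by blast
qed

theorem theorem2:
  shows "\<exists>N M c d. tm_wf N M \<and>
    (\<forall>n m I T F. valid_instance n m I T F \<longrightarrow>
       tm_decides_within M (c * (length (enc_instance n m I T F) + 1) ^ d)
         (enc_instance n m I T F) (fair_live (set I) (set T) (set F)))"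
proof -
  obtain G where G: "realizable 18 G" "\<And>w \<sigma>. fst (G w \<sigma>) = fairf w \<sigma>"
    using testable_fairf unfolding testable_def by blast
  \<comment> \<open>The machine starts with all tracks empty. \<open>mark\<close> always answers no,
    so the three tracks read by \<open>fairf\<close> are filled one after the other before
    \<open>G\<close> runs.\<close>
  define D where "D = ifc (mark 0 2) (skip 18) (ifc (mark 1 4) (skip 18) (ifc (mark 2 9) (skip 18) G))"
  have "realizable 18 D"
    unfolding D_def using G(1) by (intro realizable_intros realizable_mark) simp_all
  then obtain N M c d where M: "tm_wf N M" "\<And>w. w \<noteq> [] \<Longrightarrow> set w \<subseteq> {1, 2, 3} \<Longrightarrow>
      tm_decides_within M (c * (length w + 1) ^ d) w (fst (D w (\<lambda>_. {})))"
    using realizable_decides by metis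
  have "tm_decides_within M (c * (length w + 1) ^ d) w (fair_live (set I) (set T) (set F))"
    if w: "w = enc_instance n m I T F" for n m I T F w
  proof -
    have "set w \<subseteq> {1, 2, 3}" "w \<noteq> []"
      by (auto simp: w enc_instance_def enc_nats_def enc_nat_def)
    moreover have "fst (D w (\<lambda>_. {})) = fair_live (set I) (set T) (set F)"
      using fairf_enc[OF w] by (simp add: D_def ifc_def mark_eq G(2))
    ultimately show ?thesis using M(2)[of w] by simp
  qed
  then show ?thesis using M(1) by blast
qed

end
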